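(* Let $d\ge 1$ and let $(s,p,r)\in\mathbb{R}\times[1,+\infty]^2$ be such that $s>d/p$, or $s=d/p$ and $r>1$ (with the convention $d/p=0$ if $p=+\infty$). Then: (i) the subspace $\mathcal{S}'_h\cap\dot{B}^s_{p,r}$ is not closed in $\dot{B}^s_{p,r}$; (ii) the subspace $\mathcal{S}'_h\cap\dot{B}^s_{p,r}$ is dense in $\dot{B}^s_{p,r}$ if and only if $r<+\infty$.
   Context: All function spaces are spaces of complex-valued functions or distributions on $\mathbb{R}^d$; $\mathcal{S}$ is the Schwartz space and $\mathcal{S}'$ the space of tempered distributions. Fix a smooth radial function $\chi:\mathbb{R}^d\to\mathbb{R}$ supported in the ball $B(0,2)$, equal to $1$ in a neighborhood of $B(0,1)$, and such that $r\mapsto\chi(re)$ is nonincreasing on $\mathbb{R}_+$ for every unit vector $e$. Set $\varphi(\xi)=\chi(\xi)-\chi(2\xi)$. For a function $\sigma$, $\sigma(D)$ denotes the Fourier multiplier $f\mapsto\mathcal{F}^{-1}[\sigma(\xi)\widehat f(\xi)]$. The homogeneous dyadic blocks are $\dot\Delta_m=\varphi(2^{-m}D)$, $m\in\mathbb{Z}$. $\mathcal{S}'_h$ is the space of $f\in\mathcal{S}'$ such that $\chi(\lambda\xi)\widehat f(\xi)\to 0$ in $\mathcal{S}'$ as $\lambda\to+\infty$. Let $\mathcal{S}'/\mathcal{P}$ be the quotient of $\mathcal{S}'$ by the space $\mathcal{P}$ of polynomial functions on $\mathbb{R}^d$; the operators $\dot\Delta_m$ annihilate polynomials and hence are well defined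 on $\mathcal{S}'/\mathcal{P}$. The homogeneous Besov space $\dot{B}^s_{p,r}$ is the Banach space of those $f\in\mathcal{S}'/\mathcal{P}$ such that $\|f\|_{\dot{B}^s_{p,r}}=\big\|\big(2^{ms}\|\dot\Delta_m f\|_{L^p}\big)_{m\in\mathbb{Z}}\big\|_{\ell^r(\mathbb{Z})}<+\infty$. Since $\mathcal{S}'_h$ contains no nonzero polynomial, the natural map $\mathcal{S}'_h\to\mathcal{S}'/\mathcal{P}$ is injective, and $\mathcal{S}'_h\cap\dot{B}^s_{p,r}$ denotes the subspace of those classes in $\dot{B}^s_{p,r}$ that have a representative in $\mathcal{S}'_h$. *)

theory Defs
  imports "HOL-Analysis.Analysis" "HOL-Probability.Essential_Supremum"
begin

section \<open>Schwartz functions\<close>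

primrec iter_deriv ::
    "'a::real_normed_vector list \<Rightarrow> ('a \<Rightarrow> 'b::real_normed_vector) \<Rightarrow> 'a \<Rightarrow> 'b" where
  "iter_deriv [] f = f"
| "iter_deriv (v # vs) f = (\<lambda>x. frechet_derivative (iter_deriv vs f) (at x) v)"

definition smooth :: "('a::euclidean_space \<Rightarrow> 'b::real_normed_vector) \<Rightarrow> bool" where
  "smooth f \<longleftrightarrow> (\<forall>vs. set vs \<subseteq> Basis \<longrightarrow> (\<forall>x. iter_deriv vs f differentiable (at x)))"

definition schwartz :: "('a::euclidean_space \<Rightarrow> complex) set" where
  "schwartz = {f. smooth f \<and>
     (\<forall>k vs. set vs \<subseteq> Basis \<longrightarrow> bounded (range (\<lambda>x. (1 + norm x) ^ k *\<^sub>R iter_deriv vs f x)))}"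

definition schwartz_seminorm :: "nat \<Rightarrow> ('a::euclidean_space \<Rightarrow> complex) \<Rightarrow> real" where
  "schwartz_seminorm k f =
     Sup {(1 + norm x) ^ k * norm (iter_deriv vs f x) | vs x. set vs \<subseteq> Basis \<and> length vs \<le> k}"

definition fourier :: "('a::euclidean_space \<Rightarrow> complex) \<Rightarrow> 'a \<Rightarrow> complex" where
  "fourier f \<xi> = (LINT x|lborel. cis (- (x \<bullet> \<xi>)) * f x)"

definition inv_fourier :: "('a::euclidean_space \<Rightarrow> complex) \<Rightarrow> 'a \<Rightarrow> complex" where
  "inv_fourier f x = (LINT \<xi>|lborel. cis (x \<bullet> \<xi>) * f \<xi>) / of_real ((2 * pi) ^ DIM('a))"

section \<open>Tempered distributions\<close>

text \<open>A distribution is a functional on all functions, normalised to be zero off the Schwartz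
  space, so that equality of distributions is equality in HOL.  Continuity for the Frechet
  topology of the Schwartz space means domination by one of the (increasing) seminorms above.\<close>

type_synonym 'a functional = "('a \<Rightarrow> complex) \<Rightarrow> complex"

definition tempered :: "'a::euclidean_space functional set" where
  "tempered = {u.
     (\<forall>f. f \<notin> schwartz \<longrightarrow> u f = 0) \<and>
     (\<forall>f\<in>schwartz. \<forall>g\<in>schwartz. \<forall>a b. u (\<lambda>x. a * f x + b * g x) = a * u f + b * u g) \<and>
     (\<exists>C k. \<forall>f\<in>schwartz. norm (u f) \<le> C * schwartz_seminorm k f)}"

definition tempered_diff :: "'a::euclidean_space functional \<Rightarrow> 'a functional \<Rightarrow> 'a functional" where
  "tempered_diff u v = (\<lambda>f. u f - v f)"

text \<open>\<open>represents g u\<close>: the distribution \<open>u\<close> is the function \<open>g\<close>.\<close>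

definition represents :: "('a::euclidean_space \<Rightarrow> complex) \<Rightarrow> 'a functional \<Rightarrow> bool" where
  "represents g u \<longleftrightarrow> g \<in> borel_measurable borel \<and>
     (\<forall>f\<in>schwartz. integrable lborel (\<lambda>x. g x * f x) \<and> u f = (LINT x|lborel. g x * f x))"

text \<open>The following three operations on distributions are the transposes of the corresponding
  operations on Schwartz functions.\<close>

definition fourier_dist :: "'a::euclidean_space functional \<Rightarrow> 'a functional" where
  "fourier_dist u = (\<lambda>f. if f \<in> schwartz then u (fourier f) else 0)"

definition inv_fourier_dist :: "'a::euclidean_space functional \<Rightarrow> 'a functional" where
  "inv_fourier_dist u = (\<lambda>f. if f \<in> schwartz then u (inv_fourier f) else 0)"

definition mult_dist ::
    "('a::euclidean_space \<Rightarrow> complex) \<Rightarrow> 'a functional \<Rightarrow> 'a functional" where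
  "mult_dist \<sigma> u = (\<lambda>f. if f \<in> schwartz then u (\<lambda>x. \<sigma> x * f x) else 0)"

definition fourier_multiplier ::
    "('a::euclidean_space \<Rightarrow> complex) \<Rightarrow> 'a functional \<Rightarrow> 'a functional" where
  "fourier_multiplier \<sigma> u = inv_fourier_dist (mult_dist \<sigma> (fourier_dist u))"

section \<open>Dyadic blocks\<close>

text \<open>Balls are read as closed balls.\<close>

definition cutoff :: "('a::euclidean_space \<Rightarrow> real) \<Rightarrow> bool" where
  "cutoff chi \<longleftrightarrow> smooth chi \<and>
     (\<forall>x y. norm x = norm y \<longrightarrow> chi x = chi y) \<and>
     closure {x. chi x \<noteq> 0} \<subseteq> cball 0 2 \<and>
     (\<exists>U. open U \<and> cball 0 1 \<subseteq> U \<and> (\<forall>x\<in>U. chi x = 1)) \<and>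
     (\<forall>e. norm e = 1 \<longrightarrow> antimono_on {0..} (\<lambda>t. chi (t *\<^sub>R e)))"

definition dyadic :: "('a::euclidean_space \<Rightarrow> real) \<Rightarrow> 'a \<Rightarrow> real" where
  "dyadic chi \<xi> = chi \<xi> - chi (2 *\<^sub>R \<xi>)"

definition block ::
    "('a::euclidean_space \<Rightarrow> real) \<Rightarrow> int \<Rightarrow> 'a functional \<Rightarrow> 'a functional" where
  "block chi m = fourier_multiplier (\<lambda>\<xi>. of_real (dyadic chi ((2 powi (- m)) *\<^sub>R \<xi>)))"

text \<open>Convergence of distributions is pointwise (weak-star) convergence.\<close>

definition tempered_h :: "('a::euclidean_space \<Rightarrow> real) \<Rightarrow> 'a functional set" where
  "tempered_h chi = {u \<in> tempered. \<forall>f\<in>schwartz.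
     ((\<lambda>t::real. mult_dist (\<lambda>\<xi>. of_real (chi (t *\<^sub>R \<xi>))) (fourier_dist u) f) \<longlongrightarrow> 0) at_top}"

section \<open>Lebesgue norms with values in \<open>[0, \<infinity>]\<close>\<close>

definition ennreal_powr :: "ennreal \<Rightarrow> real \<Rightarrow> ennreal" where
  "ennreal_powr x a = (if x = \<infinity> then \<infinity> else ennreal (enn2real x powr a))"

definition Lnorm :: "ereal \<Rightarrow> 'b measure \<Rightarrow> ('b \<Rightarrow> ennreal) \<Rightarrow> ennreal" where
  "Lnorm p M f =
     (if p = \<infinity> then esssup M f
      else ennreal_powr (\<integral>\<^sup>+x. ennreal_powr (f x) (real_of_ereal p) \<partial>M) (1 / real_of_ereal p))"

text \<open>The norm of a distribution; it is infinite if the distribution is not a function.  The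
  infimum is harmless: representing functions agree almost everywhere.\<close>

definition Lnorm_dist :: "ereal \<Rightarrow> 'a::euclidean_space functional \<Rightarrow> ennreal" where
  "Lnorm_dist p u = Inf {Lnorm p lborel (\<lambda>x. ennreal (norm (g x))) | g. represents g u}"

section \<open>Tempered distributions modulo polynomials and homogeneous Besov spaces\<close>

definition poly_dist :: "'a::euclidean_space functional set" where
  "poly_dist = {u \<in> tempered. \<exists>P. polynomial_function P \<and> represents P u}"

definition tempered_mod_poly :: "'a::euclidean_space functional set set" where
  "tempered_mod_poly =
     tempered // {(u, v). u \<in> tempered \<and> v \<in> tempered \<and> tempered_diff u v \<in> poly_dist}"

definition class_diff ::
    "'a::euclidean_space functional set \<Rightarrow> 'a functional set \<Rightarrow> 'a functional set" where
  "class_diff X Y = {tempered_diff u v | u v. u \<in> X \<and> v \<in> Y}"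

definition besov_norm_rep ::
    "('a::euclidean_space \<Rightarrow> real) \<Rightarrow> real \<Rightarrow> ereal \<Rightarrow> ereal \<Rightarrow> 'a functional \<Rightarrow> ennreal" where
  "besov_norm_rep chi s p r u =
     Lnorm r (count_space UNIV)
       (\<lambda>m::int. ennreal (2 powr (of_int m * s)) * Lnorm_dist p (block chi m u))"

text \<open>All representatives of a class have the same norm, because the blocks annihilate
  polynomials; the norm of the class is this common value.\<close>

definition besov_norm ::
    "('a::euclidean_space \<Rightarrow> real) \<Rightarrow> real \<Rightarrow> ereal \<Rightarrow> ereal \<Rightarrow> 'a functional set \<Rightarrow> ennreal" where
  "besov_norm chi s p r X = the_elem (besov_norm_rep chi s p r ` X)"

definition besov ::
    "('a::euclidean_space \<Rightarrow> real) \<Rightarrow> real \<Rightarrow> ereal \<Rightarrow> ereal \<Rightarrow> 'a functional set set" where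
  "besov chi s p r = {X \<in> tempered_mod_poly. besov_norm chi s p r X < \<infinity>}"

definition besov_h ::
    "('a::euclidean_space \<Rightarrow> real) \<Rightarrow> real \<Rightarrow> ereal \<Rightarrow> ereal \<Rightarrow> 'a functional set set" where
  "besov_h chi s p r = {X \<in> besov chi s p r. \<exists>u\<in>X. u \<in> tempered_h chi}"

definition besov_open ::
    "('a::euclidean_space \<Rightarrow> real) \<Rightarrow> real \<Rightarrow> ereal \<Rightarrow> ereal \<Rightarrow> 'a functional set set \<Rightarrow> bool" where
  "besov_open chi s p r U \<longleftrightarrow> U \<subseteq> besov chi s p r \<and>
     (\<forall>X\<in>U. \<exists>\<epsilon>>0. \<forall>Y\<in>besov chi s p r. besov_norm chi s p r (class_diff Y X) < \<epsilon> \<longrightarrow> Y \<in> U)"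

definition besov_topology ::
    "('a::euclidean_space \<Rightarrow> real) \<Rightarrow> real \<Rightarrow> ereal \<Rightarrow> ereal \<Rightarrow> 'a functional set topology" where
  "besov_topology chi s p r = topology (besov_open chi s p r)"

lemma besov_open_subset: "besov_open chi s p r U \<Longrightarrow> U \<subseteq> besov chi s p r"
  unfolding besov_open_def by (rule conjunct1)

lemma besov_openE:
  assumes "besov_open chi s p r U" and "X \<in> U"
  obtains \<epsilon> where "\<epsilon> > 0"
    "\<And>Y. Y \<in> besov chi s p r \<Longrightarrow> besov_norm chi s p r (class_diff Y X) < \<epsilon> \<Longrightarrow> Y \<in> U"
proof -
  from assms(1) have "\<forall>X\<in>U. \<exists>\<epsilon>>0. \<forall>Y\<in>besov chi s p r.
      besov_norm chi s p r (class_diff Y X) < \<epsilon> \<longrightarrow> Y \<in> U"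
    unfolding besov_open_def by (rule conjunct2)
  from bspec[OF this assms(2)] show thesis by (iprover intro: that dest: bspec)
qed

lemma istopology_besov_open: "istopology (besov_open chi s p r)"
  unfolding istopology_def
proof (intro conjI allI impI)
  fix S T assume S: "besov_open chi s p r S" and T: "besov_open chi s p r T"
  show "besov_open chi s p r (S \<inter> T)"
    unfolding besov_open_def
  proof (intro conjI ballI)
    show "S \<inter> T \<subseteq> besov chi s p r" using besov_open_subset[OF S] by (rule le_infI1)
    fix X assume X: "X \<in> S \<inter> T"
    from S IntD1[OF X] obtain a where a: "a > 0"
        "\<And>Y. Y \<in> besov chi s p r \<Longrightarrow> besov_norm chi s p r (class_diff Y X) < a \<Longrightarrow> Y \<in> S"
      by (rule besov_openE) iprover
    from T IntD2[OF X] obtain b where b: "b > 0"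
        "\<And>Y. Y \<in> besov chi s p r \<Longrightarrow> besov_norm chi s p r (class_diff Y X) < b \<Longrightarrow> Y \<in> T"
      by (rule besov_openE) iprover
    show "\<exists>\<epsilon>>0. \<forall>Y\<in>besov chi s p r.
        besov_norm chi s p r (class_diff Y X) < \<epsilon> \<longrightarrow> Y \<in> S \<inter> T"
    proof (intro exI conjI ballI impI)
      show "min a b > 0" using a(1) b(1) by (simp only: min_less_iff_conj)
      fix Y assume Y: "Y \<in> besov chi s p r"
        and "besov_norm chi s p r (class_diff Y X) < min a b"
      then have "besov_norm chi s p r (class_diff Y X) < a"
          "besov_norm chi s p r (class_diff Y X) < b"
        by (simp_all only: min_less_iff_conj)
      with a(2) b(2) Y show "Y \<in> S \<inter> T" by (iprover intro: IntI)
    qed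
  qed
next
  fix \<K> assume K: "\<forall>K\<in>\<K>. besov_open chi s p r K"
  show "besov_open chi s p r (\<Union>\<K>)"
    unfolding besov_open_def
  proof (intro conjI ballI)
    show "\<Union>\<K> \<subseteq> besov chi s p r" using besov_open_subset[OF bspec[OF K]] by (rule Sup_least)
    fix X assume "X \<in> \<Union>\<K>"
    then obtain K' where K': "K' \<in> \<K>" "X \<in> K'" by (rule UnionE)
    from bspec[OF K K'(1)] K'(2) obtain a where a: "a > 0"
        "\<And>Y. Y \<in> besov chi s p r \<Longrightarrow> besov_norm chi s p r (class_diff Y X) < a \<Longrightarrow> Y \<in> K'"
      by (rule besov_openE) iprover
    show "\<exists>\<epsilon>>0. \<forall>Y\<in>besov chi s p r.
        besov_norm chi s p r (class_diff Y X) < \<epsilon> \<longrightarrow> Y \<in> \<Union>\<K>"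
    proof (intro exI conjI ballI impI)
      show "a > 0" by (rule a(1))
      fix Y assume "Y \<in> besov chi s p r" "besov_norm chi s p r (class_diff Y X) < a"
      then have "Y \<in> K'" by (rule a(2))
      with K'(1) show "Y \<in> \<Union>\<K>" by (rule UnionI)
    qed
  qed
qed

lemma openin_besov_topology: "openin (besov_topology chi s p r) = besov_open chi s p r"
  unfolding besov_topology_def by (rule topology_inverse'[OF istopology_besov_open])

lemma topspace_besov_topology: "topspace (besov_topology chi s p r) = besov chi s p r"
proof (rule antisym)
  show "topspace (besov_topology chi s p r) \<subseteq> besov chi s p r"
    unfolding topspace_def openin_besov_topology
    by (rule Sup_least, drule CollectD, rule besov_open_subset)
  have "besov_open chi s p r (besov chi s p r)"
    unfolding besov_open_def
    by (intro conjI ballI exI[of _ 1] impI order_refl zero_less_one)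
  then show "besov chi s p r \<subseteq> topspace (besov_topology chi s p r)"
    unfolding topspace_def openin_besov_topology by (rule Sup_upper[OF CollectI])
qed

end

theory Submission
  imports Defs "HOL-Probability.Characteristic_Functions" "HOL-Probability.Sinc_Integral"
begin

text \<open>Polynomials have Fourier transform supported at the origin, so a class modulo polynomials is
  tested against Schwartz functions vanishing near the origin.  The counterexamples are sums of
  bumps whose frequencies \<open>8 ^ - (k + 1)\<close> tend to zero, with coefficients \<open>a k\<close>; their Besov norm is
  comparable to the norm in \<open>l^r\<close> of \<open>a k * 8 ^ ((k + 1) (d/p - s))\<close>.

  For (i) take \<open>a k = 1 / (k + 1)\<close>.  The tails tend to zero in norm because \<open>s > d/p\<close> or \<open>r > 1\<close>, and
  partial sums have spectrum away from the origin.  But for a representative of the limit in the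
  space of vanishing low frequencies, testing against a cutoff at larger and larger scales would
  make the harmonic series converge.

  For (ii) with \<open>r = \<infinity>\<close> take \<open>a k = 8 ^ ((k + 1) (s - d/p))\<close>.  Tested against the dyadic annuli,
  the blocks of the sum are bounded below by a multiple of \<open>a k\<close>.  This persists under perturbations
  that are small in norm, whereas these pairings tend to zero for distributions with vanishing low
  frequencies.  If \<open>r < \<infinity>\<close>, then removing the frequencies below \<open>2 ^ - n\<close> changes the norm by the
  tail of a convergent series.\<close>

section \<open>Schwartz functions and their multipliers\<close>

text \<open>In (i) the limit is detected through the sum of its coefficients times the integral of
  the profile \<open>eta\<close>, so this integral must not vanish; then only one power of the
  frequency is gained on test functions, enough for bounded coefficients. In (ii) with
  \<open>r = \<infinity>\<close> the coefficients may grow like a high power of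
  \<open>freq k\<close>; a profile with many vanishing moments is used, its mean is zero,
  low-frequency sums no longer see it, and single annuli are tested instead. Hence a locale over
  \<open>eta\<close>, instantiated twice. The ratio of frequencies is 2 cubed because the profile
  and a dyadic block both live in annuli whose radii have ratio 4: a bump meets at most three
  consecutive blocks, a block at most one bump, and bumps never interact. The norm of a distribution
  is an infimum over representing functions, so lower bounds come from duality with Schwartz
  functions and upper bounds from explicit kernels. Every operation is therefore moved to the test
  function, and the Fourier transform is built on the Schwartz space together with its
  seminorms.\<close>

definition pd :: "'a::real_normed_vector \<Rightarrow> ('a \<Rightarrow> 'b::real_normed_vector) \<Rightarrow> 'a \<Rightarrow> 'b" where
  "pd v f = (\<lambda>x. frechet_derivative f (at x) v)"

lemma iter_deriv_Cons: "iter_deriv (v # vs) f = pd v (iter_deriv vs f)"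
  by (simp add: pd_def)

lemma iter_deriv_append: "iter_deriv (vs @ ws) f = iter_deriv vs (iter_deriv ws f)"
  by (induction vs) simp_all

text \<open>The head of the list is the outermost derivative, so the innermost one sits at the end.
  Moving it into the function is what closure under \<open>pd\<close> and inductions on the inner
  derivative need.\<close>

lemma iter_deriv_snoc: "iter_deriv (vs @ [v]) f = iter_deriv vs (pd v f)"
  by (simp add: iter_deriv_append pd_def)

lemma pd_eq: "(f has_derivative f') (at x) \<Longrightarrow> pd v f x = f' v"
  unfolding pd_def using frechet_derivative_at by metis

lemma pd_const: "pd v (\<lambda>x. c) = (\<lambda>x. 0)"
  using pd_eq[OF has_derivative_const] by fast

lemma has_derivative_pd:
  "f differentiable (at x) \<Longrightarrow> (f has_derivative (\<lambda>h. pd h f x)) (at x)"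
  unfolding pd_def using frechet_derivative_works by blast

text \<open>Coinduction: every iterated derivative of \<open>f\<close> stays in \<open>A\<close>, so
  smoothness follows from differentiability on a stable family, with no formula for higher
  derivatives.\<close>

lemma smoothI:
  assumes "f \<in> A" and diff: "\<And>g x. g \<in> A \<Longrightarrow> g differentiable (at x)"
    and pd: "\<And>g b. g \<in> A \<Longrightarrow> b \<in> Basis \<Longrightarrow> pd b g \<in> A"
  shows "smooth f"
proof -
  have "iter_deriv vs f \<in> A" if "set vs \<subseteq> Basis" for vs
    using that by (induction vs) (auto simp: assms iter_deriv_Cons simp del: iter_deriv.simps(2))
  then show ?thesis unfolding smooth_def using diff by blast
qed

lemma smooth_differentiable: "smooth f \<Longrightarrow> f differentiable (at x)"
  unfolding smooth_def by (metis empty_subsetI iter_deriv.simps(1) list.set(1))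

lemma smooth_pd: "smooth f \<Longrightarrow> b \<in> Basis \<Longrightarrow> smooth (pd b f)"
  unfolding smooth_def
  by (metis iter_deriv_snoc insert_subset list.simps(15) set_append Un_insert_right list.set(1) sup_bot.right_neutral)

lemma smooth_iter_deriv: "smooth f \<Longrightarrow> set vs \<subseteq> Basis \<Longrightarrow> smooth (iter_deriv vs f)"
  by (induction vs) (auto simp: smooth_pd iter_deriv_Cons simp del: iter_deriv.simps(2))

text \<open>Once a family stable under \<open>pd\<close> is found, only its members have to be
  estimated, never their derivatives separately. Sums, products, dilations and Fourier transforms
  are all treated with a suitable \<open>A\<close>.\<close>

lemma schwartz_coinduct:
  assumes "f \<in> A" and diff: "\<And>g x. g \<in> A \<Longrightarrow> g differentiable (at x)"
    and pd: "\<And>g b. g \<in> A \<Longrightarrow> b \<in> Basis \<Longrightarrow> pd b g \<in> A"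
    and bd: "\<And>g k. g \<in> A \<Longrightarrow> \<exists>C. \<forall>x. (1 + norm x) ^ k * norm (g x) \<le> C"
  shows "f \<in> schwartz"
proof -
  have *: "iter_deriv vs f \<in> A" if "set vs \<subseteq> Basis" for vs
    using that by (induction vs) (auto simp: assms iter_deriv_Cons simp del: iter_deriv.simps(2))
  show ?thesis unfolding schwartz_def
    using smoothI[OF assms(1) diff pd] bd[OF *] by (force simp: bounded_iff abs_mult)
qed

lemma schwartz_differentiable: "f \<in> schwartz \<Longrightarrow> f differentiable (at x)"
  by (simp add: schwartz_def smooth_differentiable)

lemma schwartz_pd: "f \<in> schwartz \<Longrightarrow> b \<in> Basis \<Longrightarrow> pd b f \<in> schwartz"
  unfolding schwartz_def mem_Collect_eq
proof (intro conjI allI impI; elim conjE)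
  fix k and vs :: "'a list" assume "b \<in> Basis" "set vs \<subseteq> Basis"
    "\<forall>k vs. set vs \<subseteq> Basis \<longrightarrow> bounded (range (\<lambda>x. (1 + norm x) ^ k *\<^sub>R iter_deriv vs f x))"
  from this(3)[rule_format, of "vs @ [b]" k] this(1,2)
  show "bounded (range (\<lambda>x. (1 + norm x) ^ k *\<^sub>R iter_deriv vs (pd b f) x))"
    by (simp only: iter_deriv_snoc) auto
qed (auto simp: smooth_pd)

lemma schwartz_iter_deriv: "f \<in> schwartz \<Longrightarrow> set vs \<subseteq> Basis \<Longrightarrow> iter_deriv vs f \<in> schwartz"
  by (induction vs) (auto simp: schwartz_pd iter_deriv_Cons simp del: iter_deriv.simps(2))

lemma schwartz_bound:
  assumes "f \<in> schwartz" shows "\<exists>C\<ge>0. \<forall>x. (1 + norm x) ^ k * norm (f x) \<le> C"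
proof -
  have "bounded (range (\<lambda>x. (1 + norm x) ^ k *\<^sub>R iter_deriv [] f x))"
    using assms unfolding schwartz_def mem_Collect_eq
    by (elim conjE allE[of _ k] allE[of _ "[]"]) simp
  then obtain C where C: "\<And>x. (1 + norm x) ^ k * norm (f x) \<le> C"
    by (auto simp: bounded_iff abs_mult)
  moreover have "0 \<le> C" using C[of 0] by simp (metis norm_ge_zero order_trans)
  ultimately show ?thesis by blast
qed

lemma schwartz_continuous: "f \<in> schwartz \<Longrightarrow> continuous_on A f"
  by (meson continuous_at_imp_continuous_on differentiable_imp_continuous_within schwartz_differentiable)

lemma schwartz_measurable [measurable_dest]: "f \<in> schwartz \<Longrightarrow> f \<in> borel_measurable borel"
  by (simp add: borel_measurable_continuous_onI schwartz_continuous)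

section \<open>Linear structure of the Schwartz space\<close>

lemma pd_lincomb:
  fixes f g :: "'a::real_normed_vector \<Rightarrow> 'b::real_normed_algebra"
  assumes "\<And>x. f differentiable (at x)" "\<And>x. g differentiable (at x)"
  shows "pd v (\<lambda>x. a * f x + b * g x) = (\<lambda>x. a * pd v f x + b * pd v g x)"
proof
  fix x
  have "((\<lambda>x. a * f x + b * g x) has_derivative (\<lambda>h. a * pd h f x + b * pd h g x)) (at x)"
    by (intro derivative_intros has_derivative_pd assms)
  from pd_eq[OF this] show "pd v (\<lambda>x. a * f x + b * g x) x = a * pd v f x + b * pd v g x" .
qed

lemma pd_mult:
  fixes f g :: "'a::real_normed_vector \<Rightarrow> 'b::real_normed_algebra"
  assumes "\<And>x. f differentiable (at x)" "\<And>x. g differentiable (at x)"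
  shows "pd v (\<lambda>x. f x * g x) = (\<lambda>x. f x * pd v g x + pd v f x * g x)"
proof
  fix x
  have "((\<lambda>x. f x * g x) has_derivative (\<lambda>h. f x * pd h g x + pd h f x * g x)) (at x)"
    by (intro derivative_intros has_derivative_pd assms)
  from pd_eq[OF this] show "pd v (\<lambda>x. f x * g x) x = f x * pd v g x + pd v f x * g x" .
qed

lemma schwartz_lincomb:
  assumes "f \<in> schwartz" "g \<in> schwartz"
  shows "(\<lambda>x. a * f x + b * g x) \<in> schwartz"
proof (rule schwartz_coinduct)
  let ?A = "{\<lambda>x. a * f x + b * g x | f g. f \<in> schwartz \<and> g \<in> schwartz}"
  show "(\<lambda>x. a * f x + b * g x) \<in> ?A" using assms by blast
  fix h assume "h \<in> ?A"
  then obtain f g where h: "h = (\<lambda>x. a * f x + b * g x)" "f \<in> schwartz" "g \<in> schwartz" by blast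
  show "h differentiable at x" for x
    unfolding h(1) by (intro derivative_intros schwartz_differentiable h)
  show "pd v h \<in> ?A" if "v \<in> Basis" for v
    unfolding h(1) using h that
    by (subst pd_lincomb) (auto intro: schwartz_differentiable schwartz_pd)
  fix k
  obtain C D where C: "\<And>x. (1 + norm x) ^ k * norm (f x) \<le> C" and D: "\<And>x. (1 + norm x) ^ k * norm (g x) \<le> D"
    using schwartz_bound[OF h(2), of k] schwartz_bound[OF h(3), of k] by blast
  have "(1 + norm x) ^ k * norm (h x) \<le> norm a * C + norm b * D" for x
  proof -
    have "(1 + norm x) ^ k * norm (h x) \<le> (1 + norm x) ^ k * (norm a * norm (f x) + norm b * norm (g x))"
      unfolding h(1) by (intro mult_left_mono) (auto simp flip: norm_mult intro: norm_triangle_ineq)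
    also have "\<dots> = norm a * ((1 + norm x) ^ k * norm (f x)) + norm b * ((1 + norm x) ^ k * norm (g x))"
      by (simp add: algebra_simps)
    also have "\<dots> \<le> norm a * C + norm b * D"
      by (intro add_mono mult_left_mono C D) auto
    finally show ?thesis .
  qed
  then show "\<exists>C. \<forall>x. (1 + norm x) ^ k * norm (h x) \<le> C" by blast
qed

lemma schwartz_diff: "f \<in> schwartz \<Longrightarrow> g \<in> schwartz \<Longrightarrow> (\<lambda>x. f x - g x) \<in> schwartz"
  using schwartz_lincomb[of f g 1 "-1"] by simp

lemma schwartz_scale: "f \<in> schwartz \<Longrightarrow> (\<lambda>x. a * f x) \<in> schwartz"
  using schwartz_lincomb[of f f a 0] by simp

lemma schwartz_zero: "(\<lambda>x. 0) \<in> schwartz"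
  by (rule schwartz_coinduct[where A="{\<lambda>x. 0}"]) (auto simp: pd_const)

lemma iter_deriv_lincomb:
  assumes "f \<in> schwartz" "g \<in> schwartz" "set vs \<subseteq> Basis"
  shows "iter_deriv vs (\<lambda>x. a * f x + b * g x) = (\<lambda>x. a * iter_deriv vs f x + b * iter_deriv vs g x)"
  using assms(3)
proof (induction vs)
  case (Cons v vs)
  then show ?case
    unfolding iter_deriv_Cons using assms(1,2)
    by (auto simp: pd_lincomb schwartz_differentiable schwartz_iter_deriv simp flip: fun_eq_iff)
qed simp

text \<open>The space usually written \<open>O_M\<close>: the multipliers of the Schwartz space.\<close>

definition slow :: "('a::euclidean_space \<Rightarrow> complex) set" where
  "slow = {f. smooth f \<and>
     (\<forall>vs. set vs \<subseteq> Basis \<longrightarrow> (\<exists>C N. \<forall>x. norm (iter_deriv vs f x) \<le> C * (1 + norm x) ^ N))}"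

lemma slow_differentiable: "f \<in> slow \<Longrightarrow> f differentiable (at x)"
  by (simp add: slow_def smooth_differentiable)

lemma slow_pd: "f \<in> slow \<Longrightarrow> b \<in> Basis \<Longrightarrow> pd b f \<in> slow"
  unfolding slow_def mem_Collect_eq
proof (intro conjI allI impI; elim conjE)
  fix vs :: "'a list" assume "b \<in> Basis" "set vs \<subseteq> Basis"
    "\<forall>vs. set vs \<subseteq> Basis \<longrightarrow> (\<exists>C N. \<forall>x. norm (iter_deriv vs f x) \<le> C * (1 + norm x) ^ N)"
  from this(3)[rule_format, of "vs @ [b]"] this(1,2)
  show "\<exists>C N. \<forall>x. norm (iter_deriv vs (pd b f) x) \<le> C * (1 + norm x) ^ N"
    by (simp only: iter_deriv_snoc) auto
qed (auto simp: smooth_pd)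

lemma slow_bound:
  assumes "f \<in> slow" shows "\<exists>C\<ge>0. \<exists>N. \<forall>x. norm (f x) \<le> C * (1 + norm x) ^ N"
proof -
  have "\<exists>C N. \<forall>x. norm (iter_deriv [] f x) \<le> C * (1 + norm x) ^ N"
    using assms unfolding slow_def mem_Collect_eq by (elim conjE allE[of _ "[]"]) simp
  then obtain C N where C: "\<And>x. norm (f x) \<le> C * (1 + norm x) ^ N" by auto
  moreover have "0 \<le> C" using C[of 0] by simp (metis norm_ge_zero order_trans)
  ultimately show ?thesis by blast
qed

lemma slow_coinduct:
  assumes "f \<in> A" and diff: "\<And>g x. g \<in> A \<Longrightarrow> g differentiable (at x)"
    and pd: "\<And>g b. g \<in> A \<Longrightarrow> b \<in> Basis \<Longrightarrow> pd b g \<in> A"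
    and bd: "\<And>g. g \<in> A \<Longrightarrow> \<exists>C N. \<forall>x. norm (g x) \<le> C * (1 + norm x) ^ N"
  shows "f \<in> slow"
proof -
  have *: "iter_deriv vs f \<in> A" if "set vs \<subseteq> Basis" for vs
    using that by (induction vs) (auto simp: assms iter_deriv_Cons simp del: iter_deriv.simps(2))
  show ?thesis unfolding slow_def
    using smoothI[OF assms(1) diff pd] bd[OF *] by auto
qed

lemma schwartz_imp_slow: "f \<in> schwartz \<Longrightarrow> f \<in> slow"
proof (rule slow_coinduct[where A = schwartz])
  fix g :: "'a \<Rightarrow> complex" assume "g \<in> schwartz"
  from schwartz_bound[OF this, of 0] show "\<exists>C N. \<forall>x. norm (g x) \<le> C * (1 + norm x) ^ N"
    by (metis mult.right_neutral power_0 mult_1)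
qed (auto intro: schwartz_pd schwartz_differentiable)

lemma slow_const: "(\<lambda>x. c) \<in> slow"
proof (rule slow_coinduct[where A = "range (\<lambda>c x. c)"])
  fix g :: "'a \<Rightarrow> complex" assume "g \<in> range (\<lambda>c x. c)"
  then obtain c where "g = (\<lambda>x. c)" by blast
  then show "\<exists>C N. \<forall>x. norm (g x) \<le> C * (1 + norm x) ^ N"
    by (auto intro!: exI[of _ "norm c"] exI[of _ "0::nat"])
qed (auto simp: pd_const)

lemma has_derivative_of_real_inner:
  "((\<lambda>x. complex_of_real (x \<bullet> v)) has_derivative (\<lambda>h. of_real (h \<bullet> v))) (at x)"
  by (intro derivative_intros has_derivative_ident[THEN has_derivative_inner_left])

lemma pd_inner: "pd b (\<lambda>x. complex_of_real (x \<bullet> v)) = (\<lambda>x. of_real (b \<bullet> v))"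
  using pd_eq[OF has_derivative_of_real_inner] by fast

lemma slow_inner: "(\<lambda>x. complex_of_real (x \<bullet> v)) \<in> slow"
proof (rule slow_coinduct[where A = "insert (\<lambda>x. of_real (x \<bullet> v)) (range (\<lambda>c x. c))"])
  fix g assume g: "g \<in> insert (\<lambda>x::'a. complex_of_real (x \<bullet> v)) (range (\<lambda>c x. c))"
  have "\<bar>x \<bullet> v\<bar> \<le> norm v * (1 + norm x) ^ 1" for x
    using Cauchy_Schwarz_ineq2[of x v] by (simp add: algebra_simps) (smt (verit) norm_ge_zero)
  then have 1: "\<exists>C N. \<forall>x. norm (complex_of_real (x \<bullet> v)) \<le> C * (1 + norm x) ^ N"
    by (metis norm_of_real)
  have 2: "\<exists>C N. \<forall>x::'a. norm c \<le> C * (1 + norm x) ^ N" for c :: complex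
    by (auto intro!: exI[of _ "norm c"] exI[of _ "0::nat"])
  from g consider "g = (\<lambda>x. of_real (x \<bullet> v))" | c where "g = (\<lambda>x. c)" by blast
  then show "\<exists>C N. \<forall>x. norm (g x) \<le> C * (1 + norm x) ^ N"
    by cases (simp_all only: 1 2)
  show "g differentiable at x" for x
    using g has_derivative_of_real_inner has_derivative_const by (fastforce simp: differentiable_def)
  show "pd b g \<in> insert (\<lambda>x. of_real (x \<bullet> v)) (range (\<lambda>c x. c))" for b using g
    by (auto simp: pd_inner pd_const)
qed simp

text \<open>The product rule turns one product into a sum of two, so products alone are not stable
  under \<open>pd\<close>; their finite sums are, and they serve as the family in
  \<open>schwartz_coinduct\<close>.\<close>

inductive_set mult_span :: "('a::euclidean_space \<Rightarrow> complex) set" where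
  mult: "s \<in> slow \<Longrightarrow> f \<in> schwartz \<Longrightarrow> (\<lambda>x. s x * f x) \<in> mult_span"
| add: "f \<in> mult_span \<Longrightarrow> g \<in> mult_span \<Longrightarrow> (\<lambda>x. f x + g x) \<in> mult_span"

lemma schwartz_slow_mult:
  assumes "s \<in> slow" "f \<in> schwartz" shows "(\<lambda>x. s x * f x) \<in> schwartz"
proof (rule schwartz_coinduct)
  show "(\<lambda>x. s x * f x) \<in> mult_span" using assms by (rule mult_span.mult)
  have diff: "g differentiable at x" if "g \<in> mult_span" for g :: "'a \<Rightarrow> complex" and x
    using that by induction (auto intro!: derivative_intros intro: slow_differentiable schwartz_differentiable)
  fix g :: "'a \<Rightarrow> complex" assume g: "g \<in> mult_span"
  show "g differentiable at x" for x using g by (rule diff)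
  show "pd b g \<in> mult_span" if "b \<in> Basis" for b
    using g
  proof induction
    case (mult s f)
    have "pd b (\<lambda>x. s x * f x) = (\<lambda>x. s x * pd b f x + pd b s x * f x)"
      using mult by (intro pd_mult) (auto intro: slow_differentiable schwartz_differentiable)
    with mult that show ?case by (auto intro!: mult_span.intros schwartz_pd slow_pd)
  next
    case (add f g)
    have "pd b (\<lambda>x. f x + g x) = (\<lambda>x. pd b f x + pd b g x)"
      using pd_lincomb[of f g b 1 1] add diff by auto
    with add show ?case by (auto intro: mult_span.intros)
  qed
  show "\<exists>C. \<forall>x. (1 + norm x) ^ k * norm (g x) \<le> C" for k
    using g
  proof induction
    case (mult s f)
    then obtain C N D where C: "\<And>x. norm (s x) \<le> C * (1 + norm x) ^ N" "0 \<le> C"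
      and D: "\<And>x. (1 + norm x) ^ (k + N) * norm (f x) \<le> D"
      using slow_bound schwartz_bound by metis
    have "(1 + norm x) ^ k * norm (s x * f x) \<le> C * D" for x
    proof -
      have "(1 + norm x) ^ k * norm (s x * f x) \<le> (1 + norm x) ^ k * ((C * (1 + norm x) ^ N) * norm (f x))"
        unfolding norm_mult by (intro mult_left_mono mult_right_mono C) auto
      also have "\<dots> = C * ((1 + norm x) ^ (k + N) * norm (f x))" by (simp add: power_add)
      also have "\<dots> \<le> C * D" by (intro mult_left_mono C D)
      finally show ?thesis .
    qed
    then show ?case by blast
  next
    case (add f g)
    then obtain C D where C: "\<And>x. (1 + norm x) ^ k * norm (f x) \<le> C" and D: "\<And>x. (1 + norm x) ^ k * norm (g x) \<le> D"
      by blast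
    have "(1 + norm x) ^ k * norm (f x + g x) \<le> C + D" for x
    proof -
      have "(1 + norm x) ^ k * norm (f x + g x) \<le> (1 + norm x) ^ k * (norm (f x) + norm (g x))"
        by (intro mult_left_mono norm_triangle_ineq) auto
      with C[of x] D[of x] show ?thesis by (simp add: algebra_simps)
    qed
    then show ?case by blast
  qed
qed

lemma schwartz_mult: "f \<in> schwartz \<Longrightarrow> g \<in> schwartz \<Longrightarrow> (\<lambda>x. f x * g x) \<in> schwartz"
  by (simp add: schwartz_slow_mult schwartz_imp_slow)

lemma schwartz_inner_mult: "f \<in> schwartz \<Longrightarrow> (\<lambda>x. of_real (x \<bullet> v) * f x) \<in> schwartz"
  by (rule schwartz_slow_mult[OF slow_inner])

lemma pd_dilate:
  fixes f :: "'a::real_normed_vector \<Rightarrow> 'b::real_normed_vector"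
  assumes "\<And>x. f differentiable (at x)"
  shows "pd v (\<lambda>x. f (c *\<^sub>R x)) = (\<lambda>x. c *\<^sub>R pd v f (c *\<^sub>R x))"
proof
  fix x :: 'a
  have d: "((\<lambda>x. c *\<^sub>R x) has_derivative (\<lambda>h. c *\<^sub>R h)) (at x)"
    by (auto intro!: derivative_eq_intros)
  have f: "(f has_derivative (\<lambda>h. pd h f (c *\<^sub>R x))) (at (c *\<^sub>R x))"
    by (rule has_derivative_pd[OF assms])
  have "((\<lambda>x. f (c *\<^sub>R x)) has_derivative (\<lambda>h. pd (c *\<^sub>R h) f (c *\<^sub>R x))) (at x)"
    using has_derivative_compose[OF d f] .
  from pd_eq[OF this] have "pd v (\<lambda>x. f (c *\<^sub>R x)) x = pd (c *\<^sub>R v) f (c *\<^sub>R x)" .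
  also have "\<dots> = c *\<^sub>R pd v f (c *\<^sub>R x)"
    using linear_scale[OF has_derivative_linear[OF f]] .
  finally show "pd v (\<lambda>x. f (c *\<^sub>R x)) x = c *\<^sub>R pd v f (c *\<^sub>R x)" .
qed

lemma schwartz_dilate:
  fixes f :: "'a::euclidean_space \<Rightarrow> complex"
  assumes "f \<in> schwartz" "c \<noteq> 0" shows "(\<lambda>x. f (c *\<^sub>R x)) \<in> schwartz"
proof (rule schwartz_coinduct)
  let ?A = "{\<lambda>x. f (c *\<^sub>R x) | f :: 'a \<Rightarrow> complex. f \<in> schwartz}"
  show "(\<lambda>x. f (c *\<^sub>R x)) \<in> ?A" using assms by blast
  fix h assume "h \<in> ?A"
  then obtain f :: "'a \<Rightarrow> complex" where h: "h = (\<lambda>x. f (c *\<^sub>R x))" "f \<in> schwartz" by blast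
  have "f differentiable at x" for x using h schwartz_differentiable by blast
  note pd = pd_dilate[OF this]
  show "h differentiable at x" for x
  proof -
    have "((\<lambda>x. c *\<^sub>R x) has_derivative (\<lambda>h. c *\<^sub>R h)) (at x)"
      by (auto intro!: derivative_eq_intros)
    from has_derivative_compose[OF this has_derivative_pd[OF schwartz_differentiable[OF h(2)]]]
    show ?thesis unfolding h(1) by (auto simp: differentiable_def)
  qed
  show "pd v h \<in> ?A" if "v \<in> Basis" for v
    using schwartz_scale[OF schwartz_pd[OF h(2) that], of "of_real c"] unfolding h(1) pd
    by (auto simp: scaleR_conv_of_real)
  fix k
  \<comment> \<open>This \<open>M\<close> gives
    \<open>1 + norm x \<le> M * (1 + norm (c *\<^sub>R x))\<close> for contractions and expansions
    alike.\<close>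
  define M where "M = max 1 (1 / \<bar>c\<bar>)"
  obtain C where C: "\<And>x. (1 + norm x) ^ k * norm (f x) \<le> C"
    using schwartz_bound[OF h(2), of k] by blast
  have "(1 + norm x) ^ k * norm (h x) \<le> M ^ k * C" for x
  proof -
    have "norm x = 1 / \<bar>c\<bar> * norm (c *\<^sub>R x)" using assms(2) by simp
    also have "\<dots> \<le> M * norm (c *\<^sub>R x)" by (intro mult_right_mono) (auto simp: M_def)
    finally have "1 + norm x \<le> M * (1 + norm (c *\<^sub>R x))"
      by (auto simp: M_def algebra_simps)
    then have "(1 + norm x) ^ k \<le> (M * (1 + norm (c *\<^sub>R x))) ^ k" by (intro power_mono) auto
    then have "(1 + norm x) ^ k * norm (h x) \<le> (M * (1 + norm (c *\<^sub>R x))) ^ k * norm (h x)"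
      by (rule mult_right_mono) auto
    also have "\<dots> = M ^ k * ((1 + norm (c *\<^sub>R x)) ^ k * norm (f (c *\<^sub>R x)))"
      by (simp add: power_mult_distrib h(1) del: norm_scaleR)
    also have "\<dots> \<le> M ^ k * C" by (intro mult_left_mono C) (auto simp: M_def)
    finally show ?thesis .
  qed
  then show "\<exists>C. \<forall>x. (1 + norm x) ^ k * norm (h x) \<le> C" by blast
qed

section \<open>Locality of derivatives and compact supports\<close>

lemma iter_deriv_zero_on_open:
  assumes "open V" "\<And>x. x \<in> V \<Longrightarrow> f x = 0" "x \<in> V"
  shows "iter_deriv vs f x = 0"
  using assms(3)
proof (induction vs arbitrary: x)
  case (Cons v vs)
  have "(iter_deriv vs f has_derivative (\<lambda>h. 0)) (at x)"
    using assms(1) Cons by (intro has_derivative_transform_within_open[OF has_derivative_const, of V]) auto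
  from pd_eq[OF this] show ?case by (simp only: iter_deriv_Cons)
qed (use assms in auto)

lemma pd_of_real:
  assumes "\<And>x. f differentiable (at x)"
  shows "pd b (\<lambda>x. complex_of_real (f x)) = (\<lambda>x. of_real (pd b f x))"
proof
  fix x
  have "((\<lambda>x. complex_of_real (f x)) has_derivative (\<lambda>h. of_real (pd h f x))) (at x)"
    by (intro derivative_intros has_derivative_pd assms)
  from pd_eq[OF this] show "pd b (\<lambda>x. complex_of_real (f x)) x = of_real (pd b f x)" .
qed

lemma iter_deriv_of_real:
  assumes "smooth f" "set vs \<subseteq> Basis"
  shows "iter_deriv vs (\<lambda>x. complex_of_real (f x)) = (\<lambda>x. of_real (iter_deriv vs f x))"
  using assms(2)
proof (induction vs)
  case (Cons v vs)
  then show ?case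
    unfolding iter_deriv_Cons using assms(1)
    by (simp add: pd_of_real smooth_differentiable smooth_iter_deriv)
qed simp

lemma schwartz_of_compact_support:
  assumes "smooth f" and supp: "\<And>x. norm x > R \<Longrightarrow> f x = 0"
  shows "(\<lambda>x. complex_of_real (f x)) \<in> schwartz"
proof (rule schwartz_coinduct)
  let ?A = "{\<lambda>x. complex_of_real (iter_deriv vs f x) | vs. set vs \<subseteq> Basis}"
  show "(\<lambda>x. complex_of_real (f x)) \<in> ?A" by (auto intro!: exI[of _ "[]"])
  fix g assume "g \<in> ?A"
  then obtain vs where g: "g = (\<lambda>x. of_real (iter_deriv vs f x))" "set vs \<subseteq> Basis" by blast
  have d: "iter_deriv vs f differentiable at x" for x
    using g(2) assms(1) smooth_def by blast
  show "g differentiable at x" for x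
    unfolding g(1) using has_derivative_of_real[OF has_derivative_pd[OF d]] by (auto simp: differentiable_def)
  show "pd b g \<in> ?A" if "b \<in> Basis" for b
    using g that d by (auto simp: pd_of_real simp del: iter_deriv.simps simp flip: iter_deriv_Cons intro!: exI[of _ "b # vs"])
  fix k
  have z: "iter_deriv vs f x = 0" if "norm x > R" for x
  proof (rule iter_deriv_zero_on_open[of "- cball 0 R"])
    show "open (- cball (0::'a) R)" by auto
  qed (use that supp in auto)
  have "continuous_on (cball 0 R) (\<lambda>x. (1 + norm x) ^ k * norm (iter_deriv vs f x))"
    by (intro continuous_intros continuous_at_imp_continuous_on ballI differentiable_imp_continuous_within d)
  from compact_imp_bounded[OF compact_continuous_image[OF this compact_cball]]
  obtain C where C: "\<And>x. norm x \<le> R \<Longrightarrow> (1 + norm x) ^ k * norm (iter_deriv vs f x) \<le> C"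
    by (force simp: bounded_iff)
  have "(1 + norm x) ^ k * norm (g x) \<le> max C 0" for x
    using C[of x] z[of x] by (cases "norm x \<le> R") (auto simp: g(1))
  then show "\<exists>C. \<forall>x. (1 + norm x) ^ k * norm (g x) \<le> C" by blast
qed

subsection \<open>Seminorms and continuity\<close>

text \<open>A real \<open>Sup\<close> carries information only for a set that is bounded above. As
  \<open>Basis\<close> is finite there are finitely many derivative words of length at most
  \<open>k\<close>, and each is bounded by itself.\<close>

lemma seminorm_bdd:
  assumes "f \<in> schwartz"
  shows "bdd_above {(1 + norm x) ^ k * norm (iter_deriv vs f x) | vs x. set vs \<subseteq> Basis \<and> length vs \<le> k}"
proof -
  have "finite {vs :: 'a list. set vs \<subseteq> Basis \<and> length vs \<le> k}"
    by (intro finite_lists_length_le finite_Basis)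
  moreover have "{(1 + norm x) ^ k * norm (iter_deriv vs f x) | vs x. set vs \<subseteq> Basis \<and> length vs \<le> k} =
     (\<Union>vs \<in> {vs :: 'a list. set vs \<subseteq> Basis \<and> length vs \<le> k}. range (\<lambda>x. (1 + norm x) ^ k * norm (iter_deriv vs f x)))"
    by auto
  moreover have "bdd_above (range (\<lambda>x. (1 + norm x) ^ k * norm (iter_deriv vs f x)))" if "set vs \<subseteq> Basis" for vs
    using schwartz_bound[OF schwartz_iter_deriv[OF assms that], of k] by (auto simp: bdd_above_def)
  ultimately show ?thesis by auto
qed

lemma seminorm_ge:
  assumes "f \<in> schwartz" "set vs \<subseteq> Basis" "length vs \<le> k" "j \<le> k"
  shows "(1 + norm x) ^ j * norm (iter_deriv vs f x) \<le> schwartz_seminorm k f"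
proof -
  have "(1 + norm x) ^ j * norm (iter_deriv vs f x) \<le> (1 + norm x) ^ k * norm (iter_deriv vs f x)"
    using assms by (intro mult_right_mono power_increasing) auto
  also have "\<dots> \<le> schwartz_seminorm k f"
    unfolding schwartz_seminorm_def using assms
    by (intro cSup_upper seminorm_bdd) auto
  finally show ?thesis .
qed

lemma seminorm_le:
  assumes "\<And>vs x. set vs \<subseteq> Basis \<Longrightarrow> length vs \<le> k \<Longrightarrow> (1 + norm x) ^ k * norm (iter_deriv vs f x) \<le> B"
  shows "schwartz_seminorm k f \<le> B"
  unfolding schwartz_seminorm_def using assms
  by (intro cSup_least) (auto intro!: exI[of _ "[]"])

lemma seminorm_ge0: "f \<in> schwartz \<Longrightarrow> j \<le> k \<Longrightarrow> (1 + norm x) ^ j * norm (f x) \<le> schwartz_seminorm k f"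
  using seminorm_ge[of f "[]" k j x] by simp

lemma seminorm_nonneg: "f \<in> schwartz \<Longrightarrow> 0 \<le> schwartz_seminorm k f"
  using seminorm_ge0[of f 0 k 0] by simp (metis norm_ge_zero order_trans)

lemma seminorm_mono: "f \<in> schwartz \<Longrightarrow> j \<le> k \<Longrightarrow> schwartz_seminorm j f \<le> schwartz_seminorm k f"
  by (intro seminorm_le seminorm_ge) auto

lemma seminorm_pd: "f \<in> schwartz \<Longrightarrow> b \<in> Basis \<Longrightarrow> schwartz_seminorm k (pd b f) \<le> schwartz_seminorm (Suc k) f"
  by (intro seminorm_le) (auto simp flip: iter_deriv_snoc intro!: seminorm_ge)

text \<open>Continuity for the Frechet topology; one seminorm on the right suffices because the
  seminorms increase with their index. Linearity is kept apart and asked for in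
  \<open>tempered_comp\<close>.\<close>

definition schwartz_cont :: "(('a::euclidean_space \<Rightarrow> complex) \<Rightarrow> 'a \<Rightarrow> complex) \<Rightarrow> bool" where
  "schwartz_cont L \<longleftrightarrow> (\<forall>f\<in>schwartz. L f \<in> schwartz) \<and>
     (\<forall>k. \<exists>C\<ge>0. \<exists>j. \<forall>f\<in>schwartz. schwartz_seminorm k (L f) \<le> C * schwartz_seminorm j f)"

lemma schwartz_contD: "schwartz_cont L \<Longrightarrow> f \<in> schwartz \<Longrightarrow> L f \<in> schwartz"
  by (simp add: schwartz_cont_def)

lemma schwartz_cont_seminorm:
  assumes "schwartz_cont L"
  shows "\<exists>C\<ge>0. \<exists>j. \<forall>f\<in>schwartz. schwartz_seminorm k (L f) \<le> C * schwartz_seminorm j f"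
  using assms by (simp add: schwartz_cont_def)

text \<open>The seminorm of index \<open>k\<close> involves finitely many derivative words, so each
  word may come with its own constant and index; adding up the constants and the indices bounds all
  of them at once.\<close>

lemma schwartz_contI:
  assumes S: "\<And>f. f \<in> schwartz \<Longrightarrow> L f \<in> schwartz"
    and bd: "\<And>k vs. set vs \<subseteq> Basis \<Longrightarrow> \<exists>C\<ge>0. \<exists>j. \<forall>f\<in>schwartz. \<forall>x.
      (1 + norm x) ^ k * norm (iter_deriv vs (L f) x) \<le> C * schwartz_seminorm j f"
  shows "schwartz_cont L"
  unfolding schwartz_cont_def
proof (intro conjI ballI S allI)
  fix k
  let ?V = "{vs :: 'a list. set vs \<subseteq> Basis \<and> length vs \<le> k}"
  have fin: "finite ?V" by (intro finite_lists_length_le finite_Basis)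
  have "\<forall>vs\<in>?V. \<exists>C j. 0 \<le> C \<and> (\<forall>f\<in>schwartz. \<forall>x.
      (1 + norm x) ^ k * norm (iter_deriv vs (L f) x) \<le> C * schwartz_seminorm j f)"
    using bd by blast
  from bchoice[OF this] obtain C where "\<forall>vs\<in>?V. \<exists>j. 0 \<le> C vs \<and> (\<forall>f\<in>schwartz. \<forall>x.
      (1 + norm x) ^ k * norm (iter_deriv vs (L f) x) \<le> C vs * schwartz_seminorm j f)" ..
  from bchoice[OF this] obtain j where j: "\<forall>vs\<in>?V. 0 \<le> C vs \<and> (\<forall>f\<in>schwartz. \<forall>x.
      (1 + norm x) ^ k * norm (iter_deriv vs (L f) x) \<le> C vs * schwartz_seminorm (j vs) f)" ..
  have C: "0 \<le> C vs" if "vs \<in> ?V" for vs using j that by blast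
  have Cj: "(1 + norm x) ^ k * norm (iter_deriv vs (L f) x) \<le> C vs * schwartz_seminorm (j vs) f"
    if "vs \<in> ?V" "f \<in> schwartz" for vs f x using j that by blast
  show "\<exists>C\<ge>0. \<exists>j. \<forall>f\<in>schwartz. schwartz_seminorm k (L f) \<le> C * schwartz_seminorm j f"
  proof (intro exI conjI ballI)
    show "0 \<le> sum C ?V" using C by (rule sum_nonneg)
    fix f :: "'a \<Rightarrow> complex" assume f: "f \<in> schwartz"
    show "schwartz_seminorm k (L f) \<le> sum C ?V * schwartz_seminorm (sum j ?V) f"
    proof (rule seminorm_le)
      fix vs :: "'a list" and x :: 'a assume "set vs \<subseteq> Basis" "length vs \<le> k"
      then have vs: "vs \<in> ?V" by simp
      have "(1 + norm x) ^ k * norm (iter_deriv vs (L f) x) \<le> C vs * schwartz_seminorm (j vs) f"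
        by (rule Cj[OF vs f])
      also have "\<dots> \<le> sum C ?V * schwartz_seminorm (sum j ?V) f"
        using vs fin C f by (intro mult_mono seminorm_mono member_le_sum sum_nonneg seminorm_nonneg) auto
      finally show "(1 + norm x) ^ k * norm (iter_deriv vs (L f) x) \<le> sum C ?V * schwartz_seminorm (sum j ?V) f" .
    qed
  qed
qed

lemma schwartz_cont_comp:
  assumes "schwartz_cont L" "schwartz_cont M" shows "schwartz_cont (\<lambda>f. L (M f))"
  unfolding schwartz_cont_def
proof (intro conjI ballI allI)
  fix k
  obtain C j where C: "0 \<le> C" "\<And>f. f \<in> schwartz \<Longrightarrow> schwartz_seminorm k (L f) \<le> C * schwartz_seminorm j f"
    using schwartz_cont_seminorm[OF assms(1)] by blast
  obtain D i where D: "0 \<le> D" "\<And>f. f \<in> schwartz \<Longrightarrow> schwartz_seminorm j (M f) \<le> D * schwartz_seminorm i f"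
    using schwartz_cont_seminorm[OF assms(2)] by blast
  have "schwartz_seminorm k (L (M f)) \<le> (C * D) * schwartz_seminorm i f" if "f \<in> schwartz" for f
    using C(2)[OF schwartz_contD[OF assms(2) that]] mult_left_mono[OF D(2)[OF that] C(1)] by (simp add: mult.assoc)
  then show "\<exists>C\<ge>0. \<exists>j. \<forall>f\<in>schwartz. schwartz_seminorm k (L (M f)) \<le> C * schwartz_seminorm j f"
    using C(1) D(1) by (metis mult_nonneg_nonneg)
qed (use assms schwartz_contD in blast)

text \<open>Induction on the innermost derivative: the product rule leaves \<open>s\<close> times
  \<open>pd b f\<close> and \<open>pd b s\<close> times \<open>f\<close>, each with one derivative
  fewer outside. The multiplier is generalised because it changes to \<open>pd b s\<close>.\<close>

lemma schwartz_cont_mult: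
  assumes "s \<in> slow" shows "schwartz_cont (\<lambda>f x. s x * f x)"
proof (rule schwartz_contI)
  fix vs :: "'a list" and k assume "set vs \<subseteq> Basis"
  then show "\<exists>C\<ge>0. \<exists>j. \<forall>f\<in>schwartz. \<forall>x.
      (1 + norm x) ^ k * norm (iter_deriv vs (\<lambda>x. s x * f x) x) \<le> C * schwartz_seminorm j f"
    using assms
  proof (induction vs arbitrary: s rule: rev_induct)
    case Nil
    then obtain C N where C: "\<And>x. norm (s x) \<le> C * (1 + norm x) ^ N" "0 \<le> C"
      using slow_bound by metis
    have "(1 + norm x) ^ k * norm (s x * f x) \<le> C * schwartz_seminorm (k + N) f" if "f \<in> schwartz" for f x
    proof -
      have "(1 + norm x) ^ k * norm (s x * f x) \<le> (1 + norm x) ^ k * ((C * (1 + norm x) ^ N) * norm (f x))"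
        unfolding norm_mult by (intro mult_left_mono mult_right_mono C) auto
      also have "\<dots> = C * ((1 + norm x) ^ (k + N) * norm (f x))" by (simp add: power_add)
      also have "\<dots> \<le> C * schwartz_seminorm (k + N) f" by (intro mult_left_mono C seminorm_ge0 that) simp
      finally show ?thesis .
    qed
    with C(2) show ?case by auto
  next
    case (snoc b vs)
    then have b: "b \<in> Basis" "set vs \<subseteq> Basis" by auto
    obtain C i where C: "0 \<le> C" "\<And>f x. f \<in> schwartz \<Longrightarrow>
      (1 + norm x) ^ k * norm (iter_deriv vs (\<lambda>x. s x * f x) x) \<le> C * schwartz_seminorm i f"
      using snoc.IH[OF b(2) snoc.prems(2)] by blast
    obtain D j where D: "0 \<le> D" "\<And>f x. f \<in> schwartz \<Longrightarrow>
      (1 + norm x) ^ k * norm (iter_deriv vs (\<lambda>x. pd b s x * f x) x) \<le> D * schwartz_seminorm j f"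
      using snoc.IH[OF b(2) slow_pd[OF snoc.prems(2) b(1)]] by blast
    have "(1 + norm x) ^ k * norm (iter_deriv (vs @ [b]) (\<lambda>x. s x * f x) x) \<le> (C + D) * schwartz_seminorm (Suc i + j) f"
      if f: "f \<in> schwartz" for f x
    proof -
      have "iter_deriv (vs @ [b]) (\<lambda>x. s x * f x) = iter_deriv vs (\<lambda>x. 1 * (s x * pd b f x) + 1 * (pd b s x * f x))"
        unfolding iter_deriv_snoc using snoc.prems f
        by (subst pd_mult) (auto intro: slow_differentiable schwartz_differentiable)
      also have "\<dots> = (\<lambda>x. 1 * iter_deriv vs (\<lambda>x. s x * pd b f x) x + 1 * iter_deriv vs (\<lambda>x. pd b s x * f x) x)"
        using snoc.prems f b by (intro iter_deriv_lincomb schwartz_slow_mult slow_pd schwartz_pd) auto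
      finally have "(1 + norm x) ^ k * norm (iter_deriv (vs @ [b]) (\<lambda>x. s x * f x) x) \<le>
        (1 + norm x) ^ k * (norm (iter_deriv vs (\<lambda>x. s x * pd b f x) x) + norm (iter_deriv vs (\<lambda>x. pd b s x * f x) x))"
        by (simp add: mult_left_mono norm_triangle_ineq)
      also have "\<dots> \<le> C * schwartz_seminorm i (pd b f) + D * schwartz_seminorm j f"
        unfolding distrib_left by (intro add_mono C D f schwartz_pd b)
      also have "\<dots> \<le> C * schwartz_seminorm (Suc i + j) f + D * schwartz_seminorm (Suc i + j) f"
        using seminorm_pd[OF f b(1), of i] seminorm_mono[OF f, of "Suc i" "Suc i + j"] seminorm_mono[OF f, of j "Suc i + j"]
        by (intro add_mono mult_left_mono C D) auto
      finally show ?thesis by (simp add: algebra_simps)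
    qed
    with C(1) D(1) show ?case by (metis add_nonneg_nonneg)
  qed
qed (rule schwartz_slow_mult[OF assms])

subsection \<open>Integration over Euclidean space\<close>

text \<open>Fubini for a finite product of lines, carried to the Euclidean space along
  \<open>lborel_eq\<close>. It provides both the integrable weight and the Gaussian
  integrals.\<close>

lemma
  fixes f :: "'a::euclidean_space \<Rightarrow> real \<Rightarrow> 'b::{real_normed_field,banach,second_countable_topology}"
  assumes f: "\<And>b. b \<in> Basis \<Longrightarrow> integrable lborel (f b)"
  shows integrable_lborel_prod: "integrable lborel (\<lambda>x. \<Prod>b\<in>Basis. f b (x \<bullet> b))" (is ?I)
    and integral_lborel_prod:
      "(LINT x|lborel. (\<Prod>b\<in>Basis. f b (x \<bullet> b))) = (\<Prod>b\<in>Basis. (LINT t|lborel. f b t))" (is ?E)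
proof -
  interpret product_sigma_finite "\<lambda>_::'a. lborel :: real measure" ..
  let ?P = "\<Pi>\<^sub>M b\<in>(Basis :: 'a set). (lborel :: real measure)"
  let ?T = "\<lambda>f. \<Sum>b\<in>(Basis :: 'a set). f b *\<^sub>R b"
  have [measurable]: "f b \<in> borel_measurable borel" if "b \<in> Basis" for b using f[OF that] by auto
  have T: "?T \<in> ?P \<rightarrow>\<^sub>M borel" by measurable
  have m: "(\<lambda>x. \<Prod>b\<in>Basis. f b (x \<bullet> b)) \<in> borel_measurable borel" by measurable
  have eq: "(\<Prod>b\<in>Basis. f b (?T g \<bullet> b)) = (\<Prod>b\<in>Basis. f b (g b))" for g
    by (intro prod.cong refl) (simp add: inner_sum_left inner_Basis if_distrib[where f="\<lambda>u. _ * u"] cong: if_cong)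
  show ?I
    by (subst lborel_eq, subst integrable_distr_eq[OF T m], unfold eq)
       (intro product_integrable_prod f finite_Basis)
  show ?E
    by (subst lborel_eq, subst integral_distr[OF T m], unfold eq)
       (intro product_integral_prod f finite_Basis)
qed

text \<open>Comparison with the product of the one-dimensional functions
  \<open>inverse (1 + t\<^sup>2)\<close>: every factor \<open>1 + (x \<bullet> b)\<^sup>2\<close> is
  at most \<open>(1 + norm x)\<^sup>2\<close>, whence the exponent
  \<open>2 * DIM('a)\<close>.\<close>

lemma integrable_inverse_weight:
  "integrable lborel (\<lambda>x::'a::euclidean_space. 1 / (1 + norm x) ^ (2 * DIM('a)))"
proof (rule Bochner_Integration.integrable_bound)
  have "integrable lborel (\<lambda>t::real. inverse (1 + t\<^sup>2))"
    using integrable_inverse_1_plus_square by (simp add: set_integrable_def einterval_def)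
  then show "integrable lborel (\<lambda>x::'a. \<Prod>b\<in>Basis. inverse (1 + (x \<bullet> b)\<^sup>2))"
    by (rule integrable_lborel_prod)
  show "AE x::'a in lborel. norm (1 / (1 + norm x) ^ (2 * DIM('a))) \<le> norm (\<Prod>b\<in>Basis. inverse (1 + (x \<bullet> b)\<^sup>2))"
  proof (rule AE_I2)
    fix x :: 'a
    have "(\<Prod>b\<in>(Basis::'a set). 1 + (x \<bullet> b)\<^sup>2) \<le> (\<Prod>b\<in>(Basis::'a set). (1 + norm x)\<^sup>2)"
    proof (rule prod_mono, safe)
      fix b :: 'a assume "b \<in> Basis"
      then have "(x \<bullet> b)\<^sup>2 \<le> (norm x)\<^sup>2" by (metis Basis_le_norm abs_le_square_iff abs_norm_cancel)
      then show "1 + (x \<bullet> b)\<^sup>2 \<le> (1 + norm x)\<^sup>2" using norm_ge_zero[of x] unfolding power2_sum one_power2 mult_1_right by linarith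
    qed simp
    also have "\<dots> = (1 + norm x) ^ (2 * DIM('a))" by (simp add: power_mult)
    finally have "(\<Prod>b\<in>(Basis::'a set). 1 + (x \<bullet> b)\<^sup>2) \<le> (1 + norm x) ^ (2 * DIM('a))" .
    moreover have "0 < (\<Prod>b\<in>(Basis::'a set). 1 + (x \<bullet> b)\<^sup>2)" by (intro prod_pos) (simp add: add_pos_nonneg)
    ultimately have "1 / (1 + norm x) ^ (2 * DIM('a)) \<le> 1 / (\<Prod>b\<in>Basis. 1 + (x \<bullet> b)\<^sup>2)"
      by (intro divide_left_mono mult_pos_pos) auto
    also have "\<dots> = (\<Prod>b\<in>Basis. inverse (1 + (x \<bullet> b)\<^sup>2))"
      by (simp add: inverse_eq_divide prod_dividef)
    finally show "norm (1 / (1 + norm x) ^ (2 * DIM('a))) \<le> norm (\<Prod>b\<in>Basis. inverse (1 + (x \<bullet> b)\<^sup>2))"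
      by simp
  qed
qed measurable

definition decay_mass :: "'a::euclidean_space itself \<Rightarrow> real" where
  "decay_mass _ = (LINT x|lborel. 1 / (1 + norm (x::'a)) ^ (2 * DIM('a)))"

lemma
  fixes f :: "'a::euclidean_space \<Rightarrow> 'b::{banach, second_countable_topology}"
  assumes m: "f \<in> borel_measurable borel"
    and C: "\<And>x. (1 + norm x) ^ (2 * DIM('a)) * norm (f x) \<le> C"
  shows integrable_decay: "integrable lborel f"
    and integral_decay_le: "(LINT x|lborel. norm (f x)) \<le> C * decay_mass TYPE('a)"
proof -
  have 1: "norm (f x) \<le> C * (1 / (1 + norm x) ^ (2 * DIM('a)))" for x
    using C[of x] by (simp add: field_simps add_pos_nonneg)
  have i: "integrable lborel (\<lambda>x::'a. C * (1 / (1 + norm x) ^ (2 * DIM('a))))"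
    by (intro integrable_mult_right integrable_inverse_weight)
  show I: "integrable lborel f"
    by (rule Bochner_Integration.integrable_bound[OF i]) (use m in \<open>auto simp: real_norm_def simp del: times_divide_eq_right norm_mult abs_mult mult_1_right intro!: AE_I2 order_trans[OF 1 abs_ge_self]\<close>)
  have "(LINT x|lborel. norm (f x)) \<le> (LINT x|lborel. C * (1 / (1 + norm (x::'a)) ^ (2 * DIM('a))))"
    by (intro integral_mono integrable_norm I i 1)
  also have "\<dots> = C * decay_mass TYPE('a)"
    unfolding decay_mass_def by (rule integral_mult_right_zero)
  finally show "(LINT x|lborel. norm (f x)) \<le> C * decay_mass TYPE('a)" .
qed

lemma decay_mass_nonneg: "0 \<le> decay_mass TYPE('a::euclidean_space)"
  unfolding decay_mass_def by (intro integral_nonneg_AE) auto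

lemma schwartz_integrable: "f \<in> schwartz \<Longrightarrow> integrable lborel f"
  using schwartz_bound integrable_decay schwartz_measurable by metis

lemma schwartz_L1_le:
  fixes f :: "'a::euclidean_space \<Rightarrow> complex"
  assumes "f \<in> schwartz"
  shows "(LINT x|lborel. norm (f x)) \<le> decay_mass TYPE('a) * schwartz_seminorm (2 * DIM('a)) f"
  using integral_decay_le[OF schwartz_measurable[OF assms] seminorm_ge0[OF assms order_refl]]
  by (simp add: mult.commute)

lemma schwartz_integrable_power:
  fixes f :: "'a::euclidean_space \<Rightarrow> complex"
  assumes "f \<in> schwartz"
  shows "integrable lborel (\<lambda>x. (1 + norm x) ^ k * norm (f x))"
proof -
  obtain C where C: "\<And>x. (1 + norm x) ^ (2 * DIM('a) + k) * norm (f x) \<le> C"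
    using schwartz_bound[OF assms] by metis
  show ?thesis
  proof (rule integrable_decay)
    show "(1 + norm x) ^ (2 * DIM('a)) * norm ((1 + norm x) ^ k * norm (f x)) \<le> C" for x
      using C[of x] by (simp add: power_add mult.assoc)
  qed (use schwartz_measurable[OF assms] in measurable)
qed

lemma
  fixes f :: "'a::euclidean_space \<Rightarrow> 'b::{banach, second_countable_topology}"
  assumes m[measurable]: "f \<in> borel_measurable borel" and c: "c \<noteq> 0"
  shows integral_affine: "(LINT x|lborel. f (t + c *\<^sub>R x)) = (1 / \<bar>c\<bar> ^ DIM('a)) *\<^sub>R (LINT x|lborel. f x)"
    and integrable_affine: "integrable lborel f \<Longrightarrow> integrable lborel (\<lambda>x. f (t + c *\<^sub>R x))"
proof -
  have [measurable]: "(\<lambda>x. t + c *\<^sub>R x) \<in> borel_measurable borel" by measurable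
  have "(LINT x|lborel. f x) = (LINT x|density (distr lborel borel (\<lambda>x. t + c *\<^sub>R x)) (\<lambda>_. \<bar>c\<bar> ^ DIM('a)). f x)"
    by (subst lborel_affine[OF c, of t]) (simp add: ennreal_power)
  also have "\<dots> = \<bar>c\<bar> ^ DIM('a) *\<^sub>R (LINT x|lborel. f (t + c *\<^sub>R x))"
    by (simp add: integral_density integral_distr)
  finally show "(LINT x|lborel. f (t + c *\<^sub>R x)) = (1 / \<bar>c\<bar> ^ DIM('a)) *\<^sub>R (LINT x|lborel. f x)"
    using c by simp
  assume "integrable lborel f"
  then have "integrable (density (distr lborel borel (\<lambda>x. t + c *\<^sub>R x)) (\<lambda>_. \<bar>c\<bar> ^ DIM('a))) f"
    by (subst (asm) lborel_affine[OF c, of t]) (simp add: ennreal_power)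
  then have "integrable lborel (\<lambda>x. \<bar>c\<bar> ^ DIM('a) *\<^sub>R f (t + c *\<^sub>R x))"
    by (simp add: integrable_density integrable_distr_eq)
  then have "integrable lborel (\<lambda>x. (1 / \<bar>c\<bar> ^ DIM('a)) *\<^sub>R (\<bar>c\<bar> ^ DIM('a) *\<^sub>R f (t + c *\<^sub>R x)))"
    by (rule integrable_scaleR_right)
  then show "integrable lborel (\<lambda>x. f (t + c *\<^sub>R x))"
    using c by simp
qed

lemma nn_integral_affine:
  fixes f :: "'a::euclidean_space \<Rightarrow> ennreal"
  assumes m[measurable]: "f \<in> borel_measurable borel" and c: "c \<noteq> 0"
  shows "(\<integral>\<^sup>+x. f (t + c *\<^sub>R x) \<partial>lborel) = ennreal (1 / \<bar>c\<bar> ^ DIM('a)) * (\<integral>\<^sup>+x. f x \<partial>lborel)"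
proof -
  have [measurable]: "(\<lambda>x. t + c *\<^sub>R x) \<in> borel_measurable borel" by measurable
  have "(\<integral>\<^sup>+x. f x \<partial>lborel) = (\<integral>\<^sup>+x. f x \<partial>density (distr lborel borel (\<lambda>x. t + c *\<^sub>R x)) (\<lambda>_. \<bar>c\<bar> ^ DIM('a)))"
    by (subst lborel_affine[OF c, of t]) (simp add: ennreal_power)
  also have "\<dots> = ennreal (\<bar>c\<bar> ^ DIM('a)) * (\<integral>\<^sup>+x. f (t + c *\<^sub>R x) \<partial>lborel)"
    by (simp add: nn_integral_density nn_integral_distr nn_integral_cmult)
  finally show ?thesis using c
    by (simp flip: mult.assoc ennreal_mult)
qed

lemma vector_derivative_quotient:
  assumes "(f has_vector_derivative D) (at (0::real))"
  shows "((\<lambda>t. (f t - f 0) /\<^sub>R t) \<longlongrightarrow> D) (at 0)"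
proof -
  have "((\<lambda>t. norm (f t - f 0 - (t - 0) *\<^sub>R D) / norm (t - 0)) \<longlongrightarrow> 0) (at 0)"
    using assms unfolding has_vector_derivative_def has_derivative_iff_norm by blast
  moreover have "\<forall>\<^sub>F t in at 0. norm (f t - f 0 - (t - 0) *\<^sub>R D) / norm (t - 0) = norm ((f t - f 0) /\<^sub>R t - D)"
  proof (rule eventually_mono[OF eventually_neq_at_within])
    fix t :: real assume t: "t \<noteq> 0"
    then have "(f t - f 0) /\<^sub>R t - D = (1 / t) *\<^sub>R (f t - f 0 - (t - 0) *\<^sub>R D)"
      by (simp add: scaleR_diff_right inverse_eq_divide)
    then show "norm (f t - f 0 - (t - 0) *\<^sub>R D) / norm (t - 0) = norm ((f t - f 0) /\<^sub>R t - D)"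
      by simp
  qed
  ultimately have "((\<lambda>t. norm ((f t - f 0) /\<^sub>R t - D)) \<longlongrightarrow> 0) (at 0)"
    by (rule Lim_transform_eventually)
  from LIM_zero_cancel[OF tendsto_norm_zero_cancel[OF this]] show ?thesis .
qed

text \<open>Proved with difference quotients: their integrals vanish by translation invariance.\<close>

lemma integral_pd_eq_0:
  fixes g :: "'a::euclidean_space \<Rightarrow> complex"
  assumes g: "g \<in> schwartz" and b: "b \<in> Basis"
  shows "(LINT x|lborel. pd b g x) = 0"
proof -
  let ?N = "2 * DIM('a)"
  define q where "q n x = of_nat (Suc n) * (g (x + (1 / real (Suc n)) *\<^sub>R b) - g x)" for n x
  obtain C where C: "C \<ge> 0" "\<And>x. (1 + norm x) ^ ?N * norm (pd b g x) \<le> C"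
    using schwartz_bound[OF schwartz_pd[OF g b]] by metis
  note [measurable] = schwartz_measurable[OF g] schwartz_measurable[OF schwartz_pd[OF g b]]
  have line: "((\<lambda>t. g (x + t *\<^sub>R b)) has_vector_derivative pd b g (x + t *\<^sub>R b)) (at t)" for x t
  proof -
    have 1: "((\<lambda>t. x + t *\<^sub>R b) has_derivative (\<lambda>h. h *\<^sub>R b)) (at t)"
      by (auto intro!: derivative_eq_intros)
    have 2: "(g has_derivative (\<lambda>h. pd h g (x + t *\<^sub>R b))) (at (x + t *\<^sub>R b))"
      by (rule has_derivative_pd[OF schwartz_differentiable[OF g]])
    show ?thesis
      using has_derivative_compose[OF 1 2] linear_scale[OF has_derivative_linear[OF 2]]
      by (simp add: has_vector_derivative_def)
  qed
  have "(\<lambda>n. LINT x|lborel. q n x) \<longlonglongrightarrow> (LINT x|lborel. pd b g x)"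
  proof (rule integral_dominated_convergence)
    \<comment> \<open>The mean value theorem replaces the quotient by the derivative at a point
      within distance 1 of \<open>x\<close>. There the weight is comparable up to a factor 2, raised
      to the power \<open>?N\<close>.\<close>
    show "integrable lborel (\<lambda>x::'a. (C * 2 ^ ?N) * (1 / (1 + norm x) ^ ?N))"
      by (intro integrable_mult_right integrable_inverse_weight)
    show "AE x in lborel. (\<lambda>n. q n x) \<longlonglongrightarrow> pd b g x"
    proof (rule AE_I2)
      fix x
      have "((\<lambda>t. (g (x + t *\<^sub>R b) - g (x + 0 *\<^sub>R b)) /\<^sub>R (t - 0)) \<longlongrightarrow> pd b g (x + 0 *\<^sub>R b)) (at 0)"
        using vector_derivative_quotient[OF line[of x 0]] by simp
      then have "((\<lambda>t. (g (x + t *\<^sub>R b) - g x) /\<^sub>R t) \<longlongrightarrow> pd b g x) (at 0)" by simp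
      moreover have "filterlim (\<lambda>n. 1 / real (Suc n)) (at 0) sequentially"
        using LIMSEQ_inverse_real_of_nat by (simp add: filterlim_at inverse_eq_divide)
      ultimately have "(\<lambda>n. (g (x + (1 / real (Suc n)) *\<^sub>R b) - g x) /\<^sub>R (1 / real (Suc n))) \<longlonglongrightarrow> pd b g x"
        by (rule filterlim_compose)
      then show "(\<lambda>n. q n x) \<longlonglongrightarrow> pd b g x" by (simp add: q_def scaleR_conv_of_real)
    qed
    show "AE x in lborel. norm (q n x) \<le> (C * 2 ^ ?N) * (1 / (1 + norm x) ^ ?N)" for n
    proof (rule AE_I2)
      fix x :: 'a
      have "\<exists>t\<in>{0<..<1 / real (Suc n)}. norm (g (x + (1 / real (Suc n)) *\<^sub>R b) - g (x + 0 *\<^sub>R b))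
        \<le> norm ((1 / real (Suc n) - 0) *\<^sub>R pd b g (x + t *\<^sub>R b))"
      proof (rule mvt_general)
        show "continuous_on {0..1 / real (Suc n)} (\<lambda>t. g (x + t *\<^sub>R b))"
          by (intro continuous_at_imp_continuous_on ballI has_vector_derivative_continuous[OF line])
        show "((\<lambda>t. g (x + t *\<^sub>R b)) has_derivative (\<lambda>h. h *\<^sub>R pd b g (x + t *\<^sub>R b))) (at t)" for t
          using line by (simp add: has_vector_derivative_def)
      qed simp
      then obtain t where t: "0 < t" "t < 1 / real (Suc n)"
        and le: "norm (g (x + (1 / real (Suc n)) *\<^sub>R b) - g x) \<le> 1 / real (Suc n) * norm (pd b g (x + t *\<^sub>R b))"
        by auto
      have "1 / real (Suc n) \<le> 1" by simp
      then have "t \<le> 1" using t(2) by linarith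
      then have "norm x \<le> norm (x + t *\<^sub>R b) + 1"
        using norm_triangle_ineq4[of "x + t *\<^sub>R b" "t *\<^sub>R b"] t b by simp
      then have "(1 + norm x) ^ ?N \<le> (2 * (1 + norm (x + t *\<^sub>R b))) ^ ?N"
        by (intro power_mono) (auto simp: algebra_simps intro: order_trans)
      then have "(1 + norm x) ^ ?N * norm (pd b g (x + t *\<^sub>R b)) \<le> (2 * (1 + norm (x + t *\<^sub>R b))) ^ ?N * norm (pd b g (x + t *\<^sub>R b))"
        by (rule mult_right_mono) simp
      also have "\<dots> = 2 ^ ?N * ((1 + norm (x + t *\<^sub>R b)) ^ ?N * norm (pd b g (x + t *\<^sub>R b)))"
        by (simp only: power_mult_distrib mult.assoc)
      also have "\<dots> \<le> 2 ^ ?N * C" by (intro mult_left_mono C) simp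
      finally have "norm (pd b g (x + t *\<^sub>R b)) \<le> (C * 2 ^ ?N) * (1 / (1 + norm x) ^ ?N)"
        by (simp add: field_simps add_pos_nonneg)
      moreover have "norm (q n x) \<le> norm (pd b g (x + t *\<^sub>R b))"
      proof -
        have "norm (q n x) = real (Suc n) * norm (g (x + (1 / real (Suc n)) *\<^sub>R b) - g x)"
          unfolding q_def norm_mult by (simp only: norm_of_nat)
        also have "\<dots> \<le> real (Suc n) * (1 / real (Suc n) * norm (pd b g (x + t *\<^sub>R b)))"
          by (intro mult_left_mono le) simp
        finally show ?thesis by simp
      qed
      ultimately show "norm (q n x) \<le> (C * 2 ^ ?N) * (1 / (1 + norm x) ^ ?N)" by linarith
    qed
  qed (simp_all add: q_def)
  moreover have "(LINT x|lborel. q n x) = 0" for n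
  proof -
    have i: "integrable lborel g" by (rule schwartz_integrable[OF g])
    have "(LINT x|lborel. g (x + (1 / real (Suc n)) *\<^sub>R b)) = (LINT x|lborel. g x)"
      using integral_affine[of g 1 "(1 / real (Suc n)) *\<^sub>R b"] by (simp add: add.commute)
    moreover have "integrable lborel (\<lambda>x. g (x + (1 / real (Suc n)) *\<^sub>R b))"
      using integrable_affine[OF _ _ i, of 1 "(1 / real (Suc n)) *\<^sub>R b"] by (simp add: add.commute)
    ultimately show ?thesis unfolding q_def using i by simp
  qed
  ultimately show ?thesis by (simp add: LIMSEQ_const_iff)
qed

text \<open>The product of a slowly growing and a Schwartz function is again Schwartz, so its
  derivative integrates to zero. Allowing \<open>g\<close> in \<open>slow\<close> covers plane
  waves, as needed in \<open>fourier_pd\<close>.\<close>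

lemma integral_by_parts:
  assumes "f \<in> schwartz" "g \<in> slow" "b \<in> Basis"
  shows "(LINT x|lborel. g x * pd b f x) = - (LINT x|lborel. pd b g x * f x)"
proof -
  have "pd b (\<lambda>x. g x * f x) = (\<lambda>x. g x * pd b f x + pd b g x * f x)"
    using assms by (intro pd_mult slow_differentiable schwartz_differentiable)
  then have "0 = (LINT x|lborel. g x * pd b f x + pd b g x * f x)"
    using integral_pd_eq_0[OF schwartz_slow_mult[OF assms(2,1)] assms(3)] by simp
  also have "\<dots> = (LINT x|lborel. g x * pd b f x) + (LINT x|lborel. pd b g x * f x)"
    by (intro Bochner_Integration.integral_add schwartz_integrable schwartz_slow_mult slow_pd schwartz_pd assms)
  finally show ?thesis by (simp add: eq_neg_iff_add_eq_0)
qed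

section \<open>The Fourier transform on the Schwartz space\<close>

lemma cis_measurable [measurable]: "cis \<in> borel_measurable borel"
  by (intro borel_measurable_continuous_onI continuous_intros)

lemma fourier_integrable:
  assumes "integrable lborel f" and [measurable]: "t \<in> borel_measurable borel"
  shows "integrable lborel (\<lambda>x. cis (t x) * f x)"
proof -
  have [measurable]: "f \<in> borel_measurable borel" using assms by auto
  show ?thesis
    by (rule Bochner_Integration.integrable_bound[OF assms(1)]) (auto simp: norm_mult)
qed

lemma fourier_norm_le: "norm (fourier f \<xi>) \<le> (LINT x|lborel. norm (f x))"
  unfolding fourier_def
  by (rule order_trans[OF integral_norm_bound]) (simp add: norm_mult)

lemma fourier_lincomb:
  assumes "integrable lborel f" "integrable lborel g"
  shows "fourier (\<lambda>x. a * f x + b * g x) = (\<lambda>\<xi>. a * fourier f \<xi> + b * fourier g \<xi>)"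
proof
  fix \<xi>
  have "fourier (\<lambda>x. a * f x + b * g x) \<xi> =
      (LINT x|lborel. a * (cis (- (x \<bullet> \<xi>)) * f x) + b * (cis (- (x \<bullet> \<xi>)) * g x))"
    unfolding fourier_def by (simp add: algebra_simps)
  also have "\<dots> = a * fourier f \<xi> + b * fourier g \<xi>"
    unfolding fourier_def using assms by (simp add: fourier_integrable)
  finally show "fourier (\<lambda>x. a * f x + b * g x) \<xi> = a * fourier f \<xi> + b * fourier g \<xi>" .
qed

lemma inv_fourier_eq:
  fixes f :: "'a::euclidean_space \<Rightarrow> complex"
  shows "inv_fourier f x = (1 / of_real ((2 * pi) ^ DIM('a))) * fourier f (- x)"
  unfolding inv_fourier_def fourier_def by (simp add: inner_commute)

lemma cis_taylor: "norm (cis (- t) - 1 + \<i> * of_real t) \<le> t\<^sup>2"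
proof -
  have "norm (iexp (- t) - (\<Sum>k\<le>1. (\<i> * of_real (- t)) ^ k / fact k)) \<le> \<bar>- t\<bar> ^ Suc 1 / fact (Suc 1)"
    by (rule iexp_approx1)
  then have "norm (cis (- t) - 1 + \<i> * of_real t) \<le> t\<^sup>2 / 2"
    by (simp add: cis_conv_exp algebra_simps power2_eq_square numeral_2_eq_2)
  also have "\<dots> \<le> t\<^sup>2" by simp
  finally show ?thesis .
qed

text \<open>The second-order Taylor bound \<open>cis_taylor\<close>, integrated against
  \<open>f\<close>, leaves a remainder of at most the squared increment times a finite second
  moment.\<close>

lemma fourier_has_derivative:
  fixes f :: "'a::euclidean_space \<Rightarrow> complex"
  assumes f: "f \<in> schwartz"
  shows "(fourier f has_derivative
    (\<lambda>h. \<Sum>b\<in>Basis. (h \<bullet> b) *\<^sub>R fourier (\<lambda>x. - \<i> * of_real (x \<bullet> b) * f x) \<xi>)) (at \<xi>)"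
    (is "(_ has_derivative ?L) _")
proof (rule has_derivativeI_sandwich)
  let ?I = "LINT x|lborel. (1 + norm x) ^ 2 * norm (f x)"
  note [measurable] = schwartz_measurable[OF f]
  have i: "integrable lborel f" by (rule schwartz_integrable[OF f])
  have ib: "integrable lborel (\<lambda>x. - \<i> * of_real (x \<bullet> b) * f x)" for b
    using schwartz_integrable[OF schwartz_scale[OF schwartz_inner_mult[OF f, of b], of "- \<i>"]]
    by (simp only: mult.assoc)
  show "bounded_linear ?L"
    by (intro bounded_linear_sum bounded_linear_scaleR_const bounded_linear_inner_left)
  show "(0::real) < 1" by simp
  have L: "?L h = (LINT x|lborel. cis (- (x \<bullet> \<xi>)) * (- \<i> * of_real (x \<bullet> h) * f x))" for h
  proof -
    have "?L h = (\<Sum>b\<in>Basis. (LINT x|lborel. (h \<bullet> b) *\<^sub>R (cis (- (x \<bullet> \<xi>)) * (- \<i> * of_real (x \<bullet> b) * f x))))"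
      unfolding fourier_def by simp
    also have "\<dots> = (LINT x|lborel. (\<Sum>b\<in>Basis. (h \<bullet> b) *\<^sub>R (cis (- (x \<bullet> \<xi>)) * (- \<i> * of_real (x \<bullet> b) * f x))))"
      by (intro Bochner_Integration.integral_sum[symmetric] integrable_scaleR_right fourier_integrable ib) simp
    also have "\<dots> = (LINT x|lborel. cis (- (x \<bullet> \<xi>)) * (- \<i> * of_real (x \<bullet> h) * f x))"
    proof (intro Bochner_Integration.integral_cong refl)
      fix x
      have "(\<Sum>b\<in>Basis. (h \<bullet> b) *\<^sub>R (cis (- (x \<bullet> \<xi>)) * (- \<i> * of_real (x \<bullet> b) * f x)))
        = of_real (\<Sum>b\<in>Basis. (x \<bullet> b) * (h \<bullet> b)) * (cis (- (x \<bullet> \<xi>)) * (- \<i> * f x))"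
        unfolding of_real_sum sum_distrib_right by (intro sum.cong refl) (simp add: scaleR_conv_of_real)
      also have "(\<Sum>b\<in>Basis. (x \<bullet> b) * (h \<bullet> b)) = x \<bullet> h" by (rule euclidean_inner[symmetric])
      finally show "(\<Sum>b\<in>Basis. (h \<bullet> b) *\<^sub>R (cis (- (x \<bullet> \<xi>)) * (- \<i> * of_real (x \<bullet> b) * f x)))
        = cis (- (x \<bullet> \<xi>)) * (- \<i> * of_real (x \<bullet> h) * f x)" by (simp add: mult_ac)
    qed
    finally show ?thesis .
  qed
  have ih: "integrable lborel (\<lambda>x. cis (- (x \<bullet> \<xi>)) * (- \<i> * of_real (x \<bullet> h) * f x))" for h
    by (intro fourier_integrable ib) simp
  show "norm (fourier f \<eta> - fourier f \<xi> - ?L (\<eta> - \<xi>)) / norm (\<eta> - \<xi>) \<le> norm (\<eta> - \<xi>) * ?I"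
    if "\<eta> \<noteq> \<xi>" for \<eta>
  proof -
    define h where "h = \<eta> - \<xi>"
    have "fourier f \<eta> - fourier f \<xi> - ?L h =
      (LINT x|lborel. cis (- (x \<bullet> \<eta>)) * f x - cis (- (x \<bullet> \<xi>)) * f x - cis (- (x \<bullet> \<xi>)) * (- \<i> * of_real (x \<bullet> h) * f x))"
    proof -
      have 1: "integrable lborel (\<lambda>x. cis (- (x \<bullet> \<eta>)) * f x)" for \<eta>
        by (intro fourier_integrable i) simp
      show ?thesis
        unfolding L unfolding fourier_def
        using Bochner_Integration.integral_diff[OF Bochner_Integration.integrable_diff[OF 1[of \<eta>] 1[of \<xi>]] ih[of h]]
          Bochner_Integration.integral_diff[OF 1[of \<eta>] 1[of \<xi>]] by simp
    qed
    also have "norm \<dots> \<le> (LINT x|lborel. (norm h)\<^sup>2 * ((1 + norm x) ^ 2 * norm (f x)))"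
    proof (rule order_trans[OF integral_norm_bound], rule integral_mono)
      fix x :: 'a
      have "cis (- (x \<bullet> \<eta>)) * f x - cis (- (x \<bullet> \<xi>)) * f x - cis (- (x \<bullet> \<xi>)) * (- \<i> * of_real (x \<bullet> h) * f x)
        = cis (- (x \<bullet> \<xi>)) * ((cis (- (x \<bullet> h)) - 1 + \<i> * of_real (x \<bullet> h)) * f x)"
        unfolding h_def inner_diff_right by (simp add: algebra_simps cis_mult)
      then have "norm (cis (- (x \<bullet> \<eta>)) * f x - cis (- (x \<bullet> \<xi>)) * f x - cis (- (x \<bullet> \<xi>)) * (- \<i> * of_real (x \<bullet> h) * f x))
        = norm (cis (- (x \<bullet> h)) - 1 + \<i> * of_real (x \<bullet> h)) * norm (f x)"
        by (simp only: norm_mult norm_cis mult_1)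
      also have "\<dots> \<le> (x \<bullet> h)\<^sup>2 * norm (f x)"
        by (intro mult_right_mono cis_taylor) simp
      also have "(x \<bullet> h)\<^sup>2 \<le> (norm x * norm h)\<^sup>2"
        using Cauchy_Schwarz_ineq2[of x h] by (metis abs_ge_zero power2_abs power_mono)
      also have "(norm x * norm h)\<^sup>2 \<le> ((1 + norm x) * norm h)\<^sup>2"
        by (intro power_mono mult_right_mono) auto
      finally show "norm (cis (- (x \<bullet> \<eta>)) * f x - cis (- (x \<bullet> \<xi>)) * f x - cis (- (x \<bullet> \<xi>)) * (- \<i> * of_real (x \<bullet> h) * f x))
        \<le> (norm h)\<^sup>2 * ((1 + norm x) ^ 2 * norm (f x))"
        by (simp add: power_mult_distrib mult_ac mult_right_mono)
    qed (intro integrable_norm Bochner_Integration.integrable_diff fourier_integrable i ih integrable_mult_right schwartz_integrable_power[OF f]; simp)+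
    also have "\<dots> = (norm h)\<^sup>2 * ?I" by simp
    finally have "norm (fourier f \<eta> - fourier f \<xi> - ?L h) \<le> (norm h)\<^sup>2 * ?I" .
    moreover have "norm h > 0" using that by (simp add: h_def)
    ultimately show ?thesis unfolding h_def[symmetric] by (simp add: divide_le_eq power2_eq_square mult_ac)
  qed
  have "((\<lambda>\<eta>. norm (\<eta> - \<xi>) * ?I) \<longlongrightarrow> norm (\<xi> - \<xi>) * ?I) (at \<xi>)"
    by (intro tendsto_intros)
  then show "((\<lambda>\<eta>. norm (\<eta> - \<xi>) * ?I) \<longlongrightarrow> 0) (at \<xi>)" by simp
qed

lemma pd_fourier:
  assumes f: "f \<in> schwartz" and b: "b \<in> Basis"
  shows "pd b (fourier f) = fourier (\<lambda>x. - \<i> * of_real (x \<bullet> b) * f x)"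
proof
  fix \<xi>
  show "pd b (fourier f) \<xi> = fourier (\<lambda>x. - \<i> * of_real (x \<bullet> b) * f x) \<xi>"
    using b by (subst pd_eq[OF fourier_has_derivative[OF f]])
      (simp add: inner_Basis if_distrib[where f="\<lambda>u. u *\<^sub>R _"] cong: if_cong)
qed

lemma pd_cis: "pd b (\<lambda>x. c * cis (- (x \<bullet> \<xi>))) = (\<lambda>x. (- \<i> * of_real (b \<bullet> \<xi>) * c) * cis (- (x \<bullet> \<xi>)))"
  and cis_differentiable: "(\<lambda>x. c * cis (- (x \<bullet> \<xi>))) differentiable (at x)"
proof -
  have d: "((\<lambda>x. c * cis (- (x \<bullet> \<xi>))) has_derivative
      (\<lambda>h. c * (of_real (- (h \<bullet> \<xi>)) * (\<i> * cis (- (x \<bullet> \<xi>)))))) (at x)" for x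
  proof -
    have 1: "((\<lambda>x. - (x \<bullet> \<xi>)) has_derivative (\<lambda>h. - (h \<bullet> \<xi>))) (at x)"
      by (intro derivative_intros has_derivative_ident[THEN has_derivative_inner_left])
    have "(cis has_vector_derivative (\<i> * cis t)) (at t)" for t
    proof -
      have "((\<lambda>t. exp (\<i> * complex_of_real t)) has_vector_derivative \<i> * exp (\<i> * of_real t)) (at t)"
        by (auto intro!: derivative_eq_intros has_vector_derivative_real_field simp: mult.commute)
      then show ?thesis by (simp add: cis_conv_exp[abs_def])
    qed
    then have "(cis has_derivative (\<lambda>h. h *\<^sub>R (\<i> * cis t))) (at t)" for t
      by (simp add: has_vector_derivative_def)
    from has_derivative_compose[OF 1 this]
    have "((\<lambda>x. cis (- (x \<bullet> \<xi>))) has_derivative (\<lambda>h. (- (h \<bullet> \<xi>)) *\<^sub>R (\<i> * cis (- (x \<bullet> \<xi>))))) (at x)"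
      .
    from has_derivative_mult_right[OF this, of c] show ?thesis by (simp add: scaleR_conv_of_real)
  qed
  show "pd b (\<lambda>x. c * cis (- (x \<bullet> \<xi>))) = (\<lambda>x. (- \<i> * of_real (b \<bullet> \<xi>) * c) * cis (- (x \<bullet> \<xi>)))"
    by (rule ext, subst pd_eq[OF d]) (simp add: mult_ac)
  show "(\<lambda>x. c * cis (- (x \<bullet> \<xi>))) differentiable (at x)"
    using d by (auto simp: differentiable_def)
qed

lemma slow_cis: "(\<lambda>x. cis (- (x \<bullet> \<xi>))) \<in> slow"
proof (rule slow_coinduct)
  let ?A = "range (\<lambda>c x. c * cis (- (x \<bullet> \<xi>)))"
  show "(\<lambda>x. cis (- (x \<bullet> \<xi>))) \<in> ?A" by (auto intro!: rev_image_eqI[of 1])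
  fix g assume "g \<in> ?A"
  then obtain c where g: "g = (\<lambda>x. c * cis (- (x \<bullet> \<xi>)))" by blast
  show "g differentiable at x" for x unfolding g by (rule cis_differentiable)
  show "pd b g \<in> ?A" for b unfolding g pd_cis by blast
  show "\<exists>C N. \<forall>x. norm (g x) \<le> C * (1 + norm x) ^ N"
    by (auto simp: g norm_mult intro!: exI[of _ "norm c"] exI[of _ "0::nat"])
qed

lemma fourier_pd:
  assumes "f \<in> schwartz" "b \<in> Basis"
  shows "fourier (pd b f) \<xi> = \<i> * of_real (\<xi> \<bullet> b) * fourier f \<xi>"
proof -
  have "fourier (pd b f) \<xi> = - (LINT x|lborel. pd b (\<lambda>x. cis (- (x \<bullet> \<xi>))) x * f x)"
    unfolding fourier_def by (rule integral_by_parts[OF assms(1) slow_cis assms(2)])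
  also have "\<dots> = - (LINT x|lborel. (- \<i> * of_real (b \<bullet> \<xi>)) * (cis (- (x \<bullet> \<xi>)) * f x))"
    using pd_cis[of b 1 \<xi>] by (simp add: mult.assoc)
  also have "\<dots> = \<i> * of_real (\<xi> \<bullet> b) * fourier f \<xi>"
    unfolding fourier_def by (simp add: inner_commute)
  finally show ?thesis .
qed

text \<open>Each further factor \<open>1 + norm \<xi>\<close> is at most 1 plus the sum of the
  absolute coordinates, and \<open>fourier_pd\<close> trades a coordinate for a derivative of
  \<open>f\<close>. The base case bounds the transform by the L^1 norm.\<close>

lemma fourier_seminorm_aux:
  "\<exists>C\<ge>0. \<exists>j. \<forall>f\<in>schwartz. \<forall>\<xi>::'a::euclidean_space.
     (1 + norm \<xi>) ^ k * norm (fourier f \<xi>) \<le> C * schwartz_seminorm j f"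
proof (induction k)
  case 0
  have "norm (fourier f \<xi>) \<le> decay_mass TYPE('a) * schwartz_seminorm (2 * DIM('a)) f"
    if "f \<in> schwartz" for f and \<xi> :: 'a
    using fourier_norm_le schwartz_L1_le[OF that] by (rule order_trans)
  then show ?case using decay_mass_nonneg by auto
next
  case (Suc k)
  then obtain C j where C: "0 \<le> C" "\<And>f \<xi>. f \<in> schwartz \<Longrightarrow>
     (1 + norm (\<xi>::'a)) ^ k * norm (fourier f \<xi>) \<le> C * schwartz_seminorm j f" by blast
  have "(1 + norm \<xi>) ^ Suc k * norm (fourier f \<xi>) \<le> (C + real DIM('a) * C) * schwartz_seminorm (Suc j) f"
    if f: "f \<in> schwartz" for f and \<xi> :: 'a
  proof -
    have "(1 + norm \<xi>) ^ Suc k * norm (fourier f \<xi>)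
        \<le> (1 + (\<Sum>b\<in>Basis. \<bar>\<xi> \<bullet> b\<bar>)) * ((1 + norm \<xi>) ^ k * norm (fourier f \<xi>))"
      using norm_le_l1[of \<xi>] by (simp add: mult.assoc mult_right_mono)
    also have "\<dots> = (1 + norm \<xi>) ^ k * norm (fourier f \<xi>)
        + (\<Sum>b\<in>Basis. (1 + norm \<xi>) ^ k * norm (fourier (pd b f) \<xi>))"
      unfolding distrib_right sum_distrib_right mult_1
      by (intro arg_cong2[of _ _ _ _ "(+)"] sum.cong refl) (simp add: fourier_pd[OF f] norm_mult)
    also have "\<dots> \<le> C * schwartz_seminorm (Suc j) f + (\<Sum>b\<in>(Basis::'a set). C * schwartz_seminorm (Suc j) f)"
    proof (intro add_mono sum_mono)
      show "(1 + norm \<xi>) ^ k * norm (fourier f \<xi>) \<le> C * schwartz_seminorm (Suc j) f"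
        using C(2)[OF f, of \<xi>] mult_left_mono[OF seminorm_mono[OF f, of j "Suc j"] C(1)] by simp
      fix b :: 'a assume b: "b \<in> Basis"
      show "(1 + norm \<xi>) ^ k * norm (fourier (pd b f) \<xi>) \<le> C * schwartz_seminorm (Suc j) f"
        using C(2)[OF schwartz_pd[OF f b], of \<xi>] mult_left_mono[OF seminorm_pd[OF f b, of j] C(1)] by simp
    qed
    also have "\<dots> = (C + real DIM('a) * C) * schwartz_seminorm (Suc j) f" by (simp add: algebra_simps)
    finally show ?thesis .
  qed
  then show ?case using C(1) by (metis add_nonneg_nonneg mult_nonneg_nonneg of_nat_0_le_iff)
qed

lemma fourier_schwartz:
  assumes "f \<in> schwartz" shows "fourier f \<in> schwartz"
proof (rule schwartz_coinduct)
  show "fourier f \<in> fourier ` schwartz" using assms by blast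
  fix g :: "'a \<Rightarrow> complex" assume "g \<in> fourier ` schwartz"
  then obtain f where g: "g = fourier f" and f: "f \<in> schwartz" by blast
  show "g differentiable at x" for x
    unfolding g using fourier_has_derivative[OF f] by (auto simp: differentiable_def)
  show "pd b g \<in> fourier ` schwartz" if "b \<in> Basis" for b
    unfolding g pd_fourier[OF f that]
    using schwartz_scale[OF schwartz_inner_mult[OF f, of b], of "- \<i>"] by (simp only: mult.assoc imageI)
  show "\<exists>C. \<forall>x. (1 + norm x) ^ k * norm (g x) \<le> C" for k
    using fourier_seminorm_aux[of k] f unfolding g by blast
qed

lemma schwartz_cont_scale: "schwartz_cont (\<lambda>f x. c * f x)"
  using schwartz_cont_mult[OF slow_const] .

text \<open>A derivative in frequency is a multiplication by a coordinate before the transform. So a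
  word of derivatives of \<open>fourier f\<close> is \<open>fourier (M f)\<close> with
  \<open>M\<close> continuous, and \<open>fourier_seminorm_aux\<close> applies to
  \<open>M f\<close>.\<close>

lemma schwartz_cont_fourier: "schwartz_cont (fourier :: ('a::euclidean_space \<Rightarrow> complex) \<Rightarrow> _)"
proof (rule schwartz_contI)
  fix k and vs :: "'a list" assume "set vs \<subseteq> Basis"
  then have "\<exists>M. schwartz_cont M \<and> (\<forall>f\<in>schwartz. iter_deriv vs (fourier f) = fourier (M f))"
  proof (induction vs)
    case Nil
    have "schwartz_cont (\<lambda>f :: 'a \<Rightarrow> complex. \<lambda>x. 1 * f x)" by (rule schwartz_cont_scale)
    then show ?case by (intro exI[of _ "\<lambda>f. f"]) simp
  next
    case (Cons b vs)
    then obtain M where M: "schwartz_cont M" "\<And>f. f \<in> schwartz \<Longrightarrow> iter_deriv vs (fourier f) = fourier (M f)"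
      and b: "b \<in> Basis" by auto
    have "schwartz_cont (\<lambda>f x. - \<i> * (of_real (x \<bullet> b) * M f x))"
      by (intro schwartz_cont_comp[OF schwartz_cont_scale]
          schwartz_cont_comp[OF schwartz_cont_mult[OF slow_inner]] M)
    moreover have "iter_deriv (b # vs) (fourier f) = fourier (\<lambda>x. - \<i> * (of_real (x \<bullet> b) * M f x))"
      if "f \<in> schwartz" for f
      unfolding iter_deriv_Cons M(2)[OF that] pd_fourier[OF schwartz_contD[OF M(1) that] b]
      by (simp only: mult.assoc)
    ultimately show ?case by (intro exI[of _ "\<lambda>f x. - \<i> * (of_real (x \<bullet> b) * M f x)"]) blast
  qed
  then obtain M where M: "schwartz_cont M" "\<And>f. f \<in> schwartz \<Longrightarrow> iter_deriv vs (fourier f) = fourier (M f)"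
    by blast
  obtain C j where C: "0 \<le> C" "\<And>f \<xi>. f \<in> schwartz \<Longrightarrow>
     (1 + norm (\<xi>::'a)) ^ k * norm (fourier f \<xi>) \<le> C * schwartz_seminorm j f"
    using fourier_seminorm_aux[where 'a='a, of k] by blast
  obtain D i where D: "0 \<le> D" "\<And>f. f \<in> schwartz \<Longrightarrow> schwartz_seminorm j (M f) \<le> D * schwartz_seminorm i f"
    using schwartz_cont_seminorm[OF M(1), of j] by blast
  have "(1 + norm \<xi>) ^ k * norm (iter_deriv vs (fourier f) \<xi>) \<le> (C * D) * schwartz_seminorm i f"
    if "f \<in> schwartz" for f \<xi>
    using C(2)[OF schwartz_contD[OF M(1) that], of \<xi>] mult_left_mono[OF D(2)[OF that] C(1)]
    unfolding M(2)[OF that] by (simp add: mult.assoc)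
  then show "\<exists>C\<ge>0. \<exists>j. \<forall>f\<in>schwartz. \<forall>\<xi>.
      (1 + norm \<xi>) ^ k * norm (iter_deriv vs (fourier f) \<xi>) \<le> C * schwartz_seminorm j f"
    using C(1) D(1) by (metis mult_nonneg_nonneg)
qed (rule fourier_schwartz)

lemma iter_deriv_dilate:
  assumes "f \<in> schwartz" "set vs \<subseteq> Basis"
  shows "iter_deriv vs (\<lambda>x. f (c *\<^sub>R x)) = (\<lambda>x. of_real (c ^ length vs) * iter_deriv vs f (c *\<^sub>R x))"
  using assms(2)
proof (induction vs)
  case (Cons b vs)
  let ?g = "iter_deriv vs f"
  have g: "?g \<in> schwartz" using Cons assms by (intro schwartz_iter_deriv) auto
  have d: "(\<lambda>x. ?g (c *\<^sub>R x)) differentiable at x" for x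
  proof -
    have "((\<lambda>x. c *\<^sub>R x) has_derivative (\<lambda>h. c *\<^sub>R h)) (at x)"
      by (auto intro!: derivative_eq_intros)
    from has_derivative_compose[OF this has_derivative_pd[OF schwartz_differentiable[OF g]]]
    show ?thesis by (auto simp: differentiable_def)
  qed
  have "iter_deriv (b # vs) (\<lambda>x. f (c *\<^sub>R x)) = pd b (\<lambda>x. of_real (c ^ length vs) * ?g (c *\<^sub>R x) + 0 * ?g (c *\<^sub>R x))"
    using Cons by (simp add: iter_deriv_Cons del: iter_deriv.simps)
  also have "\<dots> = (\<lambda>x. of_real (c ^ length vs) * pd b (\<lambda>x. ?g (c *\<^sub>R x)) x + 0 * pd b (\<lambda>x. ?g (c *\<^sub>R x)) x)"
    by (rule pd_lincomb[OF d d])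
  also have "\<dots> = (\<lambda>x. of_real (c ^ length (b # vs)) * iter_deriv (b # vs) f (c *\<^sub>R x))"
    by (simp add: pd_dilate[OF schwartz_differentiable[OF g]] scaleR_conv_of_real iter_deriv_Cons mult_ac fun_eq_iff
        del: iter_deriv.simps)
  finally show ?case .
qed simp

lemma schwartz_cont_reflect: "schwartz_cont (\<lambda>f x. f (- x))"
proof (rule schwartz_contI)
  show "(\<lambda>x. f (- x)) \<in> schwartz" if "f \<in> schwartz" for f :: "'a \<Rightarrow> complex"
    using schwartz_dilate[OF that, of "-1"] by simp
  fix k and vs :: "'a list" assume vs: "set vs \<subseteq> Basis"
  have "(1 + norm x) ^ k * norm (iter_deriv vs (\<lambda>x. f (- x)) x) \<le> 1 * schwartz_seminorm (k + length vs) f"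
    if f: "f \<in> schwartz" for f x
    using seminorm_ge[OF f vs, of "k + length vs" k "- x"] iter_deriv_dilate[OF f vs, of "-1"]
    by (simp add: norm_mult norm_power)
  then show "\<exists>C\<ge>0. \<exists>j. \<forall>f\<in>schwartz. \<forall>x.
      (1 + norm x) ^ k * norm (iter_deriv vs (\<lambda>x. f (- x)) x) \<le> C * schwartz_seminorm j f"
    using zero_le_one by blast
qed

lemma schwartz_cont_inv_fourier: "schwartz_cont (inv_fourier :: ('a::euclidean_space \<Rightarrow> complex) \<Rightarrow> _)"
proof -
  have "schwartz_cont (\<lambda>f (x :: 'a). (1 / of_real ((2 * pi) ^ DIM('a))) * fourier f (- x))"
    by (rule schwartz_cont_comp[OF schwartz_cont_scale schwartz_cont_comp[OF schwartz_cont_reflect schwartz_cont_fourier]])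
  then show ?thesis by (simp only: inv_fourier_eq[abs_def])
qed

lemmas inv_fourier_schwartz = schwartz_contD[OF schwartz_cont_inv_fourier]

subsection \<open>Inversion\<close>

lemma fourier_multiplication:
  fixes f g :: "'a::euclidean_space \<Rightarrow> complex"
  assumes f: "integrable lborel f" and g: "integrable lborel g"
  shows "(LINT x|lborel. fourier f x * g x) = (LINT x|lborel. f x * fourier g x)"
proof -
  have [measurable]: "f \<in> borel_measurable borel" "g \<in> borel_measurable borel" using f g by auto
  have I: "integrable (lborel \<Otimes>\<^sub>M lborel) (\<lambda>(x, y). cis (- (x \<bullet> y)) * (f x * g y))"
  proof (rule lborel_pair.Fubini_integrable)
    show "integrable lborel (\<lambda>x. LINT y|lborel. norm (case (x, y) of (x, y) \<Rightarrow> cis (- (x \<bullet> y)) * (f x * g y)))"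
      using f g by (simp add: norm_mult)
    show "AE x in lborel. integrable lborel (\<lambda>y. case (x, y) of (x, y) \<Rightarrow> cis (- (x \<bullet> y)) * (f x * g y))"
      using g by (auto intro!: fourier_integrable)
  qed measurable
  have "(LINT x|lborel. f x * fourier g x) = (LINT x|lborel. LINT y|lborel. cis (- (x \<bullet> y)) * (f x * g y))"
    unfolding fourier_def by (simp add: inner_commute mult_ac flip: integral_mult_right_zero)
  also have "\<dots> = (LINT y|lborel. LINT x|lborel. cis (- (x \<bullet> y)) * (f x * g y))"
    by (rule lborel_pair.Fubini_integral[OF I, symmetric])
  also have "\<dots> = (LINT x|lborel. fourier f x * g x)"
    unfolding fourier_def by (simp only: integral_mult_left_zero mult.assoc[symmetric])
  finally show ?thesis ..
qed

text \<open>The normalisation makes it an eigenfunction of \<open>fourier\<close>, by way of the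
  characteristic function of the standard normal law in each coordinate.\<close>

definition gaussian :: "'a::euclidean_space \<Rightarrow> complex" where
  "gaussian x = of_real (exp (- (norm x)\<^sup>2 / 2))"

lemma gaussian_real_fourier:
  "integrable lborel (\<lambda>t::real. complex_of_real (exp (- t\<^sup>2 / 2)))"
  "(LINT t|lborel. cis (- (t * s)) * complex_of_real (exp (- t\<^sup>2 / 2))) = of_real (sqrt (2 * pi) * exp (- s\<^sup>2 / 2))"
proof -
  have e: "exp (- t\<^sup>2 / 2) = sqrt (2 * pi) * std_normal_density t" for t
    by (simp add: std_normal_density_def)
  show "integrable lborel (\<lambda>t::real. complex_of_real (exp (- t\<^sup>2 / 2)))"
    unfolding e using integrable_normal_density[of 1 0] by (intro integrable_of_real integrable_mult_right) simp
  have "char std_normal_distribution (- s) = (LINT t|lborel. std_normal_density t *\<^sub>R iexp (- s * t))"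
    unfolding char_def by (subst integral_density) auto
  then have "(LINT t|lborel. std_normal_density t *\<^sub>R iexp (- s * t)) = complex_of_real (exp (- s\<^sup>2 / 2))"
    by (simp add: char_std_normal_distribution)
  moreover have "cis (- (t * s)) * complex_of_real (exp (- t\<^sup>2 / 2)) = of_real (sqrt (2 * pi)) * (std_normal_density t *\<^sub>R iexp (- s * t))" for t
    unfolding e cis_conv_exp by (simp add: scaleR_conv_of_real mult_ac)
  ultimately show "(LINT t|lborel. cis (- (t * s)) * complex_of_real (exp (- t\<^sup>2 / 2))) = of_real (sqrt (2 * pi) * exp (- s\<^sup>2 / 2))"
    by (simp only: integral_mult_right_zero of_real_mult)
qed

lemma gaussian_prod:
  fixes x :: "'a::euclidean_space"
  shows "gaussian x = (\<Prod>b\<in>Basis. of_real (exp (- (x \<bullet> b)\<^sup>2 / 2)))"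
proof -
  have "(norm x)\<^sup>2 = (\<Sum>b\<in>Basis. (x \<bullet> b)\<^sup>2)"
    unfolding power2_norm_eq_inner by (subst euclidean_inner) (simp add: power2_eq_square)
  then have "- (norm x)\<^sup>2 / 2 = (\<Sum>b\<in>Basis. - (x \<bullet> b)\<^sup>2 / 2)"
    by (simp add: sum_negf sum_divide_distrib)
  then show ?thesis unfolding gaussian_def by (simp add: exp_sum)
qed

lemma gaussian_integrable: "integrable lborel (gaussian :: 'a::euclidean_space \<Rightarrow> complex)"
  unfolding gaussian_prod[abs_def] by (rule integrable_lborel_prod) (rule gaussian_real_fourier)

lemma fourier_gaussian:
  fixes \<xi> :: "'a::euclidean_space"
  shows "fourier gaussian \<xi> = of_real (sqrt (2 * pi) ^ DIM('a)) * gaussian \<xi>"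
proof -
  have "cis (- (x \<bullet> \<xi>)) * gaussian x = (\<Prod>b\<in>Basis. cis (- (x \<bullet> b * (\<xi> \<bullet> b))) * of_real (exp (- (x \<bullet> b)\<^sup>2 / 2)))" for x
  proof -
    have "cis (- (x \<bullet> \<xi>)) = (\<Prod>b\<in>Basis. cis (- (x \<bullet> b * (\<xi> \<bullet> b))))"
      by (subst euclidean_inner) (simp add: cis_conv_exp sum_negf[symmetric] sum_distrib_left exp_sum)
    then show ?thesis by (simp only: gaussian_prod prod.distrib)
  qed
  then have "fourier gaussian \<xi> =
      (LINT x|lborel. (\<Prod>b\<in>Basis. cis (- (x \<bullet> b * (\<xi> \<bullet> b))) * of_real (exp (- (x \<bullet> b)\<^sup>2 / 2))))"
    unfolding fourier_def by simp
  also have "\<dots> = (\<Prod>b\<in>Basis. (LINT t|lborel. cis (- (t * (\<xi> \<bullet> b))) * of_real (exp (- t\<^sup>2 / 2))))"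
    by (rule integral_lborel_prod) (intro fourier_integrable gaussian_real_fourier; simp)
  also have "\<dots> = of_real (sqrt (2 * pi) ^ DIM('a)) * gaussian \<xi>"
    unfolding gaussian_real_fourier(2) gaussian_prod by (simp add: prod.distrib)
  finally show ?thesis .
qed

lemma integral_gaussian: "(LINT x|lborel. gaussian (x::'a::euclidean_space)) = of_real (sqrt (2 * pi) ^ DIM('a))"
  using fourier_gaussian[of "0::'a"] by (simp add: fourier_def gaussian_def)

lemma gaussian_measurable [measurable]: "gaussian \<in> borel_measurable borel"
  unfolding gaussian_def[abs_def] by measurable

lemma gaussian_bounds: "norm (gaussian x) \<le> 1"
  by (simp add: gaussian_def)

lemma gaussian_continuous: "continuous_on A gaussian"
  unfolding gaussian_def[abs_def] by (intro continuous_intros) auto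

lemma schwartz_bounded:
  assumes "f \<in> schwartz" shows "\<exists>C\<ge>0. \<forall>x. norm (f x) \<le> C"
  using schwartz_bound[OF assms, of 0] by simp

text \<open>Inversion with a Gaussian regularisation: the multiplication formula moves the transform
  from \<open>f\<close> to a modulated wide Gaussian, whose transform is a Gaussian of width
  \<open>e\<close> centred at \<open>y\<close>. After rescaling, \<open>f\<close> is averaged near
  \<open>y\<close>.\<close>

lemma fourier_inversion_aux:
  fixes f :: "'a::euclidean_space \<Rightarrow> complex"
  assumes f: "f \<in> schwartz" and e: "e > 0"
  shows "(LINT \<xi>|lborel. fourier f \<xi> * (cis (\<xi> \<bullet> y) * gaussian (e *\<^sub>R \<xi>))) =
     of_real (sqrt (2 * pi) ^ DIM('a)) * (LINT z|lborel. f (y + e *\<^sub>R z) * gaussian z)"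
proof -
  let ?c = "complex_of_real (sqrt (2 * pi) ^ DIM('a))"
  let ?g = "\<lambda>\<xi>. cis (\<xi> \<bullet> y) * gaussian (e *\<^sub>R \<xi>)"
  note [measurable] = schwartz_measurable[OF f]
  have gi: "integrable lborel (\<lambda>x::'a. gaussian (e *\<^sub>R x))"
    using integrable_affine[OF _ _ gaussian_integrable, of e 0] e by simp
  have F: "fourier ?g x = (1 / e ^ DIM('a)) *\<^sub>R (?c * gaussian ((1 / e) *\<^sub>R (x - y)))" for x
  proof -
    have "fourier ?g x = (LINT \<xi>|lborel. cis (- ((0 + e *\<^sub>R \<xi>) \<bullet> ((1 / e) *\<^sub>R (x - y)))) * gaussian (0 + e *\<^sub>R \<xi>))"
      unfolding fourier_def using e
      by (intro Bochner_Integration.integral_cong refl) (simp add: cis_mult inner_diff_right diff_divide_distrib flip: mult.assoc)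
    also have "\<dots> = (1 / e ^ DIM('a)) *\<^sub>R fourier gaussian ((1 / e) *\<^sub>R (x - y))"
      unfolding fourier_def using e by (subst integral_affine) auto
    finally show ?thesis unfolding fourier_gaussian .
  qed
  have "(LINT \<xi>|lborel. fourier f \<xi> * ?g \<xi>) = (LINT x|lborel. f x * fourier ?g x)"
    by (intro fourier_multiplication schwartz_integrable f fourier_integrable gi) simp
  also have "\<dots> = (1 / e ^ DIM('a)) *\<^sub>R (LINT x|lborel. ?c * (f x * gaussian ((1 / e) *\<^sub>R (x - y))))"
    unfolding F by (subst integral_scaleR_right[symmetric]) (simp add: mult_ac scaleR_conv_of_real)
  also have "\<dots> = (LINT z|lborel. ?c * (f (y + e *\<^sub>R z) * gaussian ((1 / e) *\<^sub>R (y + e *\<^sub>R z - y))))"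
    using e by (subst integral_affine[where t=y and c=e and f="\<lambda>x. ?c * (f x * gaussian ((1 / e) *\<^sub>R (x - y)))"]) auto
  also have "\<dots> = ?c * (LINT z|lborel. f (y + e *\<^sub>R z) * gaussian z)"
    using e by simp
  finally show ?thesis .
qed

text \<open>Let the width in \<open>fourier_inversion_aux\<close> tend to 0, by dominated
  convergence on both sides. The factor \<open>?c\<close> occurs twice, once from the transform and
  once as the mass of the Gaussian, and its square is the normalisation of
  \<open>inv_fourier\<close>.\<close>

lemma inv_fourier_fourier:
  fixes f :: "'a::euclidean_space \<Rightarrow> complex"
  assumes f: "f \<in> schwartz"
  shows "inv_fourier (fourier f) = f"
proof
  fix y
  let ?c = "complex_of_real (sqrt (2 * pi) ^ DIM('a))"
  let ?e = "\<lambda>n. inverse (real (Suc n))"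
  note [measurable] = schwartz_measurable[OF f] schwartz_measurable[OF fourier_schwartz[OF f]]
  obtain C where C: "\<And>x. norm (f x) \<le> C" using schwartz_bounded[OF f] by blast
  have gc: "isCont gaussian (0 :: 'a)"
    using gaussian_continuous[of "UNIV :: 'a set"] by (simp add: continuous_on_eq_continuous_at)
  have e0: "(\<lambda>n. ?e n *\<^sub>R z) \<longlonglongrightarrow> 0" for z :: 'a
    using tendsto_scaleR[OF LIMSEQ_inverse_real_of_nat tendsto_const, of z] by simp
  have l1: "(\<lambda>n. LINT \<xi>|lborel. fourier f \<xi> * (cis (\<xi> \<bullet> y) * gaussian (?e n *\<^sub>R \<xi>)))
      \<longlonglongrightarrow> (LINT \<xi>|lborel. fourier f \<xi> * (cis (\<xi> \<bullet> y) * gaussian (0 :: 'a)))"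
  proof (rule integral_dominated_convergence)
    show "integrable lborel (\<lambda>\<xi>. norm (fourier f \<xi>))"
      by (intro integrable_norm schwartz_integrable fourier_schwartz f)
    show "AE \<xi> in lborel. (\<lambda>n. fourier f \<xi> * (cis (\<xi> \<bullet> y) * gaussian (?e n *\<^sub>R \<xi>))) \<longlonglongrightarrow>
        fourier f \<xi> * (cis (\<xi> \<bullet> y) * gaussian (0 :: 'a))"
    proof (rule AE_I2)
      fix \<xi> :: 'a
      have "(\<lambda>n. gaussian (?e n *\<^sub>R \<xi>)) \<longlonglongrightarrow> gaussian (0 :: 'a)"
        by (rule isCont_tendsto_compose[OF gc e0])
      then show "(\<lambda>n. fourier f \<xi> * (cis (\<xi> \<bullet> y) * gaussian (?e n *\<^sub>R \<xi>))) \<longlonglongrightarrow>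
        fourier f \<xi> * (cis (\<xi> \<bullet> y) * gaussian (0 :: 'a))"
        by (intro tendsto_mult tendsto_const)
    qed
    show "AE \<xi> in lborel. norm (fourier f \<xi> * (cis (\<xi> \<bullet> y) * gaussian (?e n *\<^sub>R \<xi>))) \<le> norm (fourier f \<xi>)" for n
      by (intro AE_I2) (simp add: norm_mult mult_left_le gaussian_bounds)
  qed simp_all
  have l2: "(\<lambda>n. ?c * (LINT z|lborel. f (y + ?e n *\<^sub>R z) * gaussian z)) \<longlonglongrightarrow> ?c * (LINT z|lborel. f (y + 0) * gaussian (z :: 'a))"
  proof (rule tendsto_mult[OF tendsto_const integral_dominated_convergence])
    show "integrable lborel (\<lambda>z::'a. C * norm (gaussian z))"
      by (intro integrable_mult_right integrable_norm gaussian_integrable)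
    show "AE z in lborel. (\<lambda>n. f (y + ?e n *\<^sub>R z) * gaussian z) \<longlonglongrightarrow> f (y + 0) * gaussian z"
      using schwartz_continuous[OF f, of UNIV]
      by (intro AE_I2 tendsto_mult tendsto_const isCont_tendsto_compose[OF _ tendsto_add[OF tendsto_const e0]])
        (simp add: continuous_on_eq_continuous_at)
    show "AE z in lborel. norm (f (y + ?e n *\<^sub>R z) * gaussian z) \<le> C * norm (gaussian z)" for n
      using C by (intro AE_I2) (simp add: norm_mult mult_right_mono)
  qed simp_all
  have eq: "(LINT \<xi>|lborel. fourier f \<xi> * (cis (\<xi> \<bullet> y) * gaussian (?e n *\<^sub>R \<xi>))) =
      ?c * (LINT z|lborel. f (y + ?e n *\<^sub>R z) * gaussian z)" for n
    by (rule fourier_inversion_aux[OF f]) simp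
  have "(LINT \<xi>|lborel. fourier f \<xi> * (cis (\<xi> \<bullet> y) * gaussian (0 :: 'a))) = ?c * (LINT z|lborel. f (y + 0) * gaussian (z :: 'a))"
    by (rule LIMSEQ_unique[OF l1[unfolded eq] l2])
  also have "\<dots> = of_real ((2 * pi) ^ DIM('a)) * f y"
  proof -
    have "sqrt (2 * pi) ^ DIM('a) * sqrt (2 * pi) ^ DIM('a) = (2 * pi) ^ DIM('a)"
      by (simp only: power_mult_distrib[symmetric] real_sqrt_mult_self) simp
    then have c: "?c * ?c = of_real ((2 * pi) ^ DIM('a))" by (simp only: of_real_mult[symmetric])
    have "?c * (LINT z|lborel. f (y + 0) * gaussian (z :: 'a)) = f y * (?c * ?c)"
      unfolding integral_mult_right_zero integral_gaussian add_0_right by (simp only: mult_ac)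
    then show ?thesis unfolding c by (simp only: mult.commute)
  qed
  finally show "inv_fourier (fourier f) y = f y"
    unfolding inv_fourier_def by (simp add: gaussian_def mult.commute inner_commute)
qed

text \<open>The reflection of the integration variable exchanges the two orders of composition; it
  is written as an affine map in order to use \<open>integral_affine\<close>.\<close>

lemma fourier_inv_fourier:
  fixes f :: "'a::euclidean_space \<Rightarrow> complex"
  assumes f: "f \<in> schwartz"
  shows "fourier (inv_fourier f) = f"
proof
  fix x
  note [measurable] = schwartz_measurable[OF fourier_schwartz[OF f]]
  have "fourier (inv_fourier f) x = (LINT \<xi>|lborel. cis ((0 + (- 1) *\<^sub>R \<xi>) \<bullet> x) * fourier f (0 + (- 1) *\<^sub>R \<xi>)) / of_real ((2 * pi) ^ DIM('a))"
    unfolding fourier_def[of "inv_fourier f"] inv_fourier_eq by simp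
  also have "\<dots> = inv_fourier (fourier f) x"
    unfolding inv_fourier_def by (subst integral_affine) (auto simp: inner_commute)
  finally show "fourier (inv_fourier f) x = f x" by (simp add: inv_fourier_fourier[OF f])
qed

lemma integral_fourier:
  fixes f :: "'a::euclidean_space \<Rightarrow> complex"
  assumes "f \<in> schwartz"
  shows "(LINT x|lborel. fourier f x) = of_real ((2 * pi) ^ DIM('a)) * f 0"
  using fun_cong[OF inv_fourier_fourier[OF assms], of 0] by (simp add: inv_fourier_def field_simps)

lemma inv_fourier_multiplication:
  assumes f: "f \<in> schwartz" and g: "g \<in> schwartz"
  shows "(LINT x|lborel. f x * inv_fourier g x) = (LINT x|lborel. inv_fourier f x * g x)"
  using fourier_multiplication[of "inv_fourier f" "inv_fourier g"] f g
  by (simp add: fourier_inv_fourier schwartz_integrable inv_fourier_schwartz)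

lemma inv_fourier_dilate:
  fixes f :: "'a::euclidean_space \<Rightarrow> complex"
  assumes f: "f \<in> schwartz" and c: "c > 0"
  shows "inv_fourier (\<lambda>\<xi>. f (c *\<^sub>R \<xi>)) x = (1 / c ^ DIM('a)) *\<^sub>R inv_fourier f ((1 / c) *\<^sub>R x)"
proof -
  note [measurable] = schwartz_measurable[OF f]
  have "(LINT \<xi>|lborel. cis (x \<bullet> \<xi>) * f (c *\<^sub>R \<xi>)) =
     (LINT \<xi>|lborel. cis (((1 / c) *\<^sub>R x) \<bullet> (0 + c *\<^sub>R \<xi>)) * f (0 + c *\<^sub>R \<xi>))"
    using c by simp
  also have "\<dots> = (1 / c ^ DIM('a)) *\<^sub>R (LINT \<xi>|lborel. cis (((1 / c) *\<^sub>R x) \<bullet> \<xi>) * f \<xi>)"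
    using c by (subst integral_affine) auto
  finally show ?thesis unfolding inv_fourier_def by (simp add: scaleR_conv_of_real)
qed

section \<open>Tempered distributions modulo polynomials\<close>

lemma tempered_linear:
  "u \<in> tempered \<Longrightarrow> f \<in> schwartz \<Longrightarrow> g \<in> schwartz \<Longrightarrow>
    u (\<lambda>x. a * f x + b * g x) = a * u f + b * u g"
  by (simp add: tempered_def)

lemma tempered_bound:
  assumes "u \<in> tempered"
  shows "\<exists>C\<ge>0. \<exists>k. \<forall>f\<in>schwartz. norm (u f) \<le> C * schwartz_seminorm k f"
proof -
  obtain C k where C: "\<And>f. f \<in> schwartz \<Longrightarrow> norm (u f) \<le> C * schwartz_seminorm k f"
    using assms unfolding tempered_def by blast
  have "norm (u f) \<le> \<bar>C\<bar> * schwartz_seminorm k f" if "f \<in> schwartz" for f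
    using C[OF that] mult_right_mono[OF abs_ge_self seminorm_nonneg[OF that]] order_trans by blast
  then show ?thesis using abs_ge_zero by blast
qed

lemma temperedI:
  assumes "\<And>f. f \<notin> schwartz \<Longrightarrow> u f = 0"
    and "\<And>f g a b. f \<in> schwartz \<Longrightarrow> g \<in> schwartz \<Longrightarrow> u (\<lambda>x. a * f x + b * g x) = a * u f + b * u g"
    and "\<And>f. f \<in> schwartz \<Longrightarrow> norm (u f) \<le> C * schwartz_seminorm k f"
  shows "u \<in> tempered"
  using assms unfolding tempered_def by blast

lemma tempered_diff_tempered:
  assumes "u \<in> tempered" "v \<in> tempered" shows "tempered_diff u v \<in> tempered"
proof -
  obtain C k where C: "0 \<le> C" "\<And>f. f \<in> schwartz \<Longrightarrow> norm (u f) \<le> C * schwartz_seminorm k f"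
    using tempered_bound[OF assms(1)] by blast
  obtain D j where D: "0 \<le> D" "\<And>f. f \<in> schwartz \<Longrightarrow> norm (v f) \<le> D * schwartz_seminorm j f"
    using tempered_bound[OF assms(2)] by blast
  show ?thesis
  proof (rule temperedI[where C = "C + D" and k = "k + j"])
    show "tempered_diff u v f = 0" if "f \<notin> schwartz" for f
      using that assms by (simp add: tempered_diff_def tempered_def)
    show "tempered_diff u v (\<lambda>x. a * f x + b * g x) = a * tempered_diff u v f + b * tempered_diff u v g"
      if "f \<in> schwartz" "g \<in> schwartz" for f g a b
      using that assms by (simp add: tempered_diff_def tempered_linear algebra_simps)
    fix f :: "'a \<Rightarrow> complex" assume f: "f \<in> schwartz"
    have "norm (tempered_diff u v f) \<le> C * schwartz_seminorm k f + D * schwartz_seminorm j f"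
      unfolding tempered_diff_def using norm_triangle_ineq4[of "u f" "v f"] C(2)[OF f] D(2)[OF f] by simp
    also have "\<dots> \<le> C * schwartz_seminorm (k + j) f + D * schwartz_seminorm (k + j) f"
      by (intro add_mono mult_left_mono seminorm_mono f C D) auto
    finally show "norm (tempered_diff u v f) \<le> (C + D) * schwartz_seminorm (k + j) f"
      by (simp add: algebra_simps)
  qed
qed

text \<open>Transposition of a continuous operator: the seminorm bounds of \<open>u\<close> and
  \<open>L\<close> compose. The value 0 off the Schwartz space is the normalisation built into
  \<open>tempered\<close>.\<close>

lemma tempered_comp:
  assumes u: "u \<in> tempered" and L: "schwartz_cont L"
    and lin: "\<And>f g a b. f \<in> schwartz \<Longrightarrow> g \<in> schwartz \<Longrightarrow>
      L (\<lambda>x. a * f x + b * g x) = (\<lambda>x. a * L f x + b * L g x)"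
  shows "(\<lambda>f. if f \<in> schwartz then u (L f) else 0) \<in> tempered"
proof -
  obtain C k where C: "0 \<le> C" "\<And>f. f \<in> schwartz \<Longrightarrow> norm (u f) \<le> C * schwartz_seminorm k f"
    using tempered_bound[OF u] by blast
  obtain D j where D: "0 \<le> D" "\<And>f. f \<in> schwartz \<Longrightarrow> schwartz_seminorm k (L f) \<le> D * schwartz_seminorm j f"
    using schwartz_cont_seminorm[OF L] by blast
  show ?thesis
  proof (rule temperedI[where C = "C * D" and k = j])
    fix f :: "'a \<Rightarrow> complex" assume f: "f \<in> schwartz"
    have "norm (u (L f)) \<le> C * (D * schwartz_seminorm j f)"
      using C(2)[OF schwartz_contD[OF L f]] mult_left_mono[OF D(2)[OF f] C(1)] by linarith
    then show "norm (if f \<in> schwartz then u (L f) else 0) \<le> C * D * schwartz_seminorm j f"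
      using f by (simp add: mult.assoc)
  qed (use u L in \<open>auto simp: lin schwartz_lincomb tempered_linear schwartz_contD\<close>)
qed

subsection \<open>Fourier multipliers and their action on polynomials\<close>

lemma fourier_schwartz_lincomb:
  "f \<in> schwartz \<Longrightarrow> g \<in> schwartz \<Longrightarrow>
    fourier (\<lambda>x. a * f x + b * g x) = (\<lambda>\<xi>. a * fourier f \<xi> + b * fourier g \<xi>)"
  by (intro fourier_lincomb schwartz_integrable)

lemma inv_fourier_schwartz_lincomb:
  "f \<in> schwartz \<Longrightarrow> g \<in> schwartz \<Longrightarrow>
    inv_fourier (\<lambda>x. a * f x + b * g x) = (\<lambda>\<xi>. a * inv_fourier f \<xi> + b * inv_fourier g \<xi>)"
  by (simp add: fun_eq_iff inv_fourier_eq fourier_schwartz_lincomb add_divide_distrib)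

text \<open>Unlike \<open>fourier_dist\<close>, this is not truncated off the Schwartz space.\<close>

definition hat :: "'a::euclidean_space functional \<Rightarrow> ('a \<Rightarrow> complex) \<Rightarrow> complex" where
  "hat u f = u (fourier f)"

lemma hat_linear:
  "u \<in> tempered \<Longrightarrow> f \<in> schwartz \<Longrightarrow> g \<in> schwartz \<Longrightarrow>
    hat u (\<lambda>x. a * f x + b * g x) = a * hat u f + b * hat u g"
  by (simp add: hat_def fourier_schwartz_lincomb tempered_linear fourier_schwartz)

lemma hat_minus:
  "u \<in> tempered \<Longrightarrow> f \<in> schwartz \<Longrightarrow> g \<in> schwartz \<Longrightarrow> hat u (\<lambda>x. f x - g x) = hat u f - hat u g"
  using hat_linear[of u f g 1 "-1"] by simp

lemma hat_diff: "hat (tempered_diff u v) f = hat u f - hat v f"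
  by (simp add: hat_def tempered_diff_def)

lemma hat_zero: "u \<in> tempered \<Longrightarrow> hat u (\<lambda>x. 0) = 0"
  using hat_linear[OF _ schwartz_zero schwartz_zero, of u 0 0] by simp

text \<open>The three transposes act on the test function in reverse order, and for \<open>s\<close>
  in \<open>slow\<close> each intermediate function is Schwartz, so none of the truncations to 0
  takes effect.\<close>

lemma fourier_multiplier_eq:
  assumes "s \<in> slow" "f \<in> schwartz"
  shows "fourier_multiplier s u f = hat u (\<lambda>\<xi>. s \<xi> * inv_fourier f \<xi>)"
  using assms by (simp add: fourier_multiplier_def inv_fourier_dist_def mult_dist_def fourier_dist_def
      hat_def inv_fourier_schwartz schwartz_slow_mult)

lemma fourier_multiplier_tempered:
  assumes s: "s \<in> slow" and u: "u \<in> tempered"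
  shows "fourier_multiplier s u \<in> tempered"
proof -
  have "(\<lambda>f. if f \<in> schwartz then u (fourier (\<lambda>\<xi>. s \<xi> * inv_fourier f \<xi>)) else 0) \<in> tempered"
  proof (rule tempered_comp[OF u])
    show "schwartz_cont (\<lambda>f. fourier (\<lambda>\<xi>. s \<xi> * inv_fourier f \<xi>))"
      by (rule schwartz_cont_comp[OF schwartz_cont_fourier
            schwartz_cont_comp[OF schwartz_cont_mult[OF s] schwartz_cont_inv_fourier]])
    fix f g :: "'a \<Rightarrow> complex" and a b assume fg: "f \<in> schwartz" "g \<in> schwartz"
    have "(\<lambda>\<xi>. s \<xi> * inv_fourier (\<lambda>x. a * f x + b * g x) \<xi>) =
      (\<lambda>\<xi>. a * (s \<xi> * inv_fourier f \<xi>) + b * (s \<xi> * inv_fourier g \<xi>))"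
      using fg by (simp add: inv_fourier_schwartz_lincomb algebra_simps)
    then show "fourier (\<lambda>\<xi>. s \<xi> * inv_fourier (\<lambda>x. a * f x + b * g x) \<xi>) =
      (\<lambda>x. a * fourier (\<lambda>\<xi>. s \<xi> * inv_fourier f \<xi>) x + b * fourier (\<lambda>\<xi>. s \<xi> * inv_fourier g \<xi>) x)"
      using fg s by (simp add: fourier_schwartz_lincomb schwartz_slow_mult inv_fourier_schwartz)
  qed
  moreover have "(\<lambda>f. if f \<in> schwartz then u (fourier (\<lambda>\<xi>. s \<xi> * inv_fourier f \<xi>)) else 0) = fourier_multiplier s u"
    using fourier_multiplier_eq[OF s] by (auto simp: fun_eq_iff hat_def fourier_multiplier_def inv_fourier_dist_def)
  ultimately show ?thesis by simp
qed

lemma hat_fourier_multiplier: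
  assumes "s \<in> slow" "f \<in> schwartz"
  shows "hat (fourier_multiplier s u) f = hat u (\<lambda>\<xi>. s \<xi> * f \<xi>)"
  using assms by (simp add: hat_def[of "fourier_multiplier s u"] fourier_multiplier_eq fourier_schwartz inv_fourier_fourier)

lemma fourier_multiplier_diff:
  "fourier_multiplier s (tempered_diff u v) f = fourier_multiplier s u f - fourier_multiplier s v f"
  by (simp add: fourier_multiplier_def inv_fourier_dist_def mult_dist_def fourier_dist_def tempered_diff_def)

definition schwartz0 :: "('a::euclidean_space \<Rightarrow> complex) set" where
  "schwartz0 = {f \<in> schwartz. \<exists>e>0. \<forall>x\<in>ball 0 e. f x = 0}"

lemma schwartz0_schwartz: "f \<in> schwartz0 \<Longrightarrow> f \<in> schwartz"
  by (simp add: schwartz0_def)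

lemma schwartz0_at_0: "f \<in> schwartz0 \<Longrightarrow> f 0 = 0"
  by (auto simp: schwartz0_def)

lemma schwartz0_lincomb:
  assumes "f \<in> schwartz0" "g \<in> schwartz0" shows "(\<lambda>x. a * f x + b * g x) \<in> schwartz0"
proof -
  obtain d e where "d > 0" "\<forall>x\<in>ball 0 d. f x = 0" "e > 0" "\<forall>x\<in>ball 0 e. g x = 0"
    using assms unfolding schwartz0_def by blast
  then show ?thesis
    using assms by (auto simp: schwartz0_def schwartz_lincomb intro!: exI[of _ "min d e"])
qed

lemma schwartz0_pd:
  assumes "f \<in> schwartz0" "b \<in> Basis" shows "pd b f \<in> schwartz0"
proof -
  obtain e where e: "e > 0" "\<forall>x\<in>ball 0 e. f x = 0"
    using assms unfolding schwartz0_def by blast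
  have "pd b f x = 0" if "x \<in> ball 0 e" for x
    using iter_deriv_zero_on_open[of "ball 0 e" f x "[b]"] e that by (simp add: pd_def)
  with e assms show ?thesis by (auto simp: schwartz0_def schwartz_pd)
qed

lemma schwartz0_sum:
  fixes g :: "'b \<Rightarrow> 'a::euclidean_space \<Rightarrow> complex"
  assumes "finite B" "\<And>b. b \<in> B \<Longrightarrow> \<exists>h\<in>schwartz0. g b = fourier h"
  shows "\<exists>h\<in>schwartz0. (\<lambda>x. \<Sum>b\<in>B. g b x) = fourier h"
  using assms
proof (induction B)
  case empty
  have "(\<lambda>x::'a. 0::complex) \<in> schwartz0" by (auto simp: schwartz0_def schwartz_zero intro!: exI[of _ "1::real"])
  moreover have "fourier (\<lambda>x::'a. 0) = (\<lambda>x. 0)" by (simp add: fourier_def fun_eq_iff)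
  ultimately show ?case by (intro bexI[of _ "\<lambda>x. 0"]) simp_all
next
  case (insert b B)
  then obtain h k where hk: "h \<in> schwartz0" "k \<in> schwartz0" "(\<lambda>x. \<Sum>b\<in>B. g b x) = fourier h" "g b = fourier k"
    by (metis insertI1 insertI2)
  have "(\<lambda>x. \<Sum>b\<in>insert b B. g b x) = fourier (\<lambda>x. 1 * k x + 1 * h x)"
    using insert(1,2) hk fun_cong[OF hk(3)] by (simp only: fourier_schwartz_lincomb schwartz0_schwartz) (simp add: fun_eq_iff)
  with schwartz0_lincomb[OF hk(2,1), of 1 1] show ?case by blast
qed

text \<open>A coordinate times a Fourier transform is a constant times the transform of a
  derivative, and differentiation preserves vanishing near the origin. In the product case the
  hypothesis is used twice, for different functions, so \<open>f\<close> is generalised.\<close>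

lemma real_polynomial_fourier:
  assumes "real_polynomial_function p" "f \<in> schwartz0"
  shows "\<exists>h\<in>schwartz0. (\<lambda>x. of_real (p x) * fourier f x) = fourier h"
  using assms
proof (induction arbitrary: f)
  case (linear p)
  have "\<exists>h\<in>schwartz0. (\<lambda>x. \<Sum>b\<in>Basis. of_real ((x \<bullet> b) * p b) * fourier f x) = fourier h"
  proof (rule schwartz0_sum)
    fix b :: 'a assume b: "b \<in> Basis"
    have f: "f \<in> schwartz" "pd b f \<in> schwartz0" using linear b by (auto simp: schwartz0_schwartz schwartz0_pd)
    have "(\<lambda>x. of_real ((x \<bullet> b) * p b) * fourier f x) = fourier (\<lambda>x. (- \<i> * of_real (p b)) * pd b f x + 0 * pd b f x)"
      using f b by (simp only: fourier_schwartz_lincomb schwartz0_schwartz fourier_pd) (simp add: fun_eq_iff mult_ac)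
    then show "\<exists>h\<in>schwartz0. (\<lambda>x. of_real ((x \<bullet> b) * p b) * fourier f x) = fourier h"
      using schwartz0_lincomb[OF f(2) f(2)] by blast
  qed simp
  moreover have "(\<Sum>b\<in>Basis. of_real ((x \<bullet> b) * p b) * fourier f x) = of_real (p x) * fourier f x" for x
  proof -
    have "p x = p (\<Sum>b\<in>Basis. (x \<bullet> b) *\<^sub>R b)" by (simp add: euclidean_representation)
    also have "\<dots> = (\<Sum>b\<in>Basis. (x \<bullet> b) * p b)"
      using linear(1) by (simp add: bounded_linear.linear linear_sum linear_scale)
    finally show ?thesis by (simp add: sum_distrib_right)
  qed
  ultimately show ?case by simp
next
  case (const c)
  have "(\<lambda>x. of_real c * fourier f x) = fourier (\<lambda>x. of_real c * f x + 0 * f x)"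
    using const by (simp only: fourier_schwartz_lincomb schwartz0_schwartz) simp
  then show ?case using schwartz0_lincomb[OF const const] by blast
next
  case (add p q)
  then obtain h k where hk: "h \<in> schwartz0" "k \<in> schwartz0" "(\<lambda>x. of_real (p x) * fourier f x) = fourier h"
    "(\<lambda>x. of_real (q x) * fourier f x) = fourier k" by meson
  have "(\<lambda>x. of_real (p x + q x) * fourier f x) = fourier (\<lambda>x. 1 * h x + 1 * k x)"
    using hk by (simp only: fourier_schwartz_lincomb schwartz0_schwartz hk(3,4)[symmetric]) (simp add: algebra_simps)
  then show ?case using schwartz0_lincomb[OF hk(1,2)] by blast
next
  case (mult p q)
  then obtain h where h: "h \<in> schwartz0" "(\<lambda>x. of_real (q x) * fourier f x) = fourier h" by meson
  obtain k where k: "k \<in> schwartz0" "(\<lambda>x. of_real (p x) * fourier h x) = fourier k" using mult h(1) by meson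
  have "(\<lambda>x. of_real (p x * q x) * fourier f x) = fourier k"
    using fun_cong[OF h(2)] unfolding k(2)[symmetric] by (simp add: mult.assoc)
  with k(1) show ?case by blast
qed

text \<open>By \<open>real_polynomial_fourier\<close> the pairing is a combination of integrals of
  transforms of functions in \<open>schwartz0\<close>, and by inversion such an integral is a
  multiple of the value at 0. Real and imaginary parts of the polynomial are treated apart.\<close>

lemma hat_poly_dist:
  fixes f :: "'a::euclidean_space \<Rightarrow> complex"
  assumes q: "q \<in> poly_dist" and f: "f \<in> schwartz0"
  shows "hat q f = 0"
proof -
  obtain P where P: "polynomial_function P" "represents P q"
    using q unfolding poly_dist_def by blast
  have re: "real_polynomial_function (Re \<circ> P)" and im: "real_polynomial_function (Im \<circ> P)"
    using P(1) bounded_linear_Re bounded_linear_Im unfolding polynomial_function_def by blast+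
  obtain h where h: "h \<in> schwartz0" "(\<lambda>x. of_real ((Re \<circ> P) x) * fourier f x) = fourier h"
    using real_polynomial_fourier[OF re f] by blast
  obtain k where k: "k \<in> schwartz0" "(\<lambda>x. of_real ((Im \<circ> P) x) * fourier f x) = fourier k"
    using real_polynomial_fourier[OF im f] by blast
  have S: "h \<in> schwartz" "k \<in> schwartz" using h k by (auto simp: schwartz0_schwartz)
  have "P x * fourier f x = fourier h x + \<i> * fourier k x" for x
    unfolding h(2)[symmetric] k(2)[symmetric] by (subst complex_eq[of "P x"]) (simp add: algebra_simps)
  then have "(LINT x|lborel. P x * fourier f x) = (LINT x|lborel. fourier h x + \<i> * fourier k x)"
    by simp
  also have "\<dots> = (LINT x|lborel. fourier h x) + \<i> * (LINT x|lborel. fourier k x)"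
    using S by (simp add: schwartz_integrable fourier_schwartz)
  also have "\<dots> = 0"
    unfolding integral_fourier[OF S(1)] integral_fourier[OF S(2)] using h k by (simp add: schwartz0_at_0)
  finally show ?thesis
    using P(2) schwartz0_schwartz[OF f] unfolding represents_def hat_def by (simp add: fourier_schwartz)
qed

subsection \<open>Classes modulo polynomials\<close>

lemma represents_diff:
  assumes "represents g u" "represents h v"
  shows "represents (\<lambda>x. g x - h x) (tempered_diff u v)"
  using assms unfolding represents_def tempered_diff_def by (auto simp: algebra_simps)

lemma poly_dist_diff:
  assumes "u \<in> poly_dist" "v \<in> poly_dist" shows "tempered_diff u v \<in> poly_dist"
  using assms unfolding poly_dist_def
  by (auto intro: tempered_diff_tempered polynomial_function_diff represents_diff)

lemma zero_poly_dist: "(\<lambda>f. 0) \<in> poly_dist"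
proof -
  have "(\<lambda>f. 0) \<in> tempered" by (rule temperedI[where C = 0 and k = 0]) auto
  moreover have "represents (\<lambda>x. 0) (\<lambda>f. 0)" by (simp add: represents_def)
  ultimately show ?thesis unfolding poly_dist_def using polynomial_function_const by blast
qed

definition poly_class :: "'a::euclidean_space functional \<Rightarrow> 'a functional set" where
  "poly_class u = {v \<in> tempered. tempered_diff u v \<in> poly_dist}"

lemma poly_class_mod_poly: "u \<in> tempered \<Longrightarrow> poly_class u \<in> tempered_mod_poly"
  unfolding poly_class_def tempered_mod_poly_def quotient_def by auto

lemma poly_class_self: "u \<in> tempered \<Longrightarrow> u \<in> poly_class u"
  using zero_poly_dist by (simp add: poly_class_def tempered_diff_def)

lemma mod_poly_diff:
  assumes "X \<in> tempered_mod_poly" "u \<in> X" "v \<in> X"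
  shows "tempered_diff u v \<in> poly_dist"
proof -
  obtain w where "w \<in> tempered" "X = poly_class w"
    using assms(1) unfolding tempered_mod_poly_def quotient_def poly_class_def by auto
  with assms have "tempered_diff w v \<in> poly_dist" "tempered_diff w u \<in> poly_dist" by (auto simp: poly_class_def)
  from poly_dist_diff[OF this] show ?thesis by (simp add: tempered_diff_def)
qed

lemma mod_poly_tempered: "X \<in> tempered_mod_poly \<Longrightarrow> u \<in> X \<Longrightarrow> u \<in> tempered"
  unfolding tempered_mod_poly_def quotient_def by auto

lemma mod_poly_nonempty: "X \<in> tempered_mod_poly \<Longrightarrow> \<exists>u. u \<in> X"
  unfolding tempered_mod_poly_def quotient_def using poly_class_self by (auto simp: poly_class_def)

section \<open>Dyadic blocks\<close>

locale littlewood_paley =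
  fixes chi :: "'a::euclidean_space \<Rightarrow> real"
  assumes cutoff: "cutoff chi"
begin

abbreviation low :: "real \<Rightarrow> 'a \<Rightarrow> complex" where
  "low t \<equiv> \<lambda>\<xi>. of_real (chi (t *\<^sub>R \<xi>))"

abbreviation ann :: "real \<Rightarrow> 'a \<Rightarrow> complex" where
  "ann t \<equiv> \<lambda>\<xi>. of_real (dyadic chi (t *\<^sub>R \<xi>))"

lemma chi_smooth: "smooth chi"
  using cutoff by (simp add: cutoff_def)

lemma chi_eq_0: "norm \<xi> > 2 \<Longrightarrow> chi \<xi> = 0"
proof (rule ccontr)
  assume "norm \<xi> > 2" "chi \<xi> \<noteq> 0"
  moreover have "closure {x. chi x \<noteq> 0} \<subseteq> cball 0 2"
    using cutoff unfolding cutoff_def by (elim conjE)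
  then have "{x. chi x \<noteq> 0} \<subseteq> cball 0 2" by (rule order_trans[OF closure_subset])
  ultimately show False by auto
qed

lemma chi_eq_1_nhd: "\<exists>U. open U \<and> cball 0 1 \<subseteq> U \<and> (\<forall>x\<in>U. chi x = 1)"
  using cutoff unfolding cutoff_def by (elim conjE)

lemma chi_eq_1: "norm \<xi> \<le> 1 \<Longrightarrow> chi \<xi> = 1"
  using chi_eq_1_nhd by force

lemma low_schwartz: "t \<noteq> 0 \<Longrightarrow> low t \<in> schwartz"
  by (rule schwartz_dilate) (auto intro: schwartz_of_compact_support[OF chi_smooth, of 2] chi_eq_0)

lemma low_eq_0: "t * norm \<xi> > 2 \<Longrightarrow> t > 0 \<Longrightarrow> low t \<xi> = 0"
  using chi_eq_0[of "t *\<^sub>R \<xi>"] by simp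

lemma low_eq_1: "t * norm \<xi> \<le> 1 \<Longrightarrow> t > 0 \<Longrightarrow> low t \<xi> = 1"
  using chi_eq_1[of "t *\<^sub>R \<xi>"] by simp

lemma ann_low: "ann t \<xi> = low t \<xi> - low (2 * t) \<xi>"
  by (simp add: dyadic_def mult.commute)

lemma ann_schwartz: "t \<noteq> 0 \<Longrightarrow> ann t \<in> schwartz"
  unfolding ann_low by (intro schwartz_diff low_schwartz) auto

lemma ann_eq_0: "t > 0 \<Longrightarrow> t * norm \<xi> > 2 \<or> t * norm \<xi> \<le> 1 / 2 \<Longrightarrow> ann t \<xi> = 0"
  unfolding ann_low using low_eq_0[of t \<xi>] low_eq_0[of "2 * t" \<xi>] low_eq_1[of t \<xi>] low_eq_1[of "2 * t" \<xi>] by auto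

lemma schwartz0_mult_ann:
  assumes "t > 0" "f \<in> schwartz" shows "(\<lambda>\<xi>. ann t \<xi> * f \<xi>) \<in> schwartz0"
proof -
  have "ann t \<xi> * f \<xi> = 0" if "\<xi> \<in> ball 0 (1 / (2 * t))" for \<xi>
    using that assms(1) by (subst ann_eq_0) (auto simp: field_simps)
  moreover have "1 / (2 * t) > 0" using assms(1) by simp
  moreover have "(\<lambda>\<xi>. ann t \<xi> * f \<xi>) \<in> schwartz"
    using assms by (intro schwartz_mult ann_schwartz) auto
  ultimately show ?thesis unfolding schwartz0_def by blast
qed

lemma block_eq: "f \<in> schwartz \<Longrightarrow> block chi m u f = hat u (\<lambda>\<xi>. ann (2 powi (- m)) \<xi> * inv_fourier f \<xi>)"
  unfolding block_def by (intro fourier_multiplier_eq schwartz_imp_slow ann_schwartz) simp_all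

lemma block_fourier: "f \<in> schwartz \<Longrightarrow> block chi m u (fourier f) = hat u (\<lambda>\<xi>. ann (2 powi (- m)) \<xi> * f \<xi>)"
  by (simp add: block_eq fourier_schwartz inv_fourier_fourier)

lemma block_diff: "block chi m (tempered_diff u v) = tempered_diff (block chi m u) (block chi m v)"
  by (simp add: fun_eq_iff block_def fourier_multiplier_diff tempered_diff_def[of "fourier_multiplier _ _"])

lemma block_off_schwartz: "f \<notin> schwartz \<Longrightarrow> block chi m u f = 0"
  by (simp add: block_def fourier_multiplier_def inv_fourier_dist_def)

lemma block_poly_dist: "q \<in> poly_dist \<Longrightarrow> block chi m q = (\<lambda>f. 0)"
proof
  fix f :: "'a \<Rightarrow> complex" assume q: "q \<in> poly_dist"
  show "block chi m q f = 0"
  proof (cases "f \<in> schwartz")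
    case True
    then show ?thesis
      using hat_poly_dist[OF q schwartz0_mult_ann[OF _ inv_fourier_schwartz]] by (simp add: block_eq)
  qed (rule block_off_schwartz)
qed

section \<open>Besov norms of classes and the space of vanishing low frequencies\<close>

lemma besov_norm_rep_cong:
  assumes "tempered_diff u v \<in> poly_dist"
  shows "besov_norm_rep chi s p r u = besov_norm_rep chi s p r v"
proof -
  have "block chi m u = block chi m v" for m
    using block_poly_dist[OF assms, of m] unfolding block_diff by (simp add: tempered_diff_def fun_eq_iff)
  then show ?thesis by (simp add: besov_norm_rep_def)
qed

lemma besov_norm_eq:
  assumes "X \<in> tempered_mod_poly" "u \<in> X"
  shows "besov_norm chi s p r X = besov_norm_rep chi s p r u"
proof -
  have "besov_norm_rep chi s p r v = besov_norm_rep chi s p r u" if "v \<in> X" for v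
    by (rule besov_norm_rep_cong[OF mod_poly_diff[OF assms(1) that assms(2)]])
  then have "besov_norm_rep chi s p r ` X = {besov_norm_rep chi s p r u}"
    using assms(2) by blast
  then show ?thesis by (simp add: besov_norm_def)
qed

text \<open>Any two differences of representatives differ by a polynomial, so the image of
  \<open>class_diff X Y\<close> under the norm is a singleton and \<open>the_elem\<close> returns
  its value.\<close>

lemma besov_norm_class_diff:
  assumes "X \<in> tempered_mod_poly" "Y \<in> tempered_mod_poly" "u \<in> X" "v \<in> Y"
  shows "besov_norm chi s p r (class_diff X Y) = besov_norm_rep chi s p r (tempered_diff u v)"
proof -
  have "besov_norm_rep chi s p r (tempered_diff u' v') = besov_norm_rep chi s p r (tempered_diff u v)"
    if "u' \<in> X" "v' \<in> Y" for u' v'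
  proof (rule besov_norm_rep_cong)
    have "tempered_diff (tempered_diff u' v') (tempered_diff u v) = tempered_diff (tempered_diff u' u) (tempered_diff v' v)"
      by (simp add: tempered_diff_def fun_eq_iff)
    then show "tempered_diff (tempered_diff u' v') (tempered_diff u v) \<in> poly_dist"
      using poly_dist_diff[OF mod_poly_diff[OF assms(1) that(1) assms(3)] mod_poly_diff[OF assms(2) that(2) assms(4)]]
      by (simp only:)
  qed
  then have "besov_norm_rep chi s p r ` class_diff X Y = {besov_norm_rep chi s p r (tempered_diff u v)}"
    using assms unfolding class_diff_def by blast
  then show ?thesis by (simp add: besov_norm_def)
qed

lemma poly_class_besov:
  assumes "u \<in> tempered" "besov_norm_rep chi s p r u < \<infinity>"
  shows "poly_class u \<in> besov chi s p r"
  using assms besov_norm_eq[OF poly_class_mod_poly poly_class_self] poly_class_mod_poly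
  by (simp add: besov_def)

lemma hat_eq_schwartz0:
  assumes "X \<in> tempered_mod_poly" "u \<in> X" "v \<in> X" "f \<in> schwartz0"
  shows "hat u f = hat v f"
  using hat_poly_dist[OF mod_poly_diff[OF assms(1-3)] assms(4)] by (simp add: hat_diff)

lemma tempered_h_hat:
  assumes "u \<in> tempered_h chi" "f \<in> schwartz"
  shows "((\<lambda>t. hat u (\<lambda>\<xi>. low t \<xi> * f \<xi>)) \<longlongrightarrow> 0) at_top"
proof -
  have "((\<lambda>t. mult_dist (low t) (fourier_dist u) f) \<longlongrightarrow> 0) at_top"
    using assms by (simp add: tempered_h_def)
  \<comment> \<open>\<open>low t\<close> is known to be Schwartz only for non-zero \<open>t\<close>;
    the limit at infinity sees positive \<open>t\<close> only, where the truncations in the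
    definitions disappear.\<close>
  moreover have "\<forall>\<^sub>F t in at_top. mult_dist (low t) (fourier_dist u) f = hat u (\<lambda>\<xi>. low t \<xi> * f \<xi>)"
    using eventually_gt_at_top[of "0::real"]
  proof eventually_elim
    case (elim t)
    with assms(2) show ?case
      by (simp add: mult_dist_def fourier_dist_def hat_def schwartz_mult low_schwartz)
  qed
  ultimately show ?thesis by (rule Lim_transform_eventually)
qed

text \<open>The form in which membership is always verified: a spectrum away from the origin makes
  the low-frequency part exactly zero from some scale on, the same for all test functions.\<close>

lemma tempered_hI:
  assumes "u \<in> tempered" and "\<And>f t. f \<in> schwartz \<Longrightarrow> t \<ge> T \<Longrightarrow> hat u (\<lambda>\<xi>. low t \<xi> * f \<xi>) = 0"
  shows "u \<in> tempered_h chi"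
  unfolding tempered_h_def
proof (intro CollectI conjI ballI assms(1))
  fix f :: "'a \<Rightarrow> complex" assume f: "f \<in> schwartz"
  have "\<forall>\<^sub>F t in at_top. 0 = mult_dist (low t) (fourier_dist u) f"
    using eventually_gt_at_top[of "0::real"] eventually_ge_at_top[of T]
  proof eventually_elim
    case (elim t)
    with f assms(2)[OF f, of t] show ?case
      by (simp add: mult_dist_def fourier_dist_def hat_def schwartz_mult low_schwartz)
  qed
  then show "((\<lambda>t. mult_dist (low t) (fourier_dist u) f) \<longlongrightarrow> 0) at_top"
    by (rule Lim_transform_eventually[OF tendsto_const])
qed

end

section \<open>Lebesgue norms\<close>

lemma ennreal_powr_ennreal [simp]: "0 \<le> x \<Longrightarrow> ennreal_powr (ennreal x) a = ennreal (x powr a)"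
  by (simp add: ennreal_powr_def)

lemma ennreal_powr_top [simp]: "ennreal_powr top a = top"
  by (simp add: ennreal_powr_def infinity_ennreal_def)

lemma ennreal_powr_0 [simp]: "ennreal_powr 0 a = 0"
  by (simp add: ennreal_powr_def)

lemma ennreal_powr_measurable [measurable]:
  assumes [measurable]: "f \<in> borel_measurable M"
  shows "(\<lambda>x. ennreal_powr (f x) a) \<in> borel_measurable M"
  unfolding ennreal_powr_def infinity_ennreal_def by measurable

lemma ennreal_powr_mono:
  assumes "x \<le> y" "0 \<le> a" shows "ennreal_powr x a \<le> ennreal_powr y a"
  using assms by (cases x; cases y) (auto intro!: ennreal_leI powr_mono2 simp: top_unique)

lemma ennreal_powr_mult:
  assumes "0 \<le> c" "0 < a"
  shows "ennreal_powr (ennreal c * x) a = ennreal (c powr a) * ennreal_powr x a"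
proof (cases x)
  case top
  then show ?thesis using assms by (cases "c = 0") (auto simp: ennreal_mult_top)
qed (use assms in \<open>simp add: powr_mult flip: ennreal_mult\<close>)

lemma ennreal_powr_inverse: "0 < a \<Longrightarrow> ennreal_powr (ennreal_powr x a) (1 / a) = x"
  by (cases x) (auto simp: powr_powr)

lemma ennreal_powr_eq_0: "ennreal_powr x a = 0 \<Longrightarrow> x = 0"
  by (cases x) (auto simp: ennreal_eq_0_iff)

lemma ennreal_powr_less_top: "ennreal_powr x a < top \<Longrightarrow> x < top"
  by (cases x) auto

lemma ennreal_powr_less_topI: "x < top \<Longrightarrow> ennreal_powr x a < top"
  by (cases x) auto

text \<open>Convexity: this is the tangent inequality of \<open>x powr q\<close> at
  \<open>t\<close>, solved for \<open>a\<close>. It is Young's inequality for \<open>a / t\<close>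
  and 1; at \<open>q = 1\<close> the conjugate exponent is infinite and the claim is
  trivial.\<close>

lemma powr_tangent:
  fixes a t q :: real
  assumes "0 \<le> a" "0 < t" "1 \<le> q"
  shows "a \<le> t powr (1 - q) / q * a powr q + (1 - 1 / q) * t"
proof (cases "q = 1")
  case True
  then show ?thesis using assms by simp
next
  case False
  with assms have q: "q > 1" by simp
  have "a / t * 1 \<le> (a / t) powr q / q + 1 powr (q / (q - 1)) / (q / (q - 1))"
    using assms q by (intro Youngs_inequality) (auto simp: field_simps)
  then have "t * (a / t) \<le> t * ((a / t) powr q / q + (1 - 1 / q))"
    using q assms by (intro mult_left_mono) (auto simp: field_simps)
  also have "\<dots> = t powr (1 - q) / q * a powr q + (1 - 1 / q) * t"
    using assms q by (simp add: powr_divide powr_diff field_simps)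
  finally show ?thesis using assms by simp
qed

text \<open>Jensen's inequality, by integrating the tangent line of \<open>x powr q\<close> at the point \<open>t\<close> for which
  \<open>t powr q\<close> is the mean of \<open>h powr q\<close>.\<close>

lemma powr_nn_integral_le:
  assumes [measurable]: "w \<in> borel_measurable M" "h \<in> borel_measurable M"
    and W: "(\<integral>\<^sup>+x. w x \<partial>M) = ennreal W" "0 \<le> W" and q: "1 \<le> q"
  shows "ennreal_powr (\<integral>\<^sup>+x. w x * h x \<partial>M) q \<le>
    ennreal (W powr (q - 1)) * (\<integral>\<^sup>+x. w x * ennreal_powr (h x) q \<partial>M)"
proof -
  define B where "B = (\<integral>\<^sup>+x. w x * ennreal_powr (h x) q \<partial>M)"
  \<comment> \<open>The tangent point must be positive and finite, which excludes zero mass and a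
    zero or infinite mean.\<close>
  consider "W = 0" | "W > 0" "B = top" | "W > 0" "B = 0" | b where "W > 0" "B = ennreal b" "b > 0"
    using W(2) by (cases B) (fastforce simp: less_le)+
  then show ?thesis
  proof cases
    case 1
    then have "AE x in M. w x = 0" using W by (simp add: nn_integral_0_iff_AE)
    then have "(\<integral>\<^sup>+x. w x * h x \<partial>M) = 0" by (subst nn_integral_0_iff_AE) auto
    then show ?thesis by simp
  next
    case 2
    then show ?thesis by (simp add: B_def[symmetric] ennreal_mult_top)
  next
    case 3
    then have "AE x in M. w x * ennreal_powr (h x) q = 0"
      unfolding B_def by (subst (asm) nn_integral_0_iff_AE) auto
    then have "(\<integral>\<^sup>+x. w x * h x \<partial>M) = 0" by (subst nn_integral_0_iff_AE) (auto dest: ennreal_powr_eq_0)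
    then show ?thesis by simp
  next
    case 4
    define t where "t = (b / W) powr (1 / q)"
    have t: "t > 0" "t powr q = b / W" using 4 q by (auto simp: t_def powr_powr)
    have le: "h x \<le> ennreal (t powr (1 - q) / q) * ennreal_powr (h x) q + ennreal ((1 - 1 / q) * t)" for x
    proof (cases "h x")
      case (real a)
      then show ?thesis using powr_tangent[of a t q] t q
        by (simp add: ennreal_leI flip: ennreal_mult ennreal_plus)
    next
      case top
      then show ?thesis using t q by (simp add: ennreal_mult_top)
    qed
    have "(\<integral>\<^sup>+x. w x * h x \<partial>M) \<le> (\<integral>\<^sup>+x. ennreal (t powr (1 - q) / q) * (w x * ennreal_powr (h x) q) + ennreal ((1 - 1 / q) * t) * w x \<partial>M)"
      using mult_left_mono[OF le, of "w _"] by (intro nn_integral_mono) (simp add: algebra_simps)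
    also have "\<dots> = ennreal (t powr (1 - q) / q) * ennreal b + ennreal ((1 - 1 / q) * t) * ennreal W"
      using 4(2) W by (simp add: nn_integral_add nn_integral_cmult B_def)
    also have "\<dots> = ennreal (t powr (1 - q) / q * b + (1 - 1 / q) * t * W)"
      using 4 W q t by (simp flip: ennreal_mult ennreal_plus)
    \<comment> \<open>At this tangent point the two terms are the fractions \<open>1 / q\<close> and
      \<open>1 - 1 / q\<close> of the same quantity \<open>t * W\<close>.\<close>
    also have "t powr (1 - q) / q * b + (1 - 1 / q) * t * W = t * W"
    proof -
      have "t powr (1 - q) * b = t * W" using t 4 by (simp add: powr_diff)
      then have "t powr (1 - q) / q * b = t * W / q" by simp
      then show ?thesis by (simp add: algebra_simps)
    qed
    finally have "ennreal_powr (\<integral>\<^sup>+x. w x * h x \<partial>M) q \<le> ennreal_powr (ennreal (t * W)) q"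
      using q by (intro ennreal_powr_mono) auto
    also have "\<dots> = ennreal (W powr (q - 1) * b)"
      using t 4 by (simp add: powr_mult powr_diff)
    also have "\<dots> = ennreal (W powr (q - 1)) * B" using 4 by (simp add: ennreal_mult)
    finally show ?thesis by (simp add: B_def)
  qed
qed

text \<open>The reciprocal as a real number, equal to 0 at infinity, so that the scaling exponents
  have one formula for all \<open>p\<close>.\<close>

definition recip :: "ereal \<Rightarrow> real" where
  "recip p = real_of_ereal (1 / p)"

lemma exponent_cases:
  assumes "1 \<le> p"
  obtains "p = \<infinity>" "recip p = 0" | q where "p = ereal q" "1 \<le> q" "recip p = 1 / q"
  using assms by (cases p) (auto simp: recip_def one_ereal_def)

lemma Lnorm_ereal: "Lnorm (ereal q) M f = ennreal_powr (\<integral>\<^sup>+x. ennreal_powr (f x) q \<partial>M) (1 / q)"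
  by (simp add: Lnorm_def)

lemma Lnorm_infinity: "Lnorm \<infinity> M f = esssup M f"
  by (simp add: Lnorm_def)

lemma Lnorm_zero: "1 \<le> p \<Longrightarrow> Lnorm p lborel (\<lambda>x. 0) = 0"
  by (erule exponent_cases) (auto simp: Lnorm_ereal Lnorm_infinity esssup_const)

text \<open>Interpolation between L^1 and L^\<infinity>: the power \<open>q\<close> of
  \<open>norm (f x)\<close> is at most \<open>F powr (q - 1)\<close> times
  \<open>norm (f x)\<close>.\<close>

lemma Lnorm_bounded_integrable:
  fixes f :: "'b \<Rightarrow> 'c::{banach, second_countable_topology}"
  assumes p: "1 \<le> p" and f: "integrable M f" and A: "(LINT x|M. norm (f x)) \<le> A" "0 < A"
    and F: "\<And>x. norm (f x) \<le> F" "0 < F"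
  shows "Lnorm p M (\<lambda>x. ennreal (norm (f x))) \<le> ennreal (A powr recip p * F powr (1 - recip p))"
proof (cases rule: exponent_cases[OF p])
  case 1
  have "esssup M (\<lambda>x. ennreal (norm (f x))) \<le> ennreal F"
    using f F by (intro esssup_I) (auto intro!: ennreal_leI)
  then show ?thesis using 1 A F by (simp add: Lnorm_infinity)
next
  case (2 q)
  have [measurable]: "f \<in> borel_measurable M" using f by auto
  have "(\<integral>\<^sup>+x. ennreal_powr (ennreal (norm (f x))) q \<partial>M) \<le> (\<integral>\<^sup>+x. ennreal (F powr (q - 1)) * ennreal (norm (f x)) \<partial>M)"
  proof (rule nn_integral_mono)
    fix x
    have "norm (f x) powr q = norm (f x) powr (q - 1) * norm (f x)"
      by (cases "f x = 0") (auto simp: powr_diff)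
    also have "\<dots> \<le> F powr (q - 1) * norm (f x)"
      using F 2 by (intro mult_right_mono powr_mono2) auto
    finally show "ennreal_powr (ennreal (norm (f x))) q \<le> ennreal (F powr (q - 1)) * ennreal (norm (f x))"
      by (simp add: ennreal_leI flip: ennreal_mult)
  qed
  also have "\<dots> = ennreal (F powr (q - 1)) * ennreal (LINT x|M. norm (f x))"
    using f by (simp add: nn_integral_cmult nn_integral_eq_integral)
  also have "\<dots> \<le> ennreal (F powr (q - 1)) * ennreal A"
    by (intro mult_left_mono ennreal_leI A) simp
  finally have "(\<integral>\<^sup>+x. ennreal_powr (ennreal (norm (f x))) q \<partial>M) \<le> ennreal (F powr (q - 1) * A)"
    using A by (simp add: ennreal_mult)
  then have "Lnorm p M (\<lambda>x. ennreal (norm (f x))) \<le> ennreal_powr (ennreal (F powr (q - 1) * A)) (1 / q)"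
    unfolding 2 Lnorm_ereal using 2 by (intro ennreal_powr_mono) auto
  also have "\<dots> = ennreal ((F powr (q - 1) * A) powr (1 / q))" using A by simp
  also have "(F powr (q - 1) * A) powr (1 / q) = A powr recip p * F powr (1 - recip p)"
    using 2 A F by (simp add: powr_mult powr_powr diff_divide_distrib)
  finally show ?thesis .
qed

text \<open>If \<open>f\<close> is not integrable the left side is 0, by the convention for the
  Bochner integral.\<close>

lemma norm_integral_le_nn_integral:
  fixes f :: "'b \<Rightarrow> 'c::{banach, second_countable_topology}"
  shows "ennreal (norm (integral\<^sup>L M f)) \<le> (\<integral>\<^sup>+x. ennreal (norm (f x)) \<partial>M)"
  by (cases "integrable M f") (auto simp: integral_norm_bound_ennreal not_integrable_integral_eq)

text \<open>Hoelder's inequality with the dual norm of \<open>f\<close> replaced by its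
  interpolation bound. For finite exponents it is Jensen's inequality with weight
  \<open>norm (f x)\<close>, followed by the sup bound of \<open>f\<close> inside the remaining
  integral.\<close>

lemma Lnorm_pairing:
  fixes f g :: "'b \<Rightarrow> complex"
  assumes p: "1 \<le> p" and g[measurable]: "g \<in> borel_measurable M" and f: "integrable M f"
    and A: "(LINT x|M. norm (f x)) \<le> A" "0 < A" and F: "\<And>x. norm (f x) \<le> F" "0 < F"
  shows "ennreal (norm (LINT x|M. g x * f x)) \<le>
    ennreal (A powr (1 - recip p) * F powr recip p) * Lnorm p M (\<lambda>x. ennreal (norm (g x)))"
proof -
  have [measurable]: "f \<in> borel_measurable M" using f by auto
  let ?I = "\<integral>\<^sup>+x. ennreal (norm (f x)) * ennreal (norm (g x)) \<partial>M"
  have "ennreal (norm (LINT x|M. g x * f x)) \<le> (\<integral>\<^sup>+x. ennreal (norm (g x * f x)) \<partial>M)"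
    by (rule norm_integral_le_nn_integral)
  also have "\<dots> = ?I" by (intro nn_integral_cong) (simp add: norm_mult ennreal_mult mult.commute)
  finally have 1: "ennreal (norm (LINT x|M. g x * f x)) \<le> ?I" .
  have f1: "(\<integral>\<^sup>+x. ennreal (norm (f x)) \<partial>M) = ennreal (LINT x|M. norm (f x))"
    using f by (simp add: nn_integral_eq_integral)
  have f0: "0 \<le> (LINT x|M. norm (f x))" by (intro integral_nonneg_AE) auto
  show ?thesis
  proof (cases rule: exponent_cases[OF p])
    case 1
    let ?e = "esssup M (\<lambda>x. ennreal (norm (g x)))"
    have "?I \<le> (\<integral>\<^sup>+x. ennreal (norm (f x)) * ?e \<partial>M)"
      using esssup_AE[of "\<lambda>x. ennreal (norm (g x))" M]
      by (intro nn_integral_mono_AE) (auto elim!: eventually_mono intro: mult_left_mono)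
    also have "\<dots> = ennreal (LINT x|M. norm (f x)) * ?e"
      by (simp add: nn_integral_multc f1)
    also have "\<dots> \<le> ennreal A * ?e" by (intro mult_right_mono ennreal_leI A) simp
    finally show ?thesis
      using \<open>ennreal (norm (LINT x|M. g x * f x)) \<le> ?I\<close> 1 A F by (simp add: Lnorm_infinity)
  next
    case (2 q)
    have "ennreal_powr ?I q \<le> ennreal ((LINT x|M. norm (f x)) powr (q - 1)) *
        (\<integral>\<^sup>+x. ennreal (norm (f x)) * ennreal_powr (ennreal (norm (g x))) q \<partial>M)"
      using 2 by (intro powr_nn_integral_le f1 f0) auto
    also have "\<dots> \<le> ennreal (A powr (q - 1)) * (\<integral>\<^sup>+x. ennreal F * ennreal_powr (ennreal (norm (g x))) q \<partial>M)"
      using 2 A F f0 by (intro mult_mono nn_integral_mono mult_right_mono ennreal_leI powr_mono2) auto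
    also have "\<dots> = ennreal (A powr (q - 1) * F) * (\<integral>\<^sup>+x. ennreal_powr (ennreal (norm (g x))) q \<partial>M)"
      using F by (subst nn_integral_cmult) (auto simp: ennreal_mult mult.assoc)
    finally have "ennreal_powr (ennreal_powr ?I q) (1 / q) \<le> ennreal_powr \<dots> (1 / q)"
      using 2 by (intro ennreal_powr_mono) auto
    also have "\<dots> = ennreal ((A powr (q - 1) * F) powr (1 / q)) * Lnorm p M (\<lambda>x. ennreal (norm (g x)))"
      using 2 F by (subst ennreal_powr_mult) (auto simp: Lnorm_ereal)
    also have "(A powr (q - 1) * F) powr (1 / q) = A powr (1 - recip p) * F powr recip p"
      using 2 A F by (simp add: powr_mult powr_powr diff_divide_distrib)
    finally show ?thesis using 1 2 by (simp add: ennreal_powr_inverse)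
  qed
qed

text \<open>Multiplication by a positive real is invertible on \<open>ennreal\<close>. For empty
  \<open>S\<close> the infimum is infinite, which is the case of a distribution that is not a
  function.\<close>

lemma ennreal_le_mult_Inf:
  assumes "0 < (A::real)" "\<And>z. z \<in> S \<Longrightarrow> L \<le> ennreal A * z"
  shows "L \<le> ennreal A * Inf S"
proof -
  have "ennreal (1 / A) * L \<le> z" if "z \<in> S" for z
  proof -
    have "ennreal (1 / A) * L \<le> ennreal (1 / A) * (ennreal A * z)"
      by (intro mult_left_mono assms that) simp
    also have "\<dots> = z" using assms(1) by (simp flip: mult.assoc ennreal_mult)
    finally show ?thesis .
  qed
  then have "ennreal (1 / A) * L \<le> Inf S" by (intro Inf_greatest)
  then have "ennreal A * (ennreal (1 / A) * L) \<le> ennreal A * Inf S" by (intro mult_left_mono) simp_all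
  also have "ennreal A * (ennreal (1 / A) * L) = L" using assms(1) by (simp flip: mult.assoc ennreal_mult)
  finally show ?thesis .
qed

lemma Lnorm_dist_le: "represents g u \<Longrightarrow> Lnorm_dist p u \<le> Lnorm p lborel (\<lambda>x. ennreal (norm (g x)))"
  unfolding Lnorm_dist_def by (intro Inf_lower) auto

text \<open>The source of all lower bounds for the norm of a block: a large value on one test
  function forces every representing function to be large.\<close>

lemma Lnorm_dist_pairing:
  assumes p: "1 \<le> p" and f: "f \<in> schwartz"
    and A: "(LINT x|lborel. norm (f x)) \<le> A" "0 < A" and F: "\<And>x. norm (f x) \<le> F" "0 < F"
  shows "ennreal (norm (u f)) \<le> ennreal (A powr (1 - recip p) * F powr recip p) * Lnorm_dist p u"
  unfolding Lnorm_dist_def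
proof (rule ennreal_le_mult_Inf)
  show "0 < A powr (1 - recip p) * F powr recip p" using A F by simp
  fix z assume "z \<in> {Lnorm p lborel (\<lambda>x. ennreal (norm (g x))) |g. represents g u}"
  then obtain g where g: "represents g u" "z = Lnorm p lborel (\<lambda>x. ennreal (norm (g x)))" by blast
  then have "u f = (LINT x|lborel. g x * f x)" "g \<in> borel_measurable lborel"
    using f by (auto simp: represents_def)
  then show "ennreal (norm (u f)) \<le> ennreal (A powr (1 - recip p) * F powr recip p) * z"
    unfolding g(2) using Lnorm_pairing[OF p _ schwartz_integrable[OF f] A F] by simp
qed

subsection \<open>Fourier multipliers on Lebesgue spaces\<close>

text \<open>The plane wave multiplying \<open>s\<close> becomes a translation of its kernel. The
  argument is \<open>y - x\<close> because the multiplier acts here on the test function, that is,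
  transposed.\<close>

lemma fourier_mult_inv_fourier:
  assumes s: "s \<in> schwartz" and f: "f \<in> schwartz"
  shows "fourier (\<lambda>\<xi>. s \<xi> * inv_fourier f \<xi>) x = (LINT y|lborel. inv_fourier s (y - x) * f y)"
proof -
  have "fourier (\<lambda>\<xi>. s \<xi> * inv_fourier f \<xi>) x = (LINT \<xi>|lborel. (cis (- (\<xi> \<bullet> x)) * s \<xi>) * inv_fourier f \<xi>)"
    by (simp add: fourier_def mult.assoc)
  also have "\<dots> = (LINT y|lborel. inv_fourier (\<lambda>\<xi>. cis (- (\<xi> \<bullet> x)) * s \<xi>) y * f y)"
    by (intro inv_fourier_multiplication schwartz_slow_mult slow_cis s f)
  also have "inv_fourier (\<lambda>\<xi>. cis (- (\<xi> \<bullet> x)) * s \<xi>) = (\<lambda>y. inv_fourier s (y - x))"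
  proof
    fix y
    have "cis (y \<bullet> \<xi>) * (cis (- (\<xi> \<bullet> x)) * s \<xi>) = cis ((y - x) \<bullet> \<xi>) * s \<xi>" for \<xi>
      by (simp add: cis_mult inner_diff_left inner_commute[of \<xi> x] flip: mult.assoc)
    then show "inv_fourier (\<lambda>\<xi>. cis (- (\<xi> \<bullet> x)) * s \<xi>) y = inv_fourier s (y - x)"
      by (simp only: inv_fourier_def)
  qed
  finally show ?thesis .
qed

lemma nn_integral_translate:
  fixes f :: "'a::euclidean_space \<Rightarrow> ennreal"
  assumes "f \<in> borel_measurable borel"
  shows "(\<integral>\<^sup>+y. f (y - x) \<partial>lborel) = (\<integral>\<^sup>+y. f y \<partial>lborel)"
    and "(\<integral>\<^sup>+x. f (y - x) \<partial>lborel) = (\<integral>\<^sup>+y. f y \<partial>lborel)"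
  using nn_integral_affine[OF assms, of 1 "- x"] nn_integral_affine[OF assms, of "- 1" y] by simp_all

text \<open>Young's inequality for L^1 and L^p: Jensen with the weight
  \<open>norm (k (y - x))\<close>, whose mass \<open>K\<close> does not depend on \<open>y\<close>,
  and then Tonelli. Where the convolution integral diverges it is 0 by convention and the pointwise
  bound persists.\<close>

lemma Lnorm_convolution:
  fixes k g :: "'a::euclidean_space \<Rightarrow> complex"
  assumes p: "1 \<le> p" and k: "k \<in> schwartz" and g[measurable]: "g \<in> borel_measurable borel"
    and A: "(LINT x|lborel. norm (k x)) \<le> A" "0 < A"
  shows "Lnorm p lborel (\<lambda>y. ennreal (norm (LINT x|lborel. k (y - x) * g x))) \<le>
    ennreal A * Lnorm p lborel (\<lambda>x. ennreal (norm (g x)))"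
proof -
  note [measurable] = schwartz_measurable[OF k]
  let ?I = "\<lambda>y. \<integral>\<^sup>+x. ennreal (norm (k (y - x))) * ennreal (norm (g x)) \<partial>lborel"
  define K where "K = (LINT x|lborel. norm (k x))"
  have K0: "0 \<le> K" unfolding K_def by (intro integral_nonneg_AE) auto
  have K: "(\<integral>\<^sup>+x. ennreal (norm (k x)) \<partial>lborel) = ennreal K"
    using schwartz_integrable[OF k] by (simp add: nn_integral_eq_integral K_def)
  have kx: "(\<integral>\<^sup>+x. ennreal (norm (k (y - x))) \<partial>lborel) = ennreal K" for y
    using nn_integral_translate(2)[of "\<lambda>x. ennreal (norm (k x))" y] K by simp
  have ky: "(\<integral>\<^sup>+y. ennreal (norm (k (y - x))) \<partial>lborel) = ennreal K" for x
    using nn_integral_translate(1)[of "\<lambda>x. ennreal (norm (k x))" x] K by simp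
  have le: "ennreal (norm (LINT x|lborel. k (y - x) * g x)) \<le> ?I y" for y
    by (rule order_trans[OF norm_integral_le_nn_integral]) (simp add: norm_mult ennreal_mult)
  have m[measurable]: "(\<lambda>y. LINT x|lborel. k (y - x) * g x) \<in> borel_measurable borel"
    by measurable
  show ?thesis
  proof (cases rule: exponent_cases[OF p])
    case 1
    let ?e = "esssup lborel (\<lambda>x. ennreal (norm (g x)))"
    have "ennreal (norm (LINT x|lborel. k (y - x) * g x)) \<le> ennreal A * ?e" for y
    proof -
      have "?I y \<le> (\<integral>\<^sup>+x. ennreal (norm (k (y - x))) * ?e \<partial>lborel)"
        using esssup_AE[of "\<lambda>x. ennreal (norm (g x))" lborel]
        by (intro nn_integral_mono_AE) (auto elim!: eventually_mono intro: mult_left_mono)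
      also have "\<dots> = ennreal K * ?e" by (simp add: nn_integral_multc kx)
      also have "\<dots> \<le> ennreal A * ?e" using A by (intro mult_right_mono ennreal_leI) (auto simp: K_def)
      finally show ?thesis using le[of y] by (rule order_trans[rotated])
    qed
    then show ?thesis unfolding 1 Lnorm_infinity by (intro esssup_I) auto
  next
    case (2 q)
    let ?G = "\<lambda>x. ennreal_powr (ennreal (norm (g x))) q"
    have "(\<integral>\<^sup>+y. ennreal_powr (ennreal (norm (LINT x|lborel. k (y - x) * g x))) q \<partial>lborel)
      \<le> (\<integral>\<^sup>+y. ennreal (K powr (q - 1)) * (\<integral>\<^sup>+x. ennreal (norm (k (y - x))) * ?G x \<partial>lborel) \<partial>lborel)"
    proof (rule nn_integral_mono)
      fix y
      have "ennreal_powr (ennreal (norm (LINT x|lborel. k (y - x) * g x))) q \<le> ennreal_powr (?I y) q"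
        using 2 by (intro ennreal_powr_mono le) auto
      also have "\<dots> \<le> ennreal (K powr (q - 1)) * (\<integral>\<^sup>+x. ennreal (norm (k (y - x))) * ?G x \<partial>lborel)"
        using 2 by (intro powr_nn_integral_le kx K0) auto
      finally show "ennreal_powr (ennreal (norm (LINT x|lborel. k (y - x) * g x))) q \<le>
        ennreal (K powr (q - 1)) * (\<integral>\<^sup>+x. ennreal (norm (k (y - x))) * ?G x \<partial>lborel)" .
    qed
    also have "\<dots> = ennreal (K powr (q - 1)) * (\<integral>\<^sup>+y. \<integral>\<^sup>+x. ennreal (norm (k (y - x))) * ?G x \<partial>lborel \<partial>lborel)"
      by (rule nn_integral_cmult) measurable
    also have "(\<integral>\<^sup>+y. \<integral>\<^sup>+x. ennreal (norm (k (y - x))) * ?G x \<partial>lborel \<partial>lborel) =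
        (\<integral>\<^sup>+x. \<integral>\<^sup>+y. ennreal (norm (k (y - x))) * ?G x \<partial>lborel \<partial>lborel)"
      by (rule lborel_pair.Fubini') measurable
    also have "\<dots> = ennreal K * (\<integral>\<^sup>+x. ?G x \<partial>lborel)"
      by (simp add: nn_integral_multc ky nn_integral_cmult)
    also have "ennreal (K powr (q - 1)) * (ennreal K * (\<integral>\<^sup>+x. ?G x \<partial>lborel)) = ennreal (K powr q) * (\<integral>\<^sup>+x. ?G x \<partial>lborel)"
    proof -
      have "K powr (q - 1) * K = K powr q" using K0 by (cases "K = 0") (auto simp: powr_diff)
      then show ?thesis using K0 by (simp flip: mult.assoc ennreal_mult)
    qed
    also have "\<dots> \<le> ennreal (A powr q) * (\<integral>\<^sup>+x. ?G x \<partial>lborel)"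
      using A K0 2 by (intro mult_right_mono ennreal_leI powr_mono2) (auto simp: K_def)
    finally have "ennreal_powr (\<integral>\<^sup>+y. ennreal_powr (ennreal (norm (LINT x|lborel. k (y - x) * g x))) q \<partial>lborel) (1 / q)
      \<le> ennreal_powr (ennreal (A powr q) * (\<integral>\<^sup>+x. ?G x \<partial>lborel)) (1 / q)"
      using 2 by (intro ennreal_powr_mono) auto
    also have "\<dots> = ennreal A * Lnorm p lborel (\<lambda>x. ennreal (norm (g x)))"
      using 2 A by (subst ennreal_powr_mult) (auto simp: Lnorm_ereal powr_powr)
    finally show ?thesis unfolding 2 Lnorm_ereal .
  qed
qed

text \<open>The formula is Fubini's theorem for a triple product. Absolute integrability holds
  because \<open>?h\<close>, the convolution of the moduli of kernel and test function, is both
  bounded and integrable, hence pairs with \<open>g\<close> for every \<open>p\<close>.\<close>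

lemma represents_convolution:
  fixes k g :: "'a::euclidean_space \<Rightarrow> complex"
  assumes p: "1 \<le> p" and s: "s \<in> schwartz" and g: "represents g v"
    and fin: "Lnorm p lborel (\<lambda>x. ennreal (norm (g x))) < top"
    and w: "\<And>f. f \<in> schwartz \<Longrightarrow> w f = v (fourier (\<lambda>\<xi>. s \<xi> * inv_fourier f \<xi>))"
  shows "represents (\<lambda>y. LINT x|lborel. inv_fourier s (y - x) * g x) w"
  unfolding represents_def
proof (intro conjI ballI)
  let ?k = "inv_fourier s"
  have k: "?k \<in> schwartz" by (rule inv_fourier_schwartz[OF s])
  have gm[measurable]: "g \<in> borel_measurable borel" using g by (simp add: represents_def)
  note [measurable] = schwartz_measurable[OF k]
  show "(\<lambda>y. LINT x|lborel. ?k (y - x) * g x) \<in> borel_measurable borel" by measurable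
  fix f :: "'a \<Rightarrow> complex" assume f: "f \<in> schwartz"
  note [measurable] = schwartz_measurable[OF f]
  obtain M where M: "\<And>x. norm (?k x) \<le> M" "0 \<le> M" using schwartz_bounded[OF k] by blast
  define K where "K = (LINT x|lborel. norm (?k x))"
  define F where "F = (LINT x|lborel. norm (f x))"
  have "0 \<le> K" "0 \<le> F" unfolding K_def F_def by (auto intro!: integral_nonneg_AE)
  have K: "(\<integral>\<^sup>+x. ennreal (norm (?k x)) \<partial>lborel) = ennreal K"
    using schwartz_integrable[OF k] by (simp add: nn_integral_eq_integral K_def)
  have F: "(\<integral>\<^sup>+x. ennreal (norm (f x)) \<partial>lborel) = ennreal F"
    using schwartz_integrable[OF f] by (simp add: nn_integral_eq_integral F_def)
  let ?h = "\<lambda>x. \<integral>\<^sup>+y. ennreal (norm (?k (y - x))) * ennreal (norm (f y)) \<partial>lborel"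
  have h1: "?h x \<le> ennreal (M * F)" for x
  proof -
    have "?h x \<le> (\<integral>\<^sup>+y. ennreal M * ennreal (norm (f y)) \<partial>lborel)"
      by (intro nn_integral_mono mult_right_mono ennreal_leI M) simp
    then show ?thesis using M \<open>0 \<le> F\<close> by (simp add: nn_integral_cmult F ennreal_mult)
  qed
  have h2: "(\<integral>\<^sup>+x. ?h x \<partial>lborel) = ennreal (K * F)"
  proof -
    have "(\<integral>\<^sup>+x. ?h x \<partial>lborel) = (\<integral>\<^sup>+y. \<integral>\<^sup>+x. ennreal (norm (?k (y - x))) * ennreal (norm (f y)) \<partial>lborel \<partial>lborel)"
      by (rule lborel_pair.Fubini') measurable
    also have "\<dots> = (\<integral>\<^sup>+y. ennreal K * ennreal (norm (f y)) \<partial>lborel)"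
      using nn_integral_translate(2)[of "\<lambda>x. ennreal (norm (?k x))"] K by (simp add: nn_integral_multc)
    finally show ?thesis using \<open>0 \<le> K\<close> \<open>0 \<le> F\<close> by (simp add: nn_integral_cmult F ennreal_mult)
  qed
  have gh: "(\<integral>\<^sup>+x. ennreal (norm (g x)) * ?h x \<partial>lborel) < top"
  proof (cases rule: exponent_cases[OF p])
    case 1
    let ?e = "esssup lborel (\<lambda>x. ennreal (norm (g x)))"
    have "(\<integral>\<^sup>+x. ennreal (norm (g x)) * ?h x \<partial>lborel) \<le> (\<integral>\<^sup>+x. ?e * ?h x \<partial>lborel)"
      using esssup_AE[of "\<lambda>x. ennreal (norm (g x))" lborel]
      by (intro nn_integral_mono_AE) (auto elim!: eventually_mono intro: mult_right_mono)
    also have "\<dots> = ?e * ennreal (K * F)" by (subst nn_integral_cmult) (auto simp: h2)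
    also have "\<dots> < top" using fin 1 by (simp add: Lnorm_infinity ennreal_mult_less_top)
    finally show ?thesis .
  next
    case (2 q)
    let ?G = "\<lambda>x. ennreal_powr (ennreal (norm (g x))) q"
    \<comment> \<open>This splits \<open>g\<close> into a bounded part, paired with the integral of
      \<open>?h\<close>, and its power \<open>q\<close>, paired with the sup bound of
      \<open>?h\<close>.\<close>
    have le: "ennreal a \<le> 1 + ennreal_powr (ennreal a) q" if "0 \<le> a" for a
    proof -
      have "a \<le> 1 + a powr q"
      proof (cases "a \<le> 1")
        case False
        then have "a powr 1 \<le> a powr q" using 2 by (intro powr_mono) auto
        then show ?thesis using False by simp
      qed (simp add: add_increasing2)
      then have "ennreal a \<le> ennreal (1 + a powr q)" by (rule ennreal_leI)
      then show ?thesis using that by simp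
    qed
    have "(\<integral>\<^sup>+x. ennreal (norm (g x)) * ?h x \<partial>lborel) \<le> (\<integral>\<^sup>+x. ?h x + ?G x * ennreal (M * F) \<partial>lborel)"
    proof (rule nn_integral_mono)
      fix x
      have "ennreal (norm (g x)) * ?h x \<le> (1 + ?G x) * ?h x" by (intro mult_right_mono le) auto
      also have "\<dots> \<le> ?h x + ?G x * ennreal (M * F)"
        unfolding distrib_right mult_1 by (intro add_mono mult_left_mono h1 order_refl) simp
      finally show "ennreal (norm (g x)) * ?h x \<le> ?h x + ?G x * ennreal (M * F)" .
    qed
    also have "\<dots> = ennreal (K * F) + (\<integral>\<^sup>+x. ?G x \<partial>lborel) * ennreal (M * F)"
      by (subst nn_integral_add) (auto simp: h2 nn_integral_multc)
    also have "\<dots> < top"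
      using fin 2 ennreal_powr_less_top by (auto simp: Lnorm_ereal ennreal_mult_less_top)
    finally show ?thesis .
  qed
  have I: "integrable (lborel \<Otimes>\<^sub>M lborel) (\<lambda>(x, y). ?k (y - x) * g x * f y)"
  proof (rule integrableI_bounded)
    have "(\<integral>\<^sup>+z. ennreal (norm (case z of (x, y) \<Rightarrow> ?k (y - x) * g x * f y)) \<partial>(lborel \<Otimes>\<^sub>M lborel))
      = (\<integral>\<^sup>+x. \<integral>\<^sup>+y. ennreal (norm (?k (y - x) * g x * f y)) \<partial>lborel \<partial>lborel)"
      by (subst lborel.nn_integral_fst[symmetric]) auto
    also have "\<dots> = (\<integral>\<^sup>+x. ennreal (norm (g x)) * ?h x \<partial>lborel)"
      by (subst nn_integral_cmult[symmetric]) (auto intro!: nn_integral_cong simp: norm_mult ennreal_mult mult_ac)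
    finally show "(\<integral>\<^sup>+z. ennreal (norm (case z of (x, y) \<Rightarrow> ?k (y - x) * g x * f y)) \<partial>(lborel \<Otimes>\<^sub>M lborel)) < \<infinity>"
      using gh by simp
  qed measurable
  have "integrable lborel (\<lambda>y. LINT x|lborel. ?k (y - x) * g x * f y)"
    using lborel_pair.integrable_snd[OF I] by simp
  then show "integrable lborel (\<lambda>y. (LINT x|lborel. ?k (y - x) * g x) * f y)" by simp
  have "w f = (LINT x|lborel. g x * fourier (\<lambda>\<xi>. s \<xi> * inv_fourier f \<xi>) x)"
    using g w[OF f] f s unfolding represents_def by (simp add: fourier_schwartz schwartz_mult inv_fourier_schwartz)
  also have "\<dots> = (LINT x|lborel. LINT y|lborel. ?k (y - x) * g x * f y)"
    unfolding fourier_mult_inv_fourier[OF s f]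
    by (simp add: mult_ac flip: integral_mult_right_zero)
  also have "\<dots> = (LINT y|lborel. LINT x|lborel. ?k (y - x) * g x * f y)"
    by (rule lborel_pair.Fubini_integral[OF I, symmetric])
  finally show "w f = (LINT y|lborel. (LINT x|lborel. ?k (y - x) * g x) * f y)" by simp
qed

text \<open>Only representing functions of finite norm need \<open>represents_convolution\<close>;
  for the others the right side is infinite because \<open>A\<close> is positive.\<close>

lemma Lnorm_dist_multiplier:
  assumes p: "1 \<le> p" and s: "s \<in> schwartz"
    and w: "\<And>f. f \<in> schwartz \<Longrightarrow> w f = v (fourier (\<lambda>\<xi>. s \<xi> * inv_fourier f \<xi>))"
    and A: "(LINT x|lborel. norm (inv_fourier s x)) \<le> A" "0 < A"
  shows "Lnorm_dist p w \<le> ennreal A * Lnorm_dist p v"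
  unfolding Lnorm_dist_def[of p v]
proof (rule ennreal_le_mult_Inf[OF A(2)])
  fix z assume "z \<in> {Lnorm p lborel (\<lambda>x. ennreal (norm (g x))) |g. represents g v}"
  then obtain g where g: "represents g v" "z = Lnorm p lborel (\<lambda>x. ennreal (norm (g x)))" by blast
  show "Lnorm_dist p w \<le> ennreal A * z"
  proof (cases "z < top")
    case True
    have "Lnorm_dist p w \<le> Lnorm p lborel (\<lambda>y. ennreal (norm (LINT x|lborel. inv_fourier s (y - x) * g x)))"
      using True g by (intro Lnorm_dist_le represents_convolution[OF p s g(1) _ w]) auto
    also have "\<dots> \<le> ennreal A * z"
      unfolding g(2) using g(1) by (intro Lnorm_convolution p inv_fourier_schwartz s A) (auto simp: represents_def)
    finally show ?thesis .
  next
    case False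
    then show ?thesis using A by (simp add: ennreal_mult_top less_top[symmetric])
  qed
qed

context littlewood_paley
begin

subsection \<open>Dilations of Schwartz functions\<close>

lemma L1_dilate:
  fixes h :: "'a \<Rightarrow> complex"
  assumes "h \<in> schwartz" "c > 0"
  shows "(LINT x|lborel. norm ((1 / c ^ DIM('a)) *\<^sub>R h ((1 / c) *\<^sub>R x))) = (LINT x|lborel. norm (h x))"
proof -
  note [measurable] = schwartz_measurable[OF assms(1)]
  have "(LINT x|lborel. norm (h (0 + (1 / c) *\<^sub>R x))) = c ^ DIM('a) * (LINT x|lborel. norm (h x))"
    using assms(2) by (subst integral_affine[where f="\<lambda>x. norm (h x)"]) (auto simp: power_divide)
  then show ?thesis using assms(2) by simp
qed

lemma fourier_dilate:
  fixes h :: "'a \<Rightarrow> complex"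
  assumes h: "h \<in> schwartz" and c: "c > 0"
  shows "fourier (\<lambda>\<xi>. h (c *\<^sub>R \<xi>)) x = (1 / c ^ DIM('a)) *\<^sub>R fourier h ((1 / c) *\<^sub>R x)"
proof -
  have "complex_of_real ((2 * pi) ^ DIM('a)) \<noteq> 0" by simp
  moreover have "(1 / of_real ((2 * pi) ^ DIM('a))) * fourier (\<lambda>\<xi>. h (c *\<^sub>R \<xi>)) x =
    (1 / of_real ((2 * pi) ^ DIM('a))) * ((1 / c ^ DIM('a)) *\<^sub>R fourier h ((1 / c) *\<^sub>R x))"
    using inv_fourier_dilate[OF h c, of "- x"] unfolding inv_fourier_eq by simp
  ultimately show ?thesis unfolding mult_cancel_left by simp
qed

text \<open>The kernels are dilations, normalised in L^1, of the one at \<open>t = 1\<close>, so one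
  constant serves all scales; the added 1 makes it strictly positive.\<close>

lemma low_kernel_L1:
  obtains A where "A > 0" "\<And>t. t > 0 \<Longrightarrow> (LINT x|lborel. norm (inv_fourier (low t) x)) \<le> A"
proof
  let ?A = "LINT x|lborel. norm (inv_fourier (low 1) x)"
  show "?A + 1 > 0" by (intro add_nonneg_pos integral_nonneg_AE) auto
  show "(LINT x|lborel. norm (inv_fourier (low t) x)) \<le> ?A + 1" if "t > 0" for t
    using L1_dilate[OF inv_fourier_schwartz[OF low_schwartz[of 1]] that] inv_fourier_dilate[OF low_schwartz[of 1] that]
    by simp
qed

text \<open>\<open>low (t / 2)\<close> equals 1 on the ball of radius \<open>2 / t\<close>, outside
  of which \<open>ann t\<close> vanishes. This presents \<open>ann t\<close> as the symbol of a
  block times a test function.\<close>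

lemma ann_low_half: "t > 0 \<Longrightarrow> ann t \<xi> * low (t / 2) \<xi> = ann t \<xi>"
  using ann_eq_0[of t \<xi>] low_eq_1[of "t / 2" \<xi>] by (cases "t * norm \<xi> > 2") auto

text \<open>The block is tested against the Fourier transform of a dilated cutoff that equals 1 on the
  annulus; Hoelder's inequality and scaling give the power of two.\<close>

lemma hat_ann_bound:
  assumes p: "1 \<le> p"
  obtains C where "C > 0" "\<And>u m. ennreal (norm (hat u (ann (2 powi (- m))))) \<le>
    ennreal (C * 2 powr (of_int m * (DIM('a) * recip p))) * Lnorm_dist p (block chi m u)"
proof -
  let ?h = "fourier (low 1)"
  let ?d = "real DIM('a)"
  have h: "?h \<in> schwartz" by (intro fourier_schwartz low_schwartz) simp
  obtain F0 where F0: "\<And>x. norm (?h x) \<le> F0" "0 \<le> F0" using schwartz_bounded[OF h] by blast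
  define F where "F = F0 + 1"
  define A where "A = (LINT x|lborel. norm (?h x)) + 1"
  have F: "\<And>x. norm (?h x) \<le> F" "0 < F" using F0 by (auto simp: F_def intro: add_increasing2)
  have A: "0 < A" unfolding A_def by (intro add_nonneg_pos integral_nonneg_AE) auto
  \<comment> \<open>The last factor pays for the dilation parameter \<open>t / 2\<close> instead of
    \<open>t\<close>.\<close>
  define C where "C = A powr (1 - recip p) * F powr recip p * 2 powr (?d * recip p)"
  show thesis
  proof (rule that)
    show "C > 0" using A F by (simp add: C_def)
    fix u :: "'a functional" and m
    define t :: real where "t = 2 powi (- m)"
    have t: "t > 0" by (simp add: t_def)
    let ?f = "fourier (low (t / 2))"
    have f: "?f x = (1 / (t / 2) ^ DIM('a)) *\<^sub>R ?h ((1 / (t / 2)) *\<^sub>R x)" for x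
      using fourier_dilate[OF low_schwartz[of 1], of "t / 2" x] t by simp
    have "block chi m u ?f = hat u (\<lambda>\<xi>. ann t \<xi> * low (t / 2) \<xi>)"
      using t by (subst block_fourier) (auto simp: t_def intro!: low_schwartz)
    also have "\<dots> = hat u (ann t)" unfolding ann_low_half[OF t] ..
    finally have "ennreal (norm (hat u (ann t))) = ennreal (norm (block chi m u ?f))" by simp
    also have "\<dots> \<le> ennreal (A powr (1 - recip p) * ((1 / (t / 2) ^ DIM('a)) * F) powr recip p) * Lnorm_dist p (block chi m u)"
    proof (rule Lnorm_dist_pairing[OF p _ _ A])
      show "?f \<in> schwartz" using t by (intro fourier_schwartz low_schwartz) simp
      show "(LINT x|lborel. norm (?f x)) \<le> A"
        unfolding f using t by (subst L1_dilate[OF h]) (auto simp: A_def)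
      show "norm (?f x) \<le> (1 / (t / 2) ^ DIM('a)) * F" for x
        unfolding f norm_scaleR using t F by (simp add: divide_right_mono mult_left_mono)
      show "0 < (1 / (t / 2) ^ DIM('a)) * F" using t F by simp
    qed
    also have "A powr (1 - recip p) * ((1 / (t / 2) ^ DIM('a)) * F) powr recip p = C * 2 powr (of_int m * (?d * recip p))"
    proof -
      have "1 / (t / 2) ^ DIM('a) = 2 powr ((of_int m + 1) * ?d)"
      proof -
        have "t = 2 powr (- of_int m)" unfolding t_def by (subst powr_real_of_int'[symmetric]) auto
        then have "t / 2 = 2 powr (- (of_int m + 1))" by (simp add: powr_diff)
        then have "(t / 2) ^ DIM('a) = 2 powr (- ((of_int m + 1) * ?d))"
          using powr_realpow[of "t / 2" "DIM('a)"] t by (simp add: powr_powr algebra_simps)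
        then show ?thesis by (simp only: powr_minus_divide) simp
      qed
      then show ?thesis using F by (simp add: powr_mult powr_powr C_def) (simp add: algebra_simps flip: powr_add)
    qed
    finally show "ennreal (norm (hat u (ann (2 powi (- m))))) \<le>
      ennreal (C * 2 powr (of_int m * (DIM('a) * recip p))) * Lnorm_dist p (block chi m u)"
      by (simp add: t_def)
  qed
qed

end

section \<open>Lacunary distributions\<close>

text \<open>Bump \<open>k\<close> sits at size \<open>1 / freq k\<close>, in the block of index
  \<open>- 3 * (k + 1)\<close>. Starting from exponent 1 keeps all bumps inside the unit ball, where
  \<open>low 1\<close> is 1.\<close>

definition freq :: "nat \<Rightarrow> real" where
  "freq k = 8 ^ Suc k"

lemma freq_ge: "freq k \<ge> 8" "freq k > 0" "freq k \<ge> 1"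
  using one_le_power[of "8::real" "Suc k"] by (simp_all add: freq_def)

lemma freq_powi: "freq k = 2 powi (3 * (int k + 1))"
proof -
  have "3 * (int k + 1) = int (3 * Suc k)" by simp
  then have "2 powi (3 * (int k + 1)) = (2::real) ^ (3 * Suc k)" by (simp only: power_int_of_nat)
  also have "\<dots> = (2 ^ 3) ^ Suc k" by (rule power_mult)
  finally show ?thesis by (simp add: freq_def)
qed

lemma freq_powr: "freq k = 2 powr (3 * (real k + 1))"
proof -
  have "2 powr (3 * (real k + 1)) = 2 powr real (3 * Suc k)" by (simp add: algebra_simps)
  also have "\<dots> = 2 ^ (3 * Suc k)" by (rule powr_realpow) simp
  also have "\<dots> = (2 ^ 3) ^ Suc k" by (rule power_mult)
  finally show ?thesis by (simp add: freq_def)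
qed

lemma powi_div_freq: "2 powi (- m) / freq k = 2 powi (- (m + 3 * (int k + 1)))"
  unfolding freq_powi by (subst power_int_diff[symmetric]) (auto simp: algebra_simps)

text \<open>The Fourier transform of the distribution below is, up to a multiple of the Dirac mass at the
  origin, \<open>\<Sum>k. a k * eta_k\<close>, where \<open>eta_k\<close> is \<open>eta\<close> rescaled to frequencies of size \<open>1 / freq k\<close>.
  Subtracting \<open>h 0\<close> makes the series converge.\<close>

locale lacunary = littlewood_paley chi for chi :: "'a::euclidean_space \<Rightarrow> real" +
  fixes eta :: "'a \<Rightarrow> complex" and K :: real
  assumes eta: "eta \<in> schwartz"
    and eta_supp: "norm \<xi> > 2 \<or> norm \<xi> \<le> 1 / 2 \<Longrightarrow> eta \<xi> = 0"
    and eta_decay: "\<exists>C\<ge>0. \<exists>j. \<forall>h\<in>schwartz. \<forall>c\<ge>1.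
      norm (LINT \<xi>|lborel. eta \<xi> * (h ((1 / c) *\<^sub>R \<xi>) - h 0)) \<le> C * c powr (- K) * schwartz_seminorm j h"
begin

text \<open>The rescaling is placed on \<open>h\<close> and the profile stays fixed, so decay in
  \<open>c\<close> becomes a question about \<open>h\<close> near the origin.\<close>

definition pairing :: "real \<Rightarrow> ('a \<Rightarrow> complex) \<Rightarrow> complex" where
  "pairing c h = (LINT \<xi>|lborel. eta \<xi> * (h ((1 / c) *\<^sub>R \<xi>) - h 0))"

text \<open>The weight is the gain in \<open>eta_decay\<close>, so this is absolute convergence of
  the series on every test function.\<close>

definition admissible :: "(nat \<Rightarrow> real) \<Rightarrow> bool" where
  "admissible a \<longleftrightarrow> summable (\<lambda>k. \<bar>a k\<bar> * freq k powr (- K))"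

definition lac :: "(nat \<Rightarrow> real) \<Rightarrow> 'a functional" where
  "lac a f = (if f \<in> schwartz then (\<Sum>k. of_real (a k) * pairing (freq k) (inv_fourier f)) else 0)"

lemma integrable_eta_mult: "g \<in> schwartz \<Longrightarrow> c \<noteq> 0 \<Longrightarrow> integrable lborel (\<lambda>\<xi>. eta \<xi> * g (c *\<^sub>R \<xi>))"
  by (intro schwartz_integrable schwartz_mult eta schwartz_dilate)

lemma pairing_split:
  assumes "h \<in> schwartz" "c > 0"
  shows "pairing c h = (LINT \<xi>|lborel. eta \<xi> * h ((1 / c) *\<^sub>R \<xi>)) - (LINT \<xi>|lborel. eta \<xi>) * h 0"
  using integrable_eta_mult[OF assms(1), of "1 / c"] schwartz_integrable[OF eta] assms(2)
  by (simp add: pairing_def right_diff_distrib)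

lemma pairing_lincomb:
  assumes "f \<in> schwartz" "g \<in> schwartz" "c > 0"
  shows "pairing c (\<lambda>\<xi>. a * f \<xi> + b * g \<xi>) = a * pairing c f + b * pairing c g"
proof -
  have "(LINT \<xi>|lborel. eta \<xi> * (a * f ((1 / c) *\<^sub>R \<xi>) + b * g ((1 / c) *\<^sub>R \<xi>))) =
    (LINT \<xi>|lborel. a * (eta \<xi> * f ((1 / c) *\<^sub>R \<xi>)) + b * (eta \<xi> * g ((1 / c) *\<^sub>R \<xi>)))"
    by (simp add: algebra_simps)
  also have "\<dots> = a * (LINT \<xi>|lborel. eta \<xi> * f ((1 / c) *\<^sub>R \<xi>)) + b * (LINT \<xi>|lborel. eta \<xi> * g ((1 / c) *\<^sub>R \<xi>))"
    using integrable_eta_mult[OF assms(1), of "1 / c"] integrable_eta_mult[OF assms(2), of "1 / c"] assms(3) by simp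
  finally show ?thesis
    using assms by (simp add: pairing_split schwartz_lincomb algebra_simps)
qed

lemma lac_bound:
  obtains C j where "C \<ge> 0" "\<And>a k h. h \<in> schwartz \<Longrightarrow>
    norm (of_real (a k) * pairing (freq k) h) \<le> (\<bar>a k\<bar> * freq k powr (- K)) * (C * schwartz_seminorm j h)"
proof -
  obtain C j where C: "0 \<le> C" "\<And>h c. h \<in> schwartz \<Longrightarrow> c \<ge> 1 \<Longrightarrow>
      norm (pairing c h) \<le> C * c powr (- K) * schwartz_seminorm j h"
    using eta_decay unfolding pairing_def by blast
  show thesis
  proof (rule that[OF C(1)])
    fix a :: "nat \<Rightarrow> real" and k and h :: "'a \<Rightarrow> complex" assume "h \<in> schwartz"
    from C(2)[OF this freq_ge(3), of k]
    have "\<bar>a k\<bar> * norm (pairing (freq k) h) \<le> \<bar>a k\<bar> * (C * freq k powr (- K) * schwartz_seminorm j h)"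
      by (rule mult_left_mono) simp
    then show "norm (of_real (a k) * pairing (freq k) h) \<le> (\<bar>a k\<bar> * freq k powr (- K)) * (C * schwartz_seminorm j h)"
      by (simp add: norm_mult mult_ac)
  qed
qed

lemma lac_summable:
  assumes "admissible a" "h \<in> schwartz"
  shows "summable (\<lambda>k. of_real (a k) * pairing (freq k) h)"
proof -
  obtain C j where C: "C \<ge> 0" "\<And>a k h. h \<in> schwartz \<Longrightarrow>
    norm (of_real (a k) * pairing (freq k) h) \<le> (\<bar>a k\<bar> * freq k powr (- K)) * (C * schwartz_seminorm j h)"
    using lac_bound by metis
  show ?thesis
  proof (rule summable_comparison_test')
    show "summable (\<lambda>k. (\<bar>a k\<bar> * freq k powr (- K)) * (C * schwartz_seminorm j h))"
      using assms(1) unfolding admissible_def by (rule summable_mult2)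
  qed (rule C(2)[OF assms(2)])
qed

lemma hat_lac: "h \<in> schwartz \<Longrightarrow> hat (lac a) h = (\<Sum>k. of_real (a k) * pairing (freq k) h)"
  by (simp add: hat_def lac_def fourier_schwartz inv_fourier_fourier)

lemma lac_tempered:
  assumes a: "admissible a" shows "lac a \<in> tempered"
proof -
  obtain C j where C: "C \<ge> 0" "\<And>a k h. h \<in> schwartz \<Longrightarrow>
    norm (of_real (a k) * pairing (freq k) h) \<le> (\<bar>a k\<bar> * freq k powr (- K)) * (C * schwartz_seminorm j h)"
    using lac_bound by metis
  obtain D i where D: "D \<ge> 0" "\<And>f :: 'a \<Rightarrow> complex. f \<in> schwartz \<Longrightarrow> schwartz_seminorm j (inv_fourier f) \<le> D * schwartz_seminorm i f"
    using schwartz_cont_seminorm[OF schwartz_cont_inv_fourier] by blast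
  let ?S = "\<Sum>k. \<bar>a k\<bar> * freq k powr (- K)"
  have sum: "summable (\<lambda>k. \<bar>a k\<bar> * freq k powr (- K))" using a by (simp add: admissible_def)
  show ?thesis
  proof (rule temperedI[where C = "?S * C * D" and k = i])
    show "lac a f = 0" if "f \<notin> schwartz" for f using that by (simp add: lac_def)
    fix f :: "'a \<Rightarrow> complex" assume f: "f \<in> schwartz"
    note fh = inv_fourier_schwartz[OF f]
    have s: "summable (\<lambda>k. (\<bar>a k\<bar> * freq k powr (- K)) * (C * schwartz_seminorm j (inv_fourier f)))"
      by (rule summable_mult2[OF sum])
    have "norm (lac a f) \<le> (\<Sum>k. (\<bar>a k\<bar> * freq k powr (- K)) * (C * schwartz_seminorm j (inv_fourier f)))"
      using f by (auto simp: lac_def intro!: norm_suminf_le C(2)[OF fh] s)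
    also have "\<dots> = ?S * (C * schwartz_seminorm j (inv_fourier f))" by (rule suminf_mult2[OF sum, symmetric])
    also have "\<dots> \<le> ?S * (C * (D * schwartz_seminorm i f))"
      by (intro mult_left_mono D f C suminf_nonneg sum) auto
    finally show "norm (lac a f) \<le> ?S * C * D * schwartz_seminorm i f" by (simp add: mult_ac)
  next
    fix f g :: "'a \<Rightarrow> complex" and x y assume fg: "f \<in> schwartz" "g \<in> schwartz"
    have "lac a (\<lambda>t. x * f t + y * g t) =
      (\<Sum>k. x * (of_real (a k) * pairing (freq k) (inv_fourier f)) + y * (of_real (a k) * pairing (freq k) (inv_fourier g)))"
      using fg by (simp add: lac_def schwartz_lincomb inv_fourier_schwartz_lincomb pairing_lincomb
          inv_fourier_schwartz freq_ge algebra_simps)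
    also have "\<dots> = x * lac a f + y * lac a g"
      using fg lac_summable[OF a inv_fourier_schwartz[OF fg(1)]] lac_summable[OF a inv_fourier_schwartz[OF fg(2)]]
      by (simp add: lac_def suminf_mult summable_mult flip: suminf_add)
    finally show "lac a (\<lambda>t. x * f t + y * g t) = x * lac a f + y * lac a g" .
  qed
qed

lemma lac_diff:
  assumes "admissible a" "admissible b"
  shows "tempered_diff (lac a) (lac b) = lac (\<lambda>k. a k - b k)"
proof
  fix f :: "'a \<Rightarrow> complex"
  show "tempered_diff (lac a) (lac b) f = lac (\<lambda>k. a k - b k) f"
  proof (cases "f \<in> schwartz")
    case True
    from suminf_diff[OF lac_summable[OF assms(1) inv_fourier_schwartz[OF this]] lac_summable[OF assms(2) inv_fourier_schwartz[OF this]]]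
    show ?thesis using True by (simp add: tempered_diff_def lac_def left_diff_distrib)
  qed (simp add: tempered_diff_def lac_def)
qed

section \<open>Bumps against dyadic blocks\<close>

lemma pairing_at_0: "h 0 = 0 \<Longrightarrow> pairing c h = (LINT \<xi>|lborel. eta \<xi> * h ((1 / c) *\<^sub>R \<xi>))"
  by (simp add: pairing_def)

lemma dyadic_at_0: "dyadic chi 0 = 0"
  by (simp add: dyadic_def)

text \<open>The annulus vanishes at the origin, so the subtracted value disappears, and only the
  ratio \<open>t / c\<close> of the two scales remains in the cutoff.\<close>

lemma pairing_ann:
  "pairing c (\<lambda>\<xi>. ann t \<xi> * h \<xi>) = (LINT \<xi>|lborel. eta \<xi> * ann (t / c) \<xi> * h ((1 / c) *\<^sub>R \<xi>))"
  by (subst pairing_at_0) (simp_all add: dyadic_at_0 mult.assoc)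

text \<open>Both factors live in annuli with radii of ratio 4. Among powers of two only
  \<open>\<tau>\<close> equal to 1/2, 1 or 2 allows an overlap; boundary spheres cause no harm since
  the inner one is excluded on both sides.\<close>

lemma eta_ann_eq_0:
  assumes "\<tau> > 0" "\<tau> \<ge> 4 \<or> \<tau> \<le> 1 / 4" shows "eta \<xi> * ann \<tau> \<xi> = 0"
proof (cases "norm \<xi> > 2 \<or> norm \<xi> \<le> 1 / 2")
  case False
  have "\<tau> * norm \<xi> > 2 \<or> \<tau> * norm \<xi> \<le> 1 / 2"
  proof (cases "\<tau> \<ge> 4")
    case True
    then have "4 * norm \<xi> \<le> \<tau> * norm \<xi>" by (intro mult_right_mono) auto
    with False show ?thesis by linarith
  next
    case 2: False
    then have "\<tau> * norm \<xi> \<le> 1 / 4 * norm \<xi>" using assms by (intro mult_right_mono) auto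
    with False show ?thesis by linarith
  qed
  then show ?thesis using ann_eq_0[OF assms(1)] by simp
qed (simp add: eta_supp)

lemma pairing_ann_far:
  assumes "m + 3 * (int k + 1) \<notin> {-1, 0, 1}"
  shows "pairing (freq k) (\<lambda>\<xi>. ann (2 powi (- m)) \<xi> * h \<xi>) = 0"
proof -
  define j where "j = m + 3 * (int k + 1)"
  have "(2::real) powi (- j) \<ge> 4 \<or> (2::real) powi (- j) \<le> 1 / 4"
  proof (cases "j \<ge> 2")
    case True
    then have "(2::real) powi (- j) \<le> 2 powi (- 2)" by (intro power_int_increasing) auto
    then show ?thesis by (simp add: power_int_minus)
  next
    case False
    with assms have "2 \<le> - j" by (auto simp: j_def)
    then have "(2::real) powi 2 \<le> 2 powi (- j)" by (intro power_int_increasing) auto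
    then show ?thesis by simp
  qed
  then have z: "eta \<xi> * ann (2 powi (- j)) \<xi> = 0" for \<xi> by (intro eta_ann_eq_0) auto
  show ?thesis unfolding pairing_ann powi_div_freq j_def[symmetric] z by simp
qed

text \<open>The numbers \<open>3 * (k + 1)\<close> are spaced by 3 while the window has three
  elements, so no second bump meets this block and the series collapses to one term.\<close>

lemma hat_lac_ann:
  assumes "h \<in> schwartz" and j: "m + 3 * (int k + 1) \<in> {-1, 0, 1}"
  shows "hat (lac a) (\<lambda>\<xi>. ann (2 powi (- m)) \<xi> * h \<xi>) =
    of_real (a k) * (LINT \<xi>|lborel. eta \<xi> * ann (2 powi (- (m + 3 * (int k + 1)))) \<xi> * h ((1 / freq k) *\<^sub>R \<xi>))"
proof -
  have "hat (lac a) (\<lambda>\<xi>. ann (2 powi (- m)) \<xi> * h \<xi>) =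
      (\<Sum>l. of_real (a l) * pairing (freq l) (\<lambda>\<xi>. ann (2 powi (- m)) \<xi> * h \<xi>))"
    by (intro hat_lac schwartz_mult ann_schwartz assms) simp
  also have "\<dots> = (\<Sum>l\<in>{k}. of_real (a l) * pairing (freq l) (\<lambda>\<xi>. ann (2 powi (- m)) \<xi> * h \<xi>))"
  proof (rule suminf_finite)
    fix l assume "l \<notin> {k}"
    then have "m + 3 * (int l + 1) \<notin> {-1, 0, 1}" using j by auto
    then show "of_real (a l) * pairing (freq l) (\<lambda>\<xi>. ann (2 powi (- m)) \<xi> * h \<xi>) = 0"
      by (simp add: pairing_ann_far)
  qed simp
  finally show ?thesis by (simp add: pairing_ann powi_div_freq)
qed

lemma block_lac_far:
  assumes "\<And>k. m + 3 * (int k + 1) \<notin> {-1, 0, 1}" "1 \<le> p"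
  shows "Lnorm_dist p (block chi m (lac a)) = 0"
proof -
  have "block chi m (lac a) f = 0" for f
  proof (cases "f \<in> schwartz")
    case True
    then have "block chi m (lac a) f = (\<Sum>l. of_real (a l) * pairing (freq l) (\<lambda>\<xi>. ann (2 powi (- m)) \<xi> * inv_fourier f \<xi>))"
      by (subst block_eq, simp, intro hat_lac schwartz_mult ann_schwartz inv_fourier_schwartz) simp_all
    then show ?thesis by (simp add: pairing_ann_far[OF assms(1)])
  qed (rule block_off_schwartz)
  then have "represents (\<lambda>x. 0) (block chi m (lac a))" by (simp add: represents_def)
  from Lnorm_dist_le[OF this, of p] show ?thesis
    unfolding norm_zero ennreal_0 Lnorm_zero[OF assms(2)] by simp
qed

text \<open>The block is \<open>a k\<close> times a dilation by \<open>freq k\<close> of one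
  function \<open>?w\<close> depending on \<open>j\<close> alone. Its L^1 bound scales like the
  power \<open>DIM('a)\<close> of \<open>freq k\<close> and its sup bound not at all; interpolation
  gives the exponent.\<close>

lemma block_lac_near:
  assumes p: "1 \<le> p" and j: "j \<in> {-1, 0, 1 :: int}"
  obtains C where "C > 0" "\<And>a k. Lnorm_dist p (block chi (j - 3 * (int k + 1)) (lac a)) \<le>
    ennreal (C * (\<bar>a k\<bar> * freq k powr (DIM('a) * recip p)))"
proof -
  define z where "z \<xi> = eta \<xi> * ann (2 powi (- j)) \<xi>" for \<xi>
  have z: "z \<in> schwartz" unfolding z_def by (intro schwartz_mult eta ann_schwartz) simp
  let ?w = "inv_fourier z"
  have w: "?w \<in> schwartz" by (rule inv_fourier_schwartz[OF z])
  obtain F0 where F0: "\<And>x. norm (?w x) \<le> F0" "0 \<le> F0" using schwartz_bounded[OF w] by blast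
  define F where "F = F0 + 1"
  define A where "A = (LINT x|lborel. norm (?w x)) + 1"
  have F: "\<And>x. norm (?w x) \<le> F" "0 < F" using F0 by (auto simp: F_def intro: add_increasing2)
  have A: "0 < A" unfolding A_def by (intro add_nonneg_pos integral_nonneg_AE) auto
  let ?C = "A powr recip p * F powr (1 - recip p)"
  show thesis
  proof (rule that)
    show "?C > 0" using A F by simp
    fix a :: "nat \<Rightarrow> real" and k
    define m where "m = j - 3 * (int k + 1)"
    define c where "c = freq k"
    have c: "c > 0" by (simp add: c_def freq_ge)
    have wc: "(\<lambda>x. ?w ((1 / c) *\<^sub>R x)) \<in> schwartz" using c by (intro schwartz_dilate w) simp
    have mj: "m + 3 * (int k + 1) = j" by (simp add: m_def)
    have block: "block chi m (lac a) f = (LINT x|lborel. (of_real (a k) * ?w ((1 / c) *\<^sub>R x)) * f x)" if f: "f \<in> schwartz" for f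
    proof -
      note fh = inv_fourier_schwartz[OF f]
      note [measurable] = schwartz_measurable[OF z] schwartz_measurable[OF fh]
      have "block chi m (lac a) f = of_real (a k) * (LINT \<xi>|lborel. z \<xi> * inv_fourier f ((1 / c) *\<^sub>R \<xi>))"
        unfolding block_eq[OF f] z_def c_def by (rule hat_lac_ann[OF fh, of m k a, unfolded mj, OF j])
      also have "(LINT \<xi>|lborel. z \<xi> * inv_fourier f ((1 / c) *\<^sub>R \<xi>)) =
          (LINT \<xi>|lborel. z (c *\<^sub>R (0 + (1 / c) *\<^sub>R \<xi>)) * inv_fourier f (0 + (1 / c) *\<^sub>R \<xi>))"
        using c by simp
      also have "\<dots> = c ^ DIM('a) *\<^sub>R (LINT \<xi>|lborel. z (c *\<^sub>R \<xi>) * inv_fourier f \<xi>)"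
        using c by (subst integral_affine[where f="\<lambda>\<xi>. z (c *\<^sub>R \<xi>) * inv_fourier f \<xi>"]) (auto simp: power_divide)
      also have "(LINT \<xi>|lborel. z (c *\<^sub>R \<xi>) * inv_fourier f \<xi>) = (LINT x|lborel. inv_fourier (\<lambda>\<xi>. z (c *\<^sub>R \<xi>)) x * f x)"
        using c by (intro inv_fourier_multiplication schwartz_dilate z f) simp
      also have "c ^ DIM('a) *\<^sub>R \<dots> = (LINT x|lborel. ?w ((1 / c) *\<^sub>R x) * f x)"
        unfolding inv_fourier_dilate[OF z c] using c by simp
      finally show ?thesis by (simp add: mult.assoc)
    qed
    have rep: "represents (\<lambda>x. of_real (a k) * ?w ((1 / c) *\<^sub>R x)) (block chi m (lac a))"
      unfolding represents_def using block wc
      by (auto intro!: schwartz_integrable schwartz_mult schwartz_scale schwartz_measurable)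
    show "Lnorm_dist p (block chi (j - 3 * (int k + 1)) (lac a)) \<le> ennreal (?C * (\<bar>a k\<bar> * freq k powr (DIM('a) * recip p)))"
    proof (cases "a k = 0")
      \<comment> \<open>Treated apart because \<open>Lnorm_bounded_integrable\<close> asks for
        strictly positive bounds.\<close>
      case True
      then show ?thesis using Lnorm_dist_le[OF rep, of p] by (simp add: m_def Lnorm_zero[OF p])
    next
      case False
      have "Lnorm_dist p (block chi m (lac a)) \<le> Lnorm p lborel (\<lambda>x. ennreal (norm (of_real (a k) * ?w ((1 / c) *\<^sub>R x))))"
        by (rule Lnorm_dist_le[OF rep])
      also have "\<dots> \<le> ennreal ((\<bar>a k\<bar> * (c ^ DIM('a) * A)) powr recip p * (\<bar>a k\<bar> * F) powr (1 - recip p))"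
      proof (rule Lnorm_bounded_integrable[OF p])
        show "integrable lborel (\<lambda>x. of_real (a k) * ?w ((1 / c) *\<^sub>R x))"
          by (intro schwartz_integrable schwartz_scale wc)
        have "(LINT x|lborel. norm (?w ((1 / c) *\<^sub>R x))) = c ^ DIM('a) * (LINT x|lborel. norm (?w x))"
          using L1_dilate[OF w c] c by (simp add: field_simps)
        also have "\<dots> \<le> c ^ DIM('a) * A" using c by (intro mult_left_mono) (auto simp: A_def)
        finally show "(LINT x|lborel. norm (of_real (a k) * ?w ((1 / c) *\<^sub>R x))) \<le> \<bar>a k\<bar> * (c ^ DIM('a) * A)"
          by (simp add: norm_mult mult_left_mono)
        show "norm (of_real (a k) * ?w ((1 / c) *\<^sub>R x)) \<le> \<bar>a k\<bar> * F" for x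
          using F by (simp add: norm_mult mult_left_mono)
      qed (use False c A F in auto)
      also have "(\<bar>a k\<bar> * (c ^ DIM('a) * A)) powr recip p * (\<bar>a k\<bar> * F) powr (1 - recip p) =
          ?C * (\<bar>a k\<bar> * c powr (DIM('a) * recip p))"
      proof -
        have "\<bar>a k\<bar> powr recip p * \<bar>a k\<bar> powr (1 - recip p) = \<bar>a k\<bar>"
          using False by (simp flip: powr_add)
        moreover have "(c ^ DIM('a)) powr recip p = c powr (DIM('a) * recip p)"
          using c by (simp add: powr_powr flip: powr_realpow)
        moreover have "(\<bar>a k\<bar> * (c ^ DIM('a) * A)) powr recip p * (\<bar>a k\<bar> * F) powr (1 - recip p) =
           (\<bar>a k\<bar> powr recip p * \<bar>a k\<bar> powr (1 - recip p)) * ?C * (c ^ DIM('a)) powr recip p"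
          using c A F by (simp add: powr_mult mult_ac)
        ultimately show ?thesis by simp
      qed
      finally show ?thesis by (simp add: m_def c_def)
    qed
  qed
qed

text \<open>The Besov weight of block \<open>j - 3 * (k + 1)\<close> is
  \<open>freq k powr (- s)\<close> up to \<open>2 powr \<bar>s\<bar>\<close>. The sum of the three
  constants from \<open>block_lac_near\<close> serves every \<open>j\<close>.\<close>

lemma weighted_block_lac:
  assumes p: "1 \<le> p"
  obtains C where "C > 0" "\<And>a k j. j \<in> {-1, 0, 1 :: int} \<Longrightarrow>
    ennreal (2 powr (of_int (j - 3 * (int k + 1)) * s)) * Lnorm_dist p (block chi (j - 3 * (int k + 1)) (lac a))
    \<le> ennreal (C * (\<bar>a k\<bar> * freq k powr (DIM('a) * recip p - s)))"
proof -
  have "\<exists>C>0. \<forall>a k. Lnorm_dist p (block chi (j - 3 * (int k + 1)) (lac a)) \<le>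
    ennreal (C * (\<bar>a k\<bar> * freq k powr (DIM('a) * recip p)))" if "j \<in> {-1, 0, 1 :: int}" for j
    using block_lac_near[OF p that] by metis
  then obtain C1 C2 C3 where C: "C1 > 0" "C2 > 0" "C3 > 0"
    and 1: "\<And>a k. Lnorm_dist p (block chi (-1 - 3 * (int k + 1)) (lac a)) \<le> ennreal (C1 * (\<bar>a k\<bar> * freq k powr (DIM('a) * recip p)))"
    and 2: "\<And>a k. Lnorm_dist p (block chi (0 - 3 * (int k + 1)) (lac a)) \<le> ennreal (C2 * (\<bar>a k\<bar> * freq k powr (DIM('a) * recip p)))"
    and 3: "\<And>a k. Lnorm_dist p (block chi (1 - 3 * (int k + 1)) (lac a)) \<le> ennreal (C3 * (\<bar>a k\<bar> * freq k powr (DIM('a) * recip p)))"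
    by (metis insertI1 insertI2)
  define C where "C = C1 + C2 + C3"
  have le: "Lnorm_dist p (block chi (j - 3 * (int k + 1)) (lac a)) \<le> ennreal (C * (\<bar>a k\<bar> * freq k powr (DIM('a) * recip p)))"
    if "j \<in> {-1, 0, 1}" for j k a
  proof -
    have "ennreal (D * (\<bar>a k\<bar> * freq k powr (DIM('a) * recip p))) \<le> ennreal (C * (\<bar>a k\<bar> * freq k powr (DIM('a) * recip p)))"
      if "D \<in> {C1, C2, C3}" for D
      using that C by (intro ennreal_leI mult_right_mono) (auto simp: C_def)
    with 1[of k a] 2[of k a] 3[of k a] that show ?thesis by (auto intro: order_trans)
  qed
  show thesis
  proof (rule that[of "2 powr \<bar>s\<bar> * C"])
    show "2 powr \<bar>s\<bar> * C > 0" using C by (simp add: C_def)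
    fix a :: "nat \<Rightarrow> real" and k and j :: int assume j: "j \<in> {-1, 0, 1}"
    have "2 powr (of_int (j - 3 * (int k + 1)) * s) = 2 powr (of_int j * s) * freq k powr (- s)"
      unfolding freq_powr by (simp add: powr_powr algebra_simps flip: powr_add)
    also have "\<dots> \<le> 2 powr \<bar>s\<bar> * freq k powr (- s)"
      using j by (intro mult_right_mono powr_mono) auto
    finally have "ennreal (2 powr (of_int (j - 3 * (int k + 1)) * s)) * Lnorm_dist p (block chi (j - 3 * (int k + 1)) (lac a))
      \<le> ennreal (2 powr \<bar>s\<bar> * freq k powr (- s)) * ennreal (C * (\<bar>a k\<bar> * freq k powr (DIM('a) * recip p)))"
      by (intro mult_mono ennreal_leI le j) auto
    also have "\<dots> = ennreal (2 powr \<bar>s\<bar> * C * (\<bar>a k\<bar> * freq k powr (DIM('a) * recip p - s)))"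
      using C by (simp add: C_def powr_diff powr_minus_divide mult_ac flip: ennreal_mult)
    finally show "ennreal (2 powr (of_int (j - 3 * (int k + 1)) * s)) * Lnorm_dist p (block chi (j - 3 * (int k + 1)) (lac a))
      \<le> ennreal (2 powr \<bar>s\<bar> * C * (\<bar>a k\<bar> * freq k powr (DIM('a) * recip p - s)))" .
  qed
qed

text \<open>The factor 3: each frequency \<open>freq k\<close> meets three dyadic blocks.\<close>

lemma besov_norm_lac_finite_r:
  assumes p: "1 \<le> p" and r: "1 \<le> r"
    and le: "\<And>k j. j \<in> {-1, 0, 1 :: int} \<Longrightarrow>
      ennreal (2 powr (of_int (j - 3 * (int k + 1)) * s)) * Lnorm_dist p (block chi (j - 3 * (int k + 1)) (lac a)) \<le> ennreal (b k)"
    and b: "\<And>k. 0 \<le> b k"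
  shows "besov_norm_rep chi s p (ereal r) (lac a) \<le> ennreal_powr (3 * (\<Sum>k. ennreal (b k powr r))) (1 / r)"
proof -
  let ?w = "\<lambda>m::int. ennreal (2 powr (of_int m * s)) * Lnorm_dist p (block chi m (lac a))"
  let ?J = "{-1, 0, 1 :: int}"
  \<comment> \<open>The sequence over \<open>m\<close> is dominated by point masses at the indices
    \<open>j - 3 * (k + 1)\<close>, so the sum over integers becomes a sum over \<open>k\<close> by
    monotone convergence.\<close>
  have "(\<integral>\<^sup>+m. ennreal_powr (?w m) r \<partial>count_space UNIV) \<le>
    (\<integral>\<^sup>+m. (\<Sum>k. \<Sum>j\<in>?J. ennreal (b k powr r) * indicator {j - 3 * (int k + 1)} m) \<partial>count_space UNIV)"
  proof (rule nn_integral_mono)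
    fix m :: int
    show "ennreal_powr (?w m) r \<le> (\<Sum>k. \<Sum>j\<in>?J. ennreal (b k powr r) * indicator {j - 3 * (int k + 1)} m)"
    proof (cases "\<exists>k. m + 3 * (int k + 1) \<in> ?J")
      case True
      then obtain k where k: "m + 3 * (int k + 1) \<in> ?J" by blast
      define j where "j = m + 3 * (int k + 1)"
      have m: "m = j - 3 * (int k + 1)" and j: "j \<in> ?J" using k by (auto simp: j_def)
      have "ennreal_powr (?w m) r \<le> ennreal_powr (ennreal (b k)) r"
        unfolding m using r by (intro ennreal_powr_mono le j) simp
      also have "\<dots> = (\<Sum>j\<in>{j}. ennreal (b k powr r) * indicator {j - 3 * (int k + 1)} m)" using b by (simp add: m)
      also have "\<dots> \<le> (\<Sum>j\<in>?J. ennreal (b k powr r) * indicator {j - 3 * (int k + 1)} m)"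
        using j by (intro sum_mono2) auto
      also have "\<dots> = (\<Sum>k\<in>{k}. \<Sum>j\<in>?J. ennreal (b k powr r) * indicator {j - 3 * (int k + 1)} m)" by simp
      also have "\<dots> \<le> (\<Sum>k. \<Sum>j\<in>?J. ennreal (b k powr r) * indicator {j - 3 * (int k + 1)} m)"
        by (intro sum_le_suminf) auto
      finally show ?thesis .
    next
      case False
      then have "?w m = 0" using block_lac_far[OF _ p, of m a] by simp
      then show ?thesis by simp
    qed
  qed
  also have "\<dots> = (\<Sum>k. \<Sum>j\<in>?J. ennreal (b k powr r))"
  proof -
    have "(\<integral>\<^sup>+m. (\<Sum>j\<in>?J. ennreal (b k powr r) * indicator {j - 3 * (int k + 1)} m) \<partial>count_space UNIV) =
        (\<Sum>j\<in>?J. ennreal (b k powr r))" for k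
    proof -
      have "(\<integral>\<^sup>+m. (\<Sum>j\<in>?J. ennreal (b k powr r) * indicator {j - 3 * (int k + 1)} m) \<partial>count_space UNIV) =
        (\<Sum>j\<in>?J. \<integral>\<^sup>+m. ennreal (b k powr r) * indicator {j - 3 * (int k + 1)} m \<partial>count_space UNIV)"
        by (rule nn_integral_sum) simp
      also have "\<dots> = (\<Sum>j\<in>?J. ennreal (b k powr r))"
        by (intro sum.cong refl) (simp add: nn_integral_cmult_indicator)
      finally show ?thesis .
    qed
    then show ?thesis by (subst nn_integral_suminf) (simp_all only: borel_measurable_count_space)
  qed
  also have "\<dots> = 3 * (\<Sum>k. ennreal (b k powr r))"
  proof -
    have "(\<Sum>j\<in>?J. x) = 3 * x" for x :: ennreal by simp
    then show ?thesis by (simp only: ennreal_suminf_cmult)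
  qed
  finally show ?thesis
    unfolding besov_norm_rep_def Lnorm_ereal using r by (intro ennreal_powr_mono) auto
qed

lemma besov_norm_lac_infinite_r:
  assumes p: "1 \<le> p"
    and le: "\<And>k j. j \<in> {-1, 0, 1 :: int} \<Longrightarrow>
      ennreal (2 powr (of_int (j - 3 * (int k + 1)) * s)) * Lnorm_dist p (block chi (j - 3 * (int k + 1)) (lac a)) \<le> B"
  shows "besov_norm_rep chi s p \<infinity> (lac a) \<le> B"
  unfolding besov_norm_rep_def Lnorm_infinity
proof (rule esssup_I)
  have "ennreal (2 powr (of_int m * s)) * Lnorm_dist p (block chi m (lac a)) \<le> B" for m :: int
  proof (cases "\<exists>k. m + 3 * (int k + 1) \<in> {-1, 0, 1}")
    case True
    then obtain k where k: "m + 3 * (int k + 1) \<in> {-1, 0, 1}" by blast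
    from le[OF this, of k] show ?thesis by simp
  next
    case False
    then show ?thesis using block_lac_far[OF _ p, of m a] by simp
  qed
  then show "AE m in count_space UNIV. ennreal (2 powr (of_int m * s)) * Lnorm_dist p (block chi m (lac a)) \<le> B"
    by simp
qed simp

end

lemma freq_powr_summable: "x < 0 \<Longrightarrow> summable (\<lambda>k. freq k powr x)"
proof -
  assume x: "x < 0"
  have "freq k powr x = (8 powr x) ^ Suc k" for k
  proof -
    have "freq k = 8 powr real (Suc k)" unfolding freq_def by (rule powr_realpow[symmetric]) simp
    then have "freq k powr x = 8 powr (real (Suc k) * x)" by (simp only: powr_powr)
    also have "\<dots> = (8 powr x) ^ Suc k" by (simp add: powr_power mult.commute del: power_Suc of_nat_Suc)
    finally show ?thesis .
  qed
  moreover have "8 powr x < (1::real)" using powr_less_mono[OF x, of 8] by simp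
  then have "summable (\<lambda>k. (8 powr x :: real) ^ Suc k)"
    by (subst summable_Suc_iff) (intro summable_geometric, simp)
  ultimately show ?thesis by simp
qed

lemma freq_mono: "l \<le> k \<Longrightarrow> freq l \<le> freq k"
  unfolding freq_def by (intro power_increasing) auto

lemma freq_less: "l < k \<Longrightarrow> 8 * freq l \<le> freq k"
  using freq_mono[of "Suc l" k] by (simp add: freq_def)

lemma freq_at_top: "filterlim (\<lambda>n. c * freq n) at_top sequentially" if "c \<ge> 1"
proof (rule filterlim_at_top_mono[OF filterlim_real_sequentially])
  have "real n \<le> c * freq n" for n
  proof -
    have "real n \<le> 2 ^ n" using of_nat_less_two_power[of n, where 'a=real] by simp
    also have "\<dots> \<le> 8 ^ n" by (intro power_mono) auto
    also have "\<dots> \<le> freq n" by (simp add: freq_def)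
    also have "1 * freq n \<le> c * freq n" using that freq_ge(2)[of n] by (intro mult_right_mono) auto
    finally show ?thesis by simp
  qed
  then show "\<forall>\<^sub>F n in sequentially. real n \<le> c * freq n" by simp
qed

context lacunary
begin

section \<open>Lacunary distributions and vanishing low frequencies\<close>

lemma eta_cong:
  assumes "\<And>\<xi>. norm \<xi> \<le> 2 \<Longrightarrow> norm \<xi> > 1 / 2 \<Longrightarrow> f \<xi> = g \<xi>"
  shows "eta \<xi> * f \<xi> = eta \<xi> * g \<xi>"
  using assms[of \<xi>] eta_supp[of \<xi>] by (cases "norm \<xi> > 2 \<or> norm \<xi> \<le> 1 / 2") auto

text \<open>The difference of a fixed cutoff and one at scale \<open>?T n\<close> vanishes near the
  origin, so \<open>v\<close> and \<open>lac a\<close> agree on it; on \<open>lac a\<close> it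
  isolates the bumps up to \<open>n\<close>. On \<open>v\<close> the moving term tends to 0.\<close>

lemma partial_sums_converge:
  assumes a: "admissible a" and v: "v \<in> poly_class (lac a)" "v \<in> tempered_h chi"
  shows "convergent (\<lambda>n. (\<Sum>k\<le>n. of_real (a k)) * (LINT \<xi>|lborel. eta \<xi>))"
proof -
  \<comment> \<open>The scale between bumps \<open>n\<close> and \<open>n + 1\<close>: the factor 4
    times the inner radius 1/2 reaches 2, where the cutoff vanishes, and 4 times the outer radius 2
    is 8, so on later bumps the cutoff is still 1.\<close>
  let ?T = "\<lambda>n. 4 * freq n"
  have T: "?T n > 0" for n using freq_ge(2)[of n] by simp
  \<comment> \<open>Both terms are cutoffs of the test function \<open>low 1\<close>; the second
    thus has the shape required by \<open>tempered_h_hat\<close>.\<close>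
  let ?s = "\<lambda>n \<xi>. low 1 \<xi> * low 1 \<xi> - low (?T n) \<xi> * low 1 \<xi>"
  have "?T n \<noteq> 0" for n using T[of n] by simp
  then have lowT: "low (?T n) \<in> schwartz" for n by (rule low_schwartz)
  have low1: "low 1 \<in> schwartz" by (rule low_schwartz[OF one_neq_zero])
  note low = low1 lowT
  have vt: "v \<in> tempered" using v(1) by (simp add: poly_class_def)
  have s0: "?s n \<in> schwartz0" for n
  proof -
    have "?s n \<xi> = 0" if "\<xi> \<in> ball 0 (1 / ?T n)" for \<xi>
    proof -
      have "?T n * norm \<xi> \<le> 1" using that T[of n] by (simp add: field_simps)
      moreover have "1 * norm \<xi> \<le> ?T n * norm \<xi>" using freq_ge(1)[of n] by (intro mult_right_mono) auto
      ultimately show ?thesis using low_eq_1[of "?T n" \<xi>] low_eq_1[of 1 \<xi>] T[of n] by simp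
    qed
    moreover have "1 / ?T n > 0" using T[of n] by simp
    moreover have "?s n \<in> schwartz" by (intro schwartz_diff schwartz_mult low)
    ultimately show ?thesis unfolding schwartz0_def by blast
  qed
  have pair: "pairing (freq k) (?s n) = (if k \<le> n then LINT \<xi>|lborel. eta \<xi> else 0)" for k n
  proof -
    have eq: "eta \<xi> * ?s n ((1 / freq k) *\<^sub>R \<xi>) = eta \<xi> * (if k \<le> n then 1 else 0)" for \<xi>
    proof (rule eta_cong)
      fix \<xi> :: 'a assume x: "norm \<xi> \<le> 2" "norm \<xi> > 1 / 2"
      have 1: "low 1 ((1 / freq k) *\<^sub>R \<xi>) = 1"
        using x freq_ge(1,2)[of k] by (intro low_eq_1) (auto simp: field_simps)
      have 2: "low (?T n) ((1 / freq k) *\<^sub>R \<xi>) = (if k \<le> n then 0 else 1)"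
      proof (cases "k \<le> n")
        case True
        have "4 * freq k * norm \<xi> \<le> ?T n * norm \<xi>"
          using freq_mono[OF True] by (intro mult_right_mono) auto
        moreover have "4 * freq k * norm \<xi> > 2 * freq k" using x freq_ge(2)[of k] by simp
        ultimately have "?T n * norm \<xi> > 2 * freq k" by linarith
        then show ?thesis using True T[of n] freq_ge(2)[of k] by (subst low_eq_0) (auto simp: field_simps)
      next
        case False
        have "?T n * norm \<xi> \<le> ?T n * 2" using x T[of n] by (intro mult_left_mono) auto
        also have "\<dots> \<le> freq k" using freq_less[of n k] False by simp
        finally show ?thesis using False T[of n] freq_ge(2)[of k] by (subst low_eq_1) (auto simp: field_simps)
      qed
      show "?s n ((1 / freq k) *\<^sub>R \<xi>) = (if k \<le> n then 1 else 0)" unfolding 1 2 by simp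
    qed
    show ?thesis unfolding pairing_at_0[of "?s n" "freq k", OF schwartz0_at_0[OF s0]] eq by simp
  qed
  have "hat v (\<lambda>\<xi>. low 1 \<xi> * low 1 \<xi>) - hat v (\<lambda>\<xi>. low (?T n) \<xi> * low 1 \<xi>) =
      (\<Sum>k\<le>n. of_real (a k)) * (LINT \<xi>|lborel. eta \<xi>)" for n
  proof -
    have "hat v (\<lambda>\<xi>. low 1 \<xi> * low 1 \<xi>) - hat v (\<lambda>\<xi>. low (?T n) \<xi> * low 1 \<xi>) = hat v (?s n)"
      by (rule hat_minus[symmetric]) (intro vt schwartz_mult low)+
    also have "\<dots> = hat (lac a) (?s n)"
      by (rule hat_eq_schwartz0[OF poly_class_mod_poly[OF lac_tempered[OF a]] v(1) poly_class_self[OF lac_tempered[OF a]] s0])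
    also have "\<dots> = (\<Sum>k. of_real (a k) * pairing (freq k) (?s n))"
      by (rule hat_lac[OF schwartz0_schwartz[OF s0]])
    also have "\<dots> = (\<Sum>k\<le>n. of_real (a k) * pairing (freq k) (?s n))"
      unfolding pair by (rule suminf_finite) auto
    also have "\<dots> = (\<Sum>k\<le>n. of_real (a k)) * (LINT \<xi>|lborel. eta \<xi>)"
      unfolding sum_distrib_right pair by (intro sum.cong refl) simp
    finally show ?thesis .
  qed
  moreover have "(\<lambda>n. hat v (\<lambda>\<xi>. low (?T n) \<xi> * low 1 \<xi>)) \<longlonglongrightarrow> 0"
    by (rule filterlim_compose[OF tempered_h_hat[OF v(2) low(1)] freq_at_top]) simp
  then have "convergent (\<lambda>n. hat v (\<lambda>\<xi>. low 1 \<xi> * low 1 \<xi>) - hat v (\<lambda>\<xi>. low (?T n) \<xi> * low 1 \<xi>))"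
    by (intro convergent_diff convergent_const convergentI)
  ultimately show ?thesis by simp
qed

text \<open>For finite sums, dropping the Dirac mass at the origin, that is, changing the representative by
  a constant, leaves a spectrum away from the origin.\<close>

lemma finite_lac_tempered_h:
  assumes a: "admissible a" and n: "\<And>k. k \<ge> n \<Longrightarrow> a k = 0"
  shows "\<exists>v\<in>poly_class (lac a). v \<in> tempered_h chi"
proof -
  let ?e = "LINT \<xi>|lborel. eta \<xi>"
  \<comment> \<open>This collects the subtracted values at the origin: once the cutoff kills the
    first \<open>n\<close> bumps, nothing else of the finite sum remains.\<close>
  define \<gamma> where "\<gamma> = - (\<Sum>k<n. of_real (a k) * ?e)"
  define q :: "'a functional" where "q f = (if f \<in> schwartz then \<gamma> * inv_fourier f 0 else 0)" for f
  have q: "q \<in> tempered"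
  proof -
    obtain D i where D: "D \<ge> 0" "\<And>f :: 'a \<Rightarrow> complex. f \<in> schwartz \<Longrightarrow> schwartz_seminorm 0 (inv_fourier f) \<le> D * schwartz_seminorm i f"
      using schwartz_cont_seminorm[OF schwartz_cont_inv_fourier] by blast
    show ?thesis
    proof (rule temperedI[where C = "norm \<gamma> * D" and k = i])
      fix f :: "'a \<Rightarrow> complex" assume f: "f \<in> schwartz"
      have "norm (inv_fourier f 0) \<le> D * schwartz_seminorm i f"
        using seminorm_ge0[OF inv_fourier_schwartz[OF f], of 0 0 0] D(2)[OF f] by simp
      then show "norm (q f) \<le> norm \<gamma> * D * schwartz_seminorm i f"
        using f by (simp add: q_def norm_mult mult_left_mono mult.assoc)
    qed (simp_all add: q_def schwartz_lincomb inv_fourier_schwartz_lincomb algebra_simps)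
  qed
  have "represents (\<lambda>x. \<gamma> / of_real ((2 * pi) ^ DIM('a))) q"
    unfolding represents_def by (auto simp: q_def inv_fourier_def schwartz_integrable)
  then have qp: "q \<in> poly_dist"
    unfolding poly_dist_def using q polynomial_function_const by blast
  define v where "v = tempered_diff (lac a) q"
  have vt: "v \<in> tempered" unfolding v_def by (intro tempered_diff_tempered lac_tempered a q)
  have "tempered_diff (lac a) v = q" by (simp add: v_def tempered_diff_def fun_eq_iff)
  with qp vt have "v \<in> poly_class (lac a)" by (simp add: poly_class_def)
  moreover have "v \<in> tempered_h chi"
  proof (rule tempered_hI[OF vt, of "4 * freq n"])
    fix f :: "'a \<Rightarrow> complex" and t assume f: "f \<in> schwartz" and t: "t \<ge> 4 * freq n"
    have t0: "t > 0" using t freq_ge(2)[of n] by linarith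
    let ?g = "\<lambda>\<xi>. low t \<xi> * f \<xi>"
    have g: "?g \<in> schwartz" using t0 by (intro schwartz_mult low_schwartz f) simp
    have g0: "?g 0 = f 0" using chi_eq_1[of 0] by simp
    have pair: "pairing (freq k) ?g = - ?e * f 0" if k: "k < n" for k
    proof -
      have eq: "eta \<xi> * ?g ((1 / freq k) *\<^sub>R \<xi>) = eta \<xi> * 0" for \<xi>
      proof (rule eta_cong)
        fix \<xi> :: 'a assume x: "norm \<xi> \<le> 2" "norm \<xi> > 1 / 2"
        have "4 * freq k \<le> t" using freq_mono[of k n] k t by simp
        then have "4 * freq k * norm \<xi> \<le> t * norm \<xi>" by (intro mult_right_mono) auto
        moreover have "4 * freq k * norm \<xi> > 2 * freq k" using x freq_ge(2)[of k] by simp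
        ultimately have "t * norm \<xi> > 2 * freq k" by linarith
        then have "low t ((1 / freq k) *\<^sub>R \<xi>) = 0"
          using t0 freq_ge(2)[of k] by (intro low_eq_0) (auto simp: field_simps)
        then show "?g ((1 / freq k) *\<^sub>R \<xi>) = 0" by (simp only: mult_zero_left)
      qed
      show ?thesis unfolding pairing_split[OF g freq_ge(2)] eq g0 by simp
    qed
    have "hat (lac a) ?g = (\<Sum>k<n. of_real (a k) * pairing (freq k) ?g)"
      unfolding hat_lac[OF g] using n by (intro suminf_finite) auto
    also have "\<dots> = \<gamma> * f 0"
      by (simp add: pair \<gamma>_def sum_distrib_right sum_negf mult.assoc)
    finally have "hat (lac a) ?g = \<gamma> * f 0" .
    moreover have "hat q ?g = \<gamma> * f 0"
      unfolding hat_def q_def using g g0 by (simp add: fourier_schwartz inv_fourier_fourier del: of_real_mult)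
    ultimately show "hat v ?g = 0" unfolding v_def hat_diff by simp
  qed
  ultimately show ?thesis by blast
qed

text \<open>One modulus \<open>e\<close> serves the limit, its truncations and their differences.
  For \<open>r = \<infinity>\<close> it is the size of the first remaining term. For finite
  \<open>r\<close> it comes from the tail of a series that converges by \<open>r > 1\<close>, or, at
  \<open>r = 1\<close>, by the geometric factor with \<open>DIM('a) * recip p < s\<close>.\<close>

lemma besov_norm_lac_harmonic:
  assumes p: "1 \<le> p" and r: "1 \<le> r" and s: "DIM('a) * recip p < s \<or> DIM('a) * recip p = s \<and> 1 < r"
  obtains e :: "nat \<Rightarrow> real" where "\<And>\<epsilon>. \<epsilon> > 0 \<Longrightarrow> \<exists>n. e n < \<epsilon>"
    "\<And>a n. (\<And>k. k < n \<Longrightarrow> a k = 0) \<Longrightarrow> (\<And>k. \<bar>a k\<bar> \<le> 1 / (real k + 1)) \<Longrightarrow>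
      besov_norm_rep chi s p r (lac a) \<le> ennreal (e n)"
proof -
  let ?D = "DIM('a) * recip p"
  obtain C where C: "C > 0" "\<And>a k j. j \<in> {-1, 0, 1 :: int} \<Longrightarrow>
    ennreal (2 powr (of_int (j - 3 * (int k + 1)) * s)) * Lnorm_dist p (block chi (j - 3 * (int k + 1)) (lac a))
    \<le> ennreal (C * (\<bar>a k\<bar> * freq k powr (?D - s)))"
    using weighted_block_lac[OF p] by metis
  define b where "b k = C * (1 / (real k + 1) * freq k powr (?D - s))" for k
  have b0: "0 \<le> b k" for k using C(1) by (simp add: b_def)
  have fle: "freq k powr (?D - s) \<le> 1" for k
    using powr_mono[of "?D - s" 0 "freq k"] s freq_ge(2,3)[of k] by auto
  have ble: "b k \<le> C * (1 / (real k + 1))" for k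
    unfolding b_def using C(1) fle by (intro mult_left_mono mult_left_le) auto
  have le: "ennreal (2 powr (of_int (j - 3 * (int k + 1)) * s)) * Lnorm_dist p (block chi (j - 3 * (int k + 1)) (lac a))
    \<le> ennreal (if k < n then 0 else b k)"
    if "j \<in> {-1, 0, 1 :: int}" "\<And>k. k < n \<Longrightarrow> a k = 0" "\<And>k. \<bar>a k\<bar> \<le> 1 / (real k + 1)" for j k a n
  proof -
    have "C * (\<bar>a k\<bar> * freq k powr (?D - s)) \<le> (if k < n then 0 else b k)"
    proof (cases "k < n")
      case False
      have "\<bar>a k\<bar> * freq k powr (?D - s) \<le> 1 / (real k + 1) * freq k powr (?D - s)"
        by (intro mult_right_mono that(3)) simp
      then show ?thesis using False C(1) unfolding b_def by (simp only: if_False mult_left_mono less_imp_le)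
    qed (simp add: that(2))
    then show ?thesis using C(2)[OF that(1), of k a] by (meson ennreal_leI order_trans)
  qed
  show thesis
  proof (cases rule: exponent_cases[OF r])
    case 1
    show thesis
    proof (rule that[of "\<lambda>n. C / (real n + 1)"])
      fix \<epsilon> :: real assume "\<epsilon> > 0"
      obtain n where "C / \<epsilon> < real n" using reals_Archimedean2 by blast
      then have "C < \<epsilon> * (real n + 1)" using \<open>\<epsilon> > 0\<close> by (simp add: field_simps)
      then show "\<exists>n. C / (real n + 1) < \<epsilon>" by (intro exI[of _ n]) (simp add: field_simps add_nonneg_pos)
    next
      fix a n assume a: "\<And>k. k < n \<Longrightarrow> a k = 0" "\<And>k. \<bar>a k\<bar> \<le> 1 / (real k + 1)"
      have "ennreal (if k < n then 0 else b k) \<le> ennreal (C / (real n + 1))" for k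
      proof (cases "k < n")
        case False
        have "b k \<le> C * (1 / (real k + 1))" by (rule ble)
        also have "\<dots> \<le> C * (1 / (real n + 1))" using C(1) False by (intro mult_left_mono divide_left_mono) auto
        finally show ?thesis using False by (simp add: ennreal_leI)
      qed simp
      then show "besov_norm_rep chi s p r (lac a) \<le> ennreal (C / (real n + 1))"
        unfolding 1(1) by (intro besov_norm_lac_infinite_r[OF p] order_trans[OF le[OF _ a]])
    qed
  next
    case (2 q)
    let ?f = "\<lambda>k. b k powr q"
    have sum: "summable ?f"
    proof (cases "q > 1")
      case True
      have "summable (\<lambda>k. real k powr (- q))" using True by (simp add: summable_real_powr_iff)
      then have "summable (\<lambda>k. real (Suc k) powr (- q))" by (subst summable_Suc_iff)
      then have "summable (\<lambda>k. C powr q * (real (Suc k) powr (- q)))" by (rule summable_mult)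
      moreover have le: "norm (?f k) \<le> C powr q * (real (Suc k) powr (- q))" for k
      proof -
        have "?f k \<le> (C * (1 / (real k + 1))) powr q" using ble b0 True by (intro powr_mono2) auto
        also have "\<dots> = C powr q * (real (Suc k) powr (- q))"
          using C(1) by (simp add: powr_divide powr_minus_divide add.commute)
        finally show ?thesis by simp
      qed
      ultimately show ?thesis by (intro summable_comparison_test'[OF _ le])
    next
      case False
      then have q: "q = 1" and D: "?D < s" using 2 s by (auto simp: one_ereal_def)
      have "summable (\<lambda>k. C * freq k powr (?D - s))" using D by (intro summable_mult freq_powr_summable) simp
      moreover have le: "norm (?f k) \<le> C * freq k powr (?D - s)" for k
      proof -
        have "b k \<le> C * (1 * freq k powr (?D - s))"
          unfolding b_def using C(1) by (intro mult_left_mono mult_right_mono) auto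
        then show ?thesis using b0[of k] by (simp add: q)
      qed
      ultimately show ?thesis by (intro summable_comparison_test'[OF _ le])
    qed
    let ?S = "\<lambda>n. \<Sum>k. ?f (k + n)"
    have S0: "0 \<le> ?S n" for n by (intro suminf_nonneg summable_ignore_initial_segment sum) auto
    show thesis
    proof (rule that[of "\<lambda>n. (3 * ?S n) powr (1 / q)"])
      fix \<epsilon> :: real assume e: "\<epsilon> > 0"
      obtain N where "\<And>n. n \<ge> N \<Longrightarrow> norm (?S n) < \<epsilon> powr q / 3"
        using suminf_exist_split[OF _ sum, of "\<epsilon> powr q / 3"] e by auto
      from this[of N] have "3 * ?S N < \<epsilon> powr q" by simp
      then have "(3 * ?S N) powr (1 / q) < (\<epsilon> powr q) powr (1 / q)"
        using S0[of N] 2 by (intro powr_less_mono2) auto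
      also have "\<dots> = \<epsilon>" using 2 e by (simp add: powr_powr)
      finally show "\<exists>n. (3 * ?S n) powr (1 / q) < \<epsilon>" by blast
    next
      fix a n assume a: "\<And>k. k < n \<Longrightarrow> a k = 0" "\<And>k. \<bar>a k\<bar> \<le> 1 / (real k + 1)"
      let ?g = "\<lambda>k. (if k < n then 0 else b k) powr q"
      have gs: "summable ?g"
        by (rule summable_comparison_test'[OF sum, of 0]) (auto simp: b0)
      have gS: "(\<Sum>k. ?g k) = ?S n"
        using suminf_split_initial_segment[OF gs, of n] by simp
      have "besov_norm_rep chi s p r (lac a) \<le> ennreal_powr (3 * (\<Sum>k. ennreal (?g k))) (1 / q)"
        unfolding 2(1) using 2(2) b0 by (intro besov_norm_lac_finite_r[OF p] le[OF _ a]) auto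
      also have "(\<Sum>k. ennreal (?g k)) = ennreal (?S n)"
        unfolding gS[symmetric] by (rule suminf_ennreal2) (auto simp: gs)
      also have "3 * ennreal (?S n) = ennreal (3 * ?S n)" using S0[of n] by (simp add: ennreal_mult)
      also have "ennreal_powr (ennreal (3 * ?S n)) (1 / q) = ennreal ((3 * ?S n) powr (1 / q))"
        using S0[of n] by simp
      finally show "besov_norm_rep chi s p r (lac a) \<le> ennreal ((3 * ?S n) powr (1 / q))" .
    qed
  qed
qed

end

subsection \<open>Bumps in the annulus\<close>

text \<open>If the integral of the square vanished, \<open>g\<close> would be zero almost
  everywhere; by continuity \<open>g\<close> differs from zero on a non-empty open set, which is not
  negligible.\<close>

lemma integral_real_square_nonzero:
  fixes g :: "'a::euclidean_space \<Rightarrow> real"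
  assumes g: "(\<lambda>x. complex_of_real (g x)) \<in> schwartz" and x: "g x \<noteq> 0"
  shows "(LINT x|lborel. complex_of_real (g x) * complex_of_real (g x)) \<noteq> 0"
proof
  assume "(LINT x|lborel. complex_of_real (g x) * complex_of_real (g x)) = 0"
  then have "(LINT x|lborel. complex_of_real ((g x)\<^sup>2)) = 0" by (simp add: power2_eq_square)
  then have 0: "(LINT x|lborel. (g x)\<^sup>2) = 0" by (simp only: integral_complex_of_real of_real_eq_0_iff)
  have "integrable lborel (\<lambda>x. complex_of_real ((g x)\<^sup>2))"
    using schwartz_integrable[OF schwartz_mult[OF g g]] by (simp add: power2_eq_square)
  then have "integrable lborel (\<lambda>x. (g x)\<^sup>2)" by (simp only: complex_of_real_integrable_eq)
  then have "AE x in lborel. (g x)\<^sup>2 = 0"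
    using 0 by (subst (asm) integral_nonneg_eq_0_iff_AE) auto
  then have AE: "AE x in lborel. g x = 0" by simp
  have cont: "continuous_on UNIV g"
  proof -
    have "continuous_on UNIV (\<lambda>x. Re (complex_of_real (g x)))"
      by (intro continuous_intros schwartz_continuous[OF g])
    then show ?thesis by simp
  qed
  have op: "open {x. g x \<noteq> 0}"
    using open_Collect_neq[OF cont continuous_on_const, of 0] by simp
  have "{x. g x \<noteq> 0} \<in> null_sets lborel"
    using AE op by (subst AE_iff_null_sets) auto
  then have "negligible {x. g x \<noteq> 0}"
    unfolding negligible_iff_null_sets by (rule null_sets_completionI)
  then show False using open_not_negligible[OF op] x by auto
qed

text \<open>Such an \<open>f\<close> is constant along every line in direction \<open>b\<close>, yet
  decays along it.\<close>

lemma pd_eq_0_imp: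
  assumes f: "f \<in> schwartz" and b: "b \<in> Basis" and 0: "\<And>x. pd b f x = 0"
  shows "f x = 0"
proof (rule ccontr)
  assume nz: "f x \<noteq> 0"
  have "((\<lambda>t. f (x + t *\<^sub>R b)) has_derivative (\<lambda>h. 0)) (at t)" for t
  proof -
    have 1: "((\<lambda>t. x + t *\<^sub>R b) has_derivative (\<lambda>h. h *\<^sub>R b)) (at t)"
      by (auto intro!: derivative_eq_intros)
    have 2: "(f has_derivative (\<lambda>h. pd h f (x + t *\<^sub>R b))) (at (x + t *\<^sub>R b))"
      by (rule has_derivative_pd[OF schwartz_differentiable[OF f]])
    show ?thesis
      using has_derivative_compose[OF 1 2] linear_scale[OF has_derivative_linear[OF 2]] by (simp add: 0)
  qed
  then have const: "f (x + t *\<^sub>R b) = f (x + 0 *\<^sub>R b)" for t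
    by (intro has_derivative_zero_unique[of UNIV "\<lambda>t. f (x + t *\<^sub>R b)" t 0]) (auto intro: has_derivative_at_withinI)
  obtain C where C: "\<And>y. (1 + norm y) ^ 1 * norm (f y) \<le> C" using schwartz_bound[OF f] by blast
  \<comment> \<open>Far enough out that the weight times the constant value
    \<open>norm (f x)\<close> exceeds the bound \<open>C\<close>.\<close>
  define t where "t = norm x + \<bar>C\<bar> / norm (f x)"
  have "t \<le> norm (x + t *\<^sub>R b) + norm x"
    using norm_triangle_ineq4[of "x + t *\<^sub>R b" x] b by (simp add: t_def)
  then have "\<bar>C\<bar> / norm (f x) < 1 + norm (x + t *\<^sub>R b)" by (simp add: t_def)
  then have "\<bar>C\<bar> < (1 + norm (x + t *\<^sub>R b)) ^ 1 * norm (f (x + t *\<^sub>R b))"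
    using nz by (simp add: const pos_divide_less_eq)
  with C[of "x + t *\<^sub>R b"] show False by linarith
qed

lemma iter_deriv_eq_0_imp:
  assumes "f \<in> schwartz" "b \<in> Basis" "\<And>x. iter_deriv (replicate k b) f x = 0"
  shows "f x = 0"
  using assms(3)
proof (induction k arbitrary: x)
  case (Suc k)
  have "iter_deriv (replicate k b) f x = 0" for x
  proof (rule pd_eq_0_imp[where f = "iter_deriv (replicate k b) f"])
    show "iter_deriv (replicate k b) f \<in> schwartz" using assms by (intro schwartz_iter_deriv) auto
    show "pd b (iter_deriv (replicate k b) f) x = 0" for x
      using Suc.prems[of x] by (simp only: replicate_Suc iter_deriv_Cons)
  qed (rule assms)
  then show ?case by (rule Suc.IH)
qed simp

lemma integral_iter_deriv:
  assumes f: "f \<in> schwartz" and h: "h \<in> schwartz" and b: "b \<in> Basis"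
  shows "(LINT x|lborel. iter_deriv (replicate k b) f x * h x) =
    (- 1) ^ k * (LINT x|lborel. f x * iter_deriv (replicate k b) h x)"
  using h
proof (induction k arbitrary: h)
  case (Suc k)
  have g: "iter_deriv (replicate k b) f \<in> schwartz" using f b by (intro schwartz_iter_deriv) auto
  have "(LINT x|lborel. iter_deriv (replicate (Suc k) b) f x * h x) =
      (LINT x|lborel. h x * pd b (iter_deriv (replicate k b) f) x)"
    by (simp only: replicate_Suc iter_deriv_Cons mult.commute)
  also have "\<dots> = - (LINT x|lborel. iter_deriv (replicate k b) f x * pd b h x)"
    using integral_by_parts[OF g schwartz_imp_slow[OF Suc.prems] b] by (simp only: mult.commute)
  also have "\<dots> = (- 1) ^ Suc k * (LINT x|lborel. f x * iter_deriv (replicate k b) (pd b h) x)"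
    using Suc.IH[OF schwartz_pd[OF Suc.prems b]] by simp
  also have "iter_deriv (replicate k b) (pd b h) = iter_deriv (replicate (Suc k) b) h"
    by (simp only: iter_deriv_snoc[symmetric] replicate_append_same replicate_Suc)
  finally show ?case .
qed simp

lemma schwartz_lipschitz:
  fixes h :: "'a::euclidean_space \<Rightarrow> complex"
  assumes h: "h \<in> schwartz"
  shows "norm (h x - h 0) \<le> (real DIM('a) * schwartz_seminorm 1 h) * norm x"
proof -
  have "norm (h x - h 0) \<le> (real DIM('a) * schwartz_seminorm 1 h) * norm (x - 0)"
  proof (rule differentiable_bound[OF convex_UNIV])
    fix y
    have d: "(h has_derivative (\<lambda>v. pd v h y)) (at y)"
      by (rule has_derivative_pd[OF schwartz_differentiable[OF h]])
    then show "(h has_derivative (\<lambda>v. pd v h y)) (at y within UNIV)" by simp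
    note lin = has_derivative_linear[OF d]
    have "norm (pd v h y) \<le> (real DIM('a) * schwartz_seminorm 1 h) * norm v" for v
    proof -
      have "pd v h y = pd (\<Sum>b\<in>Basis. (v \<bullet> b) *\<^sub>R b) h y" by (simp add: euclidean_representation)
      also have "\<dots> = (\<Sum>b\<in>Basis. (v \<bullet> b) *\<^sub>R pd b h y)"
        by (simp only: linear_sum[OF lin] linear_scale[OF lin])
      also have "norm \<dots> \<le> (\<Sum>b\<in>(Basis::'a set). norm v * schwartz_seminorm 1 h)"
      proof (rule order_trans[OF norm_sum], rule sum_mono)
        fix b :: 'a assume b: "b \<in> Basis"
        have "norm (pd b h y) \<le> schwartz_seminorm 1 h"
          using seminorm_ge[OF h, of "[b]" 1 0 y] b by (simp add: pd_def)
        then show "norm ((v \<bullet> b) *\<^sub>R pd b h y) \<le> norm v * schwartz_seminorm 1 h"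
          unfolding norm_scaleR real_norm_def using Basis_le_norm[OF b, of v] by (intro mult_mono) auto
      qed
      finally show ?thesis by (simp add: mult_ac)
    qed
    then show "onorm (\<lambda>v. pd v h y) \<le> real DIM('a) * schwartz_seminorm 1 h" by (rule onorm_le)
  qed auto
  then show ?thesis by simp
qed

context littlewood_paley
begin

text \<open>Since \<open>chi\<close> is 1 on a neighbourhood of the closed unit ball, just outside
  the unit sphere \<open>chi\<close> is still 1 while the doubled argument has norm above 2.\<close>

lemma dyadic_nonzero: "\<exists>\<xi>. dyadic chi \<xi> \<noteq> 0"
proof -
  obtain U where U: "open U" "cball 0 1 \<subseteq> U" "\<And>x. x \<in> U \<Longrightarrow> chi x = 1" using chi_eq_1_nhd by blast
  obtain b :: 'a where b: "b \<in> Basis" using nonempty_Basis by blast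
  then have "b \<in> U" using U(2) by auto
  then obtain e where e: "e > 0" "ball b e \<subseteq> U" using U(1) open_contains_ball by blast
  define x where "x = (1 + e / 2) *\<^sub>R b"
  have "b - x = (- (e / 2)) *\<^sub>R b" by (simp add: x_def algebra_simps)
  then have "dist b x < e" using b e(1) unfolding dist_norm by (simp only: norm_scaleR norm_Basis)
  then have "chi x = 1" using U(3) e(2) by auto
  moreover have "norm (2 *\<^sub>R x) > 2" using b e(1) by (simp add: x_def)
  then have "chi (2 *\<^sub>R x) = 0" by (rule chi_eq_0)
  ultimately show ?thesis by (intro exI[of _ x]) (simp add: dyadic_def)
qed

text \<open>Derivatives need vanishing on an open set. The sphere of radius 1/2 is covered because
  \<open>chi\<close> equals 1 beyond the closed unit ball.\<close>

lemma iter_deriv_ann_eq_0: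
  assumes "norm \<xi> > 2 \<or> norm \<xi> \<le> 1 / 2" shows "iter_deriv vs (ann 1) \<xi> = 0"
proof -
  obtain U where U: "open U" "cball 0 1 \<subseteq> U" "\<And>x. x \<in> U \<Longrightarrow> chi x = 1" using chi_eq_1_nhd by blast
  have "open ((\<lambda>x :: 'a. 2 *\<^sub>R x) -` U)" by (intro open_vimage U continuous_intros)
  then have o1: "open (U \<inter> (\<lambda>x. 2 *\<^sub>R x) -` U)" using U(1) by blast
  have o2: "open (- cball (0 :: 'a) 2)" by auto
  show ?thesis
  proof (cases "norm \<xi> > 2")
    case True
    show ?thesis
      by (rule iter_deriv_zero_on_open[OF o2]) (use True ann_eq_0[of 1] in auto)
  next
    case False
    with assms have "\<xi> \<in> cball 0 1" "2 *\<^sub>R \<xi> \<in> cball 0 1" by auto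
    then have "\<xi> \<in> U \<inter> (\<lambda>x. 2 *\<^sub>R x) -` U" using U(2) by blast
    then show ?thesis
      by (intro iter_deriv_zero_on_open[OF o1]) (use U(3) in \<open>auto simp: dyadic_def\<close>)
  qed
qed

text \<open>The profile for (i). Squaring makes it non-negative, which yields the non-zero mean. Its
  decay of order one is the Lipschitz bound for \<open>h\<close> on the support, of radius at most
  \<open>2 / c\<close> after rescaling.\<close>

lemma lacunary_square: "lacunary chi (\<lambda>\<xi>. ann 1 \<xi> * ann 1 \<xi>) 1"
proof unfold_locales
  let ?eta = "\<lambda>\<xi>. ann 1 \<xi> * ann 1 \<xi>"
  show eta: "?eta \<in> schwartz" by (intro schwartz_mult ann_schwartz) auto
  show zero: "?eta \<xi> = 0" if "norm \<xi> > 2 \<or> norm \<xi> \<le> 1 / 2" for \<xi>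
    using ann_eq_0[of 1 \<xi>] that by simp
  let ?I = "LINT \<xi>|lborel. norm (?eta \<xi>)"
  have "norm (LINT \<xi>|lborel. ?eta \<xi> * (h ((1 / c) *\<^sub>R \<xi>) - h 0)) \<le> (?I * (2 * real DIM('a))) * c powr - 1 * schwartz_seminorm 1 h"
    if h: "h \<in> schwartz" and c: "1 \<le> c" for h c
  proof -
    let ?B = "2 * real DIM('a) * c powr - 1 * schwartz_seminorm 1 h"
    have ii: "integrable lborel (\<lambda>\<xi>. ?eta \<xi> * (h ((1 / c) *\<^sub>R \<xi>) - h 0))"
      unfolding right_diff_distrib using c
      by (intro Bochner_Integration.integrable_diff integrable_mult_left schwartz_integrable[OF eta]
          schwartz_integrable schwartz_mult[OF eta] schwartz_dilate h) auto
    have le: "norm (?eta \<xi> * (h ((1 / c) *\<^sub>R \<xi>) - h 0)) \<le> norm (?eta \<xi>) * ?B" for \<xi>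
    proof (cases "norm \<xi> \<le> 2")
      case True
      have "norm (h ((1 / c) *\<^sub>R \<xi>) - h 0) \<le> (real DIM('a) * schwartz_seminorm 1 h) * norm ((1 / c) *\<^sub>R \<xi>)"
        by (rule schwartz_lipschitz[OF h])
      also have "\<dots> \<le> (real DIM('a) * schwartz_seminorm 1 h) * (2 / c)"
        using True c seminorm_nonneg[OF h] by (intro mult_left_mono) (auto simp: divide_right_mono)
      also have "\<dots> = ?B" using c by (simp add: powr_minus_divide)
      finally have "norm (h ((1 / c) *\<^sub>R \<xi>) - h 0) \<le> ?B" .
      then show ?thesis unfolding norm_mult[of "?eta \<xi>"] by (rule mult_left_mono) simp
    next
      case False
      then have "?eta \<xi> = 0" using zero[of \<xi>] by simp
      then show ?thesis by simp
    qed
    have "norm (LINT \<xi>|lborel. ?eta \<xi> * (h ((1 / c) *\<^sub>R \<xi>) - h 0)) \<le> (LINT \<xi>|lborel. norm (?eta \<xi>) * ?B)"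
      by (rule order_trans[OF integral_norm_bound], rule integral_mono)
        (intro integrable_norm ii integrable_mult_left schwartz_integrable[OF eta] le)+
    also have "\<dots> = ?I * ?B" by (rule integral_mult_left_zero)
    finally show ?thesis by (simp add: mult_ac)
  qed
  moreover have "0 \<le> ?I * (2 * real DIM('a))" by (intro mult_nonneg_nonneg integral_nonneg_AE) auto
  ultimately show "\<exists>C\<ge>0. \<exists>j. \<forall>h\<in>schwartz. \<forall>c\<ge>1.
      norm (LINT \<xi>|lborel. ?eta \<xi> * (h ((1 / c) *\<^sub>R \<xi>) - h 0)) \<le> C * c powr - 1 * schwartz_seminorm j h"
    by blast
qed

lemma square_integral_nonzero: "(LINT \<xi>|lborel. ann 1 \<xi> * ann 1 \<xi>) \<noteq> 0"
proof -
  obtain \<xi> where "dyadic chi \<xi> \<noteq> 0" using dyadic_nonzero by blast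
  then show ?thesis using integral_real_square_nonzero[of "\<lambda>\<xi>. dyadic chi (1 *\<^sub>R \<xi>)"] ann_schwartz[of 1] by auto
qed

text \<open>A derivative of order \<open>k\<close> in frequency gains the factor \<open>c ^ - k\<close> when integrated by parts,
  so that the lacunary series converges for coefficients of arbitrary polynomial growth.\<close>

lemma lacunary_deriv:
  assumes b: "b \<in> Basis" and k: "k \<ge> 1"
  shows "lacunary chi (iter_deriv (replicate k b) (iter_deriv (replicate k b) (ann 1))) (real k)"
proof unfold_locales
  let ?R = "replicate k b"
  let ?z = "iter_deriv ?R (ann 1)"
  let ?eta = "iter_deriv ?R ?z"
  have R: "set ?R \<subseteq> Basis" using b by auto
  have a: "ann 1 \<in> schwartz" by (rule ann_schwartz) simp
  have z: "?z \<in> schwartz" by (rule schwartz_iter_deriv[OF a R])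
  show eta: "?eta \<in> schwartz" by (rule schwartz_iter_deriv[OF z R])
  show "?eta \<xi> = 0" if "norm \<xi> > 2 \<or> norm \<xi> \<le> 1 / 2" for \<xi>
    using iter_deriv_ann_eq_0[OF that, of "?R @ ?R"] by (simp only: iter_deriv_append)
  let ?I = "LINT \<xi>|lborel. norm (?z \<xi>)"
  \<comment> \<open>With at least one derivative the profile is a total derivative, so the term with
    \<open>h 0\<close> drops out before the integration by parts.\<close>
  have mean: "(LINT \<xi>|lborel. ?eta \<xi>) = 0"
  proof -
    obtain k' where k': "k = Suc k'" using k by (cases k) auto
    have "?eta = pd b (iter_deriv (replicate k' b) ?z)" by (simp only: k' replicate_Suc iter_deriv_Cons)
    moreover have "iter_deriv (replicate k' b) ?z \<in> schwartz" using b by (intro schwartz_iter_deriv[OF z]) auto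
    ultimately show ?thesis by (simp only: integral_pd_eq_0[OF _ b])
  qed
  have "norm (LINT \<xi>|lborel. ?eta \<xi> * (h ((1 / c) *\<^sub>R \<xi>) - h 0)) \<le> ?I * c powr - real k * schwartz_seminorm k h"
    if h: "h \<in> schwartz" and c: "1 \<le> c" for h c
  proof -
    have hc: "(\<lambda>\<xi>. h ((1 / c) *\<^sub>R \<xi>)) \<in> schwartz" using c by (intro schwartz_dilate h) simp
    have zc: "(\<lambda>\<xi>. iter_deriv ?R h ((1 / c) *\<^sub>R \<xi>)) \<in> schwartz"
      using c by (intro schwartz_dilate schwartz_iter_deriv h R) simp
    have ck: "(1 / c) ^ k = c powr - real k"
      using c by (simp add: powr_minus_divide powr_realpow power_one_over)
    have "(LINT \<xi>|lborel. ?eta \<xi> * (h ((1 / c) *\<^sub>R \<xi>) - h 0)) = (LINT \<xi>|lborel. ?eta \<xi> * h ((1 / c) *\<^sub>R \<xi>))"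
    proof -
      have 1: "integrable lborel (\<lambda>\<xi>. ?eta \<xi> * h ((1 / c) *\<^sub>R \<xi>))"
        by (intro schwartz_integrable schwartz_mult eta hc)
      have 2: "integrable lborel (\<lambda>\<xi>. ?eta \<xi> * h 0)" by (intro integrable_mult_left schwartz_integrable eta)
      show ?thesis
        unfolding right_diff_distrib Bochner_Integration.integral_diff[OF 1 2] integral_mult_left_zero mean by simp
    qed
    also have "\<dots> = (- 1) ^ k * (LINT \<xi>|lborel. ?z \<xi> * (of_real ((1 / c) ^ k) * iter_deriv ?R h ((1 / c) *\<^sub>R \<xi>)))"
      unfolding integral_iter_deriv[OF z hc b] iter_deriv_dilate[OF h R] by simp
    finally have "norm (LINT \<xi>|lborel. ?eta \<xi> * (h ((1 / c) *\<^sub>R \<xi>) - h 0)) =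
        norm (LINT \<xi>|lborel. ?z \<xi> * (of_real ((1 / c) ^ k) * iter_deriv ?R h ((1 / c) *\<^sub>R \<xi>)))"
      by (simp add: norm_mult norm_power)
    also have "\<dots> \<le> (LINT \<xi>|lborel. norm (?z \<xi>) * (c powr - real k * schwartz_seminorm k h))"
    proof (rule order_trans[OF integral_norm_bound], rule integral_mono)
      fix \<xi>
      have "norm (iter_deriv ?R h ((1 / c) *\<^sub>R \<xi>)) \<le> schwartz_seminorm k h"
        using seminorm_ge[OF h R, of k 0 "(1 / c) *\<^sub>R \<xi>"] by simp
      then show "norm (?z \<xi> * (of_real ((1 / c) ^ k) * iter_deriv ?R h ((1 / c) *\<^sub>R \<xi>))) \<le>
          norm (?z \<xi>) * (c powr - real k * schwartz_seminorm k h)"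
        unfolding ck norm_mult norm_of_real by (auto intro!: mult_left_mono)
    next
      show "integrable lborel (\<lambda>\<xi>. norm (?z \<xi> * (of_real ((1 / c) ^ k) * iter_deriv ?R h ((1 / c) *\<^sub>R \<xi>))))"
        by (intro integrable_norm schwartz_integrable schwartz_mult z schwartz_scale zc)
      show "integrable lborel (\<lambda>\<xi>. norm (?z \<xi>) * (c powr - real k * schwartz_seminorm k h))"
        by (intro integrable_mult_left integrable_norm schwartz_integrable z)
    qed
    also have "\<dots> = ?I * (c powr - real k * schwartz_seminorm k h)" by (rule integral_mult_left_zero)
    finally show ?thesis by (simp add: mult_ac)
  qed
  moreover have "0 \<le> ?I" by (intro integral_nonneg_AE) auto
  ultimately show "\<exists>C\<ge>0. \<exists>j. \<forall>h\<in>schwartz. \<forall>c\<ge>1.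
      norm (LINT \<xi>|lborel. ?eta \<xi> * (h ((1 / c) *\<^sub>R \<xi>) - h 0)) \<le> C * c powr - real k * schwartz_seminorm j h"
    by blast
qed

text \<open>The reason for \<open>2 * k\<close> derivatives in the profile: moving half of them onto
  \<open>ann 1\<close> leaves, up to sign, the integral of a real square. That square is not
  identically zero, since a Schwartz function with vanishing \<open>k\<close>-th derivative along
  \<open>b\<close> is zero.\<close>

lemma deriv_integral_nonzero:
  assumes b: "b \<in> Basis"
  shows "(LINT \<xi>|lborel. iter_deriv (replicate k b) (iter_deriv (replicate k b) (ann 1)) \<xi> * ann 1 \<xi>) \<noteq> 0"
proof -
  let ?R = "replicate k b"
  have R: "set ?R \<subseteq> Basis" using b by auto
  have a: "ann 1 \<in> schwartz" by (rule ann_schwartz) simp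
  have z: "iter_deriv ?R (ann 1) \<in> schwartz" by (rule schwartz_iter_deriv[OF a R])
  \<comment> \<open>\<open>iter_deriv_of_real\<close> asks for smoothness of the real-valued
    function; it is recovered from the real part of the Schwartz function
    \<open>ann 1\<close>.\<close>
  have sm: "smooth (\<lambda>\<xi>. dyadic chi (1 *\<^sub>R \<xi>))"
  proof -
    have "smooth (\<lambda>x. Re (ann 1 x))"
    proof (rule smoothI[where A = "{\<lambda>x. Re (f x) | f. f \<in> schwartz}"])
      show "(\<lambda>x. Re (ann 1 x)) \<in> {\<lambda>x. Re (f x) | f. f \<in> schwartz}"
        by (intro CollectI exI[of _ "ann 1"] conjI refl a)
      fix g :: "'a \<Rightarrow> real" assume "g \<in> {\<lambda>x. Re (f x) | f. f \<in> schwartz}"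
      then obtain f where g: "g = (\<lambda>x. Re (f x))" and f: "f \<in> schwartz" by blast
      have d: "(g has_derivative (\<lambda>h. Re (pd h f x))) (at x)" for x
        unfolding g by (intro has_derivative_Re has_derivative_pd schwartz_differentiable f)
      then show "g differentiable at x" for x by (auto simp: differentiable_def)
      have "pd c g = (\<lambda>x. Re (pd c f x))" for c using pd_eq[OF d] by fast
      then show "pd c g \<in> {\<lambda>x. Re (f x) | f. f \<in> schwartz}" if "c \<in> Basis" for c
        using schwartz_pd[OF f that] by auto
    qed
    then show ?thesis by simp
  qed
  let ?g = "iter_deriv ?R (\<lambda>\<xi>. dyadic chi (1 *\<^sub>R \<xi>))"
  have zg: "iter_deriv ?R (ann 1) = (\<lambda>x. of_real (?g x))" by (rule iter_deriv_of_real[OF sm R])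
  have "\<exists>x. ?g x \<noteq> 0"
  proof (rule ccontr)
    assume "\<not> (\<exists>x. ?g x \<noteq> 0)"
    then have "iter_deriv ?R (ann 1) x = 0" for x unfolding zg by simp
    from iter_deriv_eq_0_imp[OF a b this] dyadic_nonzero show False by simp
  qed
  then obtain x where "?g x \<noteq> 0" by blast
  from integral_real_square_nonzero[OF z[unfolded zg] this]
  show ?thesis unfolding integral_iter_deriv[OF z a b] unfolding zg by simp
qed

end

section \<open>Closedness and density\<close>

lemma exponent_recip: "1 \<le> p \<Longrightarrow> ereal d / p = ereal (d * recip p)"
  by (erule exponent_cases) auto

context littlewood_paley
begin

section \<open>Failure of closedness\<close>

lemma not_closedin_besov_h:
  assumes p: "1 \<le> p" and r: "1 \<le> r" and s: "DIM('a) * recip p < s \<or> DIM('a) * recip p = s \<and> 1 < r"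
  shows "\<not> closedin (besov_topology chi s p r) (besov_h chi s p r)"
proof
  assume closed: "closedin (besov_topology chi s p r) (besov_h chi s p r)"
  define eta where "eta = (\<lambda>\<xi>. ann 1 \<xi> * ann 1 \<xi>)"
  interpret lacunary chi eta 1 unfolding eta_def by (rule lacunary_square)
  let ?E = "LINT \<xi>|lborel. eta \<xi>"
  have E: "?E \<noteq> 0" unfolding eta_def by (rule square_integral_nonzero)
  obtain e where e: "\<And>\<epsilon>. \<epsilon> > 0 \<Longrightarrow> \<exists>n. e n < \<epsilon>"
    "\<And>a n. (\<And>k. k < n \<Longrightarrow> a k = 0) \<Longrightarrow> (\<And>k. \<bar>a k\<bar> \<le> 1 / (real k + 1)) \<Longrightarrow>
      besov_norm_rep chi s p r (lac a) \<le> ennreal (e n)"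
    using besov_norm_lac_harmonic[OF p r s] by metis
  have adm: "admissible a" if "\<And>k. \<bar>a k\<bar> \<le> 1 / (real k + 1)" for a
    unfolding admissible_def
  proof (rule summable_comparison_test'[where N = 0])
    show "summable (\<lambda>k. freq k powr - 1)" by (rule freq_powr_summable) simp
    fix k
    have "\<bar>a k\<bar> \<le> 1" using that[of k] by (rule order_trans) simp
    then have "\<bar>a k\<bar> * freq k powr - 1 \<le> 1 * freq k powr - 1" by (rule mult_right_mono) simp
    then show "norm (\<bar>a k\<bar> * freq k powr - 1) \<le> freq k powr - 1" by simp
  qed
  have besov: "poly_class (lac a) \<in> besov chi s p r" if "\<And>k. \<bar>a k\<bar> \<le> 1 / (real k + 1)" for a
  proof (rule poly_class_besov[OF lac_tempered[OF adm[OF that]]])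
    have "besov_norm_rep chi s p r (lac a) \<le> ennreal (e 0)" by (rule e(2)) (use that in auto)
    also have "\<dots> < \<infinity>" by simp
    finally show "besov_norm_rep chi s p r (lac a) < \<infinity>" .
  qed
  define a where "a k = 1 / (real k + 1)" for k
  define b where "b n k = (if k < n then a k else 0)" for n k
  have a: "\<bar>a k\<bar> \<le> 1 / (real k + 1)" and b: "\<bar>b n k\<bar> \<le> 1 / (real k + 1)"
    and ba: "\<bar>b n k - a k\<bar> \<le> 1 / (real k + 1)" for n k
    by (auto simp: a_def b_def)
  let ?X = "poly_class (lac a)"
  have "?X \<notin> besov_h chi s p r"
  proof
    assume "?X \<in> besov_h chi s p r"
    then obtain v where "v \<in> ?X" "v \<in> tempered_h chi" by (auto simp: besov_h_def)
    from partial_sums_converge[OF adm[OF a] this]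
    have "convergent (\<lambda>n. (\<Sum>k\<le>n. complex_of_real (a k)) * ?E)" .
    then have "convergent (\<lambda>n. \<Sum>k\<le>n. complex_of_real (a k))"
      by (rule convergent_mult_const_right_iff[OF E, THEN iffD1])
    then have "summable (\<lambda>k. complex_of_real (a k))" by (simp only: summable_iff_convergent')
    then have "summable (\<lambda>k. inverse (of_nat (Suc k)) :: complex)"
      by (simp add: a_def inverse_eq_divide add.commute)
    then have "summable (\<lambda>k. inverse (of_nat k) :: complex)" by (subst (asm) summable_Suc_iff)
    then show False using not_summable_harmonic by blast
  qed
  then have X: "?X \<in> besov chi s p r - besov_h chi s p r" using besov[OF a] by blast
  have "besov_open chi s p r (besov chi s p r - besov_h chi s p r)"
    using closed by (simp add: closedin_def topspace_besov_topology openin_besov_topology)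
  from this X obtain \<epsilon> where \<epsilon>: "\<epsilon> > 0" "\<And>Y. Y \<in> besov chi s p r \<Longrightarrow>
      besov_norm chi s p r (class_diff Y ?X) < \<epsilon> \<Longrightarrow> Y \<in> besov chi s p r - besov_h chi s p r"
    by (rule besov_openE) blast
  \<comment> \<open>The radius of the neighbourhood lies in \<open>ennreal\<close> and may be
    infinite, so a finite positive number below it is chosen.\<close>
  obtain \<delta> :: real where \<delta>: "\<delta> > 0" "ennreal \<delta> \<le> \<epsilon>"
  proof (cases \<epsilon>)
    case (real x)
    then show thesis using \<epsilon>(1) by (intro that[of x]) auto
  next
    case top
    then show thesis by (intro that[of 1]) auto
  qed
  obtain n where n: "e n < \<delta>" using e(1)[OF \<delta>(1)] by blast
  let ?Y = "poly_class (lac (b n))"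
  have Y: "?Y \<in> besov chi s p r" by (rule besov[OF b])
  have "besov_norm chi s p r (class_diff ?Y ?X) = besov_norm_rep chi s p r (tempered_diff (lac (b n)) (lac a))"
    by (intro besov_norm_class_diff poly_class_mod_poly poly_class_self lac_tempered adm[OF a] adm[OF b])
  also have "\<dots> = besov_norm_rep chi s p r (lac (\<lambda>k. b n k - a k))"
    unfolding lac_diff[OF adm[OF b] adm[OF a]] ..
  also have "\<dots> \<le> ennreal (e n)" by (rule e(2)[OF _ ba]) (simp add: b_def)
  also have "\<dots> < ennreal \<delta>" using n \<delta>(1) by (rule ennreal_lessI[rotated])
  finally have "besov_norm chi s p r (class_diff ?Y ?X) < \<epsilon>" using \<delta>(2) by (rule less_le_trans)
  then have "?Y \<notin> besov_h chi s p r" using \<epsilon>(2)[OF Y] by blast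
  moreover have "\<exists>v\<in>?Y. v \<in> tempered_h chi"
    by (rule finite_lac_tempered_h[OF adm[OF b], of n]) (simp add: b_def)
  ultimately show False using Y by (simp add: besov_h_def)
qed

section \<open>Failure of density for infinite summation exponent\<close>

lemma low_mult_low_1: "t \<ge> 2 \<Longrightarrow> low t \<xi> * low 1 \<xi> = low t \<xi>"
proof (cases "t * norm \<xi> > 2")
  case False
  assume t: "t \<ge> 2"
  then have "2 * norm \<xi> \<le> t * norm \<xi>" by (intro mult_right_mono) auto
  then have "1 * norm \<xi> \<le> 1" using False by linarith
  then show ?thesis using low_eq_1[of 1 \<xi>] by simp
qed (use low_eq_0[of t \<xi>] in auto)

text \<open>The annulus is a difference of cutoffs at scales \<open>freq k\<close> and
  \<open>2 * freq k\<close>. By \<open>low_mult_low_1\<close> each is a cutoff applied to the fixed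
  test function \<open>low 1\<close>, so both pairings tend to 0.\<close>

lemma tempered_h_hat_ann:
  assumes "v \<in> tempered_h chi"
  shows "(\<lambda>k. hat v (ann (freq k))) \<longlonglongrightarrow> 0"
proof -
  have v: "v \<in> tempered" using assms by (simp add: tempered_h_def)
  have lim: "(\<lambda>k. hat v (low (c * freq k))) \<longlonglongrightarrow> 0" if c: "c \<ge> 1" for c
  proof -
    have "(\<lambda>k. hat v (\<lambda>\<xi>. low (c * freq k) \<xi> * low 1 \<xi>)) \<longlonglongrightarrow> 0"
      by (rule filterlim_compose[OF tempered_h_hat[OF assms low_schwartz] freq_at_top]) (use c in auto)
    moreover have "low (c * freq k) \<xi> * low 1 \<xi> = low (c * freq k) \<xi>" for k \<xi>
    proof (rule low_mult_low_1)
      have "1 * freq k \<le> c * freq k" using c freq_ge(2)[of k] by (intro mult_right_mono) auto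
      then show "2 \<le> c * freq k" using freq_ge(1)[of k] by linarith
    qed
    ultimately show ?thesis by (simp only:)
  qed
  have "hat v (ann (freq k)) = hat v (low (1 * freq k)) - hat v (low (2 * freq k))" for k
    using freq_ge(2)[of k] unfolding ann_low by (subst hat_minus[OF v]) (auto intro!: low_schwartz)
  then show ?thesis using tendsto_diff[OF lim[of 1] lim[of 2]] by simp
qed

lemma not_dense_besov_h:
  assumes p: "1 \<le> p" and s: "DIM('a) * recip p \<le> s"
  shows "(besov_topology chi s p \<infinity>) closure_of (besov_h chi s p \<infinity>) \<noteq> besov chi s p \<infinity>"
proof -
  let ?D = "DIM('a) * recip p"
  let ?B = "besov chi s p \<infinity>"
  obtain b :: 'a where b: "b \<in> Basis" using nonempty_Basis by blast
  \<comment> \<open>The number of derivatives must exceed the growth exponent \<open>s - ?D\<close>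
    of the coefficients; the successor makes it positive, as \<open>lacunary_deriv\<close>
    requires.\<close>
  obtain K0 where "s - ?D < real K0" using reals_Archimedean2 by blast
  then have K: "s - ?D < real (Suc K0)" by simp
  define K where "K = Suc K0"
  define eta where "eta = iter_deriv (replicate K b) (iter_deriv (replicate K b) (ann 1))"
  interpret lacunary chi eta "real K"
    unfolding eta_def by (rule lacunary_deriv[OF b]) (simp add: K_def)
  let ?E = "LINT \<xi>|lborel. eta \<xi> * ann 1 \<xi>"
  have E: "?E \<noteq> 0" unfolding eta_def by (rule deriv_integral_nonzero[OF b])
  \<comment> \<open>The critical growth: it cancels the factor \<open>freq k powr (?D - s)\<close>
    of \<open>weighted_block_lac\<close>, so the weighted blocks are bounded and do not
    decay.\<close>
  define a where "a k = freq k powr (s - ?D)" for k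
  have adm: "admissible a"
  proof -
    have "\<bar>a k\<bar> * freq k powr - real K = freq k powr (s - ?D - real K)" for k
      by (simp only: a_def abs_of_nonneg powr_ge_zero powr_add[symmetric]) simp
    then show ?thesis unfolding admissible_def using K by (simp only: freq_powr_summable K_def)
  qed
  define X where "X = poly_class (lac a)"
  have X: "X \<in> ?B"
  proof -
    obtain C where C: "C > 0" "\<And>a k j. j \<in> {-1, 0, 1 :: int} \<Longrightarrow>
      ennreal (2 powr (of_int (j - 3 * (int k + 1)) * s)) * Lnorm_dist p (block chi (j - 3 * (int k + 1)) (lac a))
      \<le> ennreal (C * (\<bar>a k\<bar> * freq k powr (?D - s)))"
      using weighted_block_lac[OF p] by metis
    have "C * (\<bar>a k\<bar> * freq k powr (?D - s)) = C" for k
      using freq_ge(2)[of k] by (simp add: a_def flip: powr_add)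
    then have "besov_norm_rep chi s p \<infinity> (lac a) \<le> ennreal C"
      using C(2) by (intro besov_norm_lac_infinite_r[OF p]) metis
    also have "\<dots> < \<infinity>" by simp
    finally show ?thesis unfolding X_def by (rule poly_class_besov[OF lac_tempered[OF adm]])
  qed
  text \<open>An open neighbourhood of \<open>X\<close>: the low frequency blocks are at least as large as the
    norm allows, up to a constant, whereas those of elements of \<open>tempered_h\<close> tend to zero.\<close>
  define T where "T = {Y \<in> ?B. \<exists>u\<in>Y. \<exists>\<delta>>0. \<forall>k. \<delta> * freq k powr (s - ?D) \<le> norm (hat u (ann (freq k)))}"
  \<comment> \<open>The annulus at \<open>freq k\<close> is the middle block \<open>j = 0\<close> of
    bump \<open>k\<close>.\<close>
  have "hat (lac a) (ann (freq k)) = of_real (a k) * ?E" for k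
  proof -
    have f: "freq k / 2 > 0" using freq_ge(2)[of k] by simp
    have "hat (lac a) (\<lambda>\<xi>. ann (2 powi (- (- 3 * (int k + 1)))) \<xi> * low (freq k / 2) \<xi>) = of_real (a k) *
        (LINT \<xi>|lborel. eta \<xi> * ann (2 powi (- (- 3 * (int k + 1) + 3 * (int k + 1)))) \<xi> * low (freq k / 2) ((1 / freq k) *\<^sub>R \<xi>))"
      using f by (intro hat_lac_ann low_schwartz) auto
    also have "(\<lambda>\<xi>. ann (2 powi (- (- 3 * (int k + 1)))) \<xi> * low (freq k / 2) \<xi>) = ann (freq k)"
    proof -
      have "2 powi (- (- 3 * (int k + 1))) = freq k" by (simp only: freq_powi mult_minus_left minus_minus)
      then show ?thesis by (simp only: ann_low_half[OF freq_ge(2)])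
    qed
    also have "(LINT \<xi>|lborel. eta \<xi> * ann (2 powi (- (- 3 * (int k + 1) + 3 * (int k + 1)))) \<xi> * low (freq k / 2) ((1 / freq k) *\<^sub>R \<xi>)) = ?E"
    proof (intro Bochner_Integration.integral_cong refl)
      fix \<xi>
      have "low (freq k / 2) ((1 / freq k) *\<^sub>R \<xi>) = low (1 / 2) \<xi>" using freq_ge(2)[of k] by simp
      then show "eta \<xi> * ann (2 powi (- (- 3 * (int k + 1) + 3 * (int k + 1)))) \<xi> * low (freq k / 2) ((1 / freq k) *\<^sub>R \<xi>) = eta \<xi> * ann 1 \<xi>"
        using ann_low_half[of 1 \<xi>] by (simp add: mult.assoc)
    qed
    finally show ?thesis .
  qed
  then have "norm ?E * freq k powr (s - ?D) \<le> norm (hat (lac a) (ann (freq k)))" for k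
    by (simp add: norm_mult a_def)
  moreover have "lac a \<in> X" unfolding X_def by (rule poly_class_self[OF lac_tempered[OF adm]])
  moreover have "norm ?E > 0" using E by simp
  ultimately have XT: "X \<in> T" unfolding T_def using X by blast
  obtain C where C: "C > 0" "\<And>u m. ennreal (norm (hat u (ann (2 powi (- m))))) \<le>
    ennreal (C * 2 powr (of_int m * ?D)) * Lnorm_dist p (block chi m u)"
    by (rule hat_ann_bound[OF p]) blast
  \<comment> \<open>A small Besov norm controls the same pairings, with the same power of
    \<open>freq k\<close> that bounds them below for \<open>lac a\<close>; this makes the lower
    bound stable.\<close>
  have hat_le: "norm (hat u (ann (freq k))) \<le> C * \<epsilon> * freq k powr (s - ?D)"
    if u: "besov_norm_rep chi s p \<infinity> u < ennreal \<epsilon>" and \<epsilon>: "\<epsilon> > 0" for u \<epsilon> k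
  proof -
    define m where "m = - (3 * (int k + 1))"
    have "AE m in count_space UNIV. ennreal (2 powr (of_int m * s)) * Lnorm_dist p (block chi m u) \<le> besov_norm_rep chi s p \<infinity> u"
      unfolding besov_norm_rep_def Lnorm_infinity by (rule esssup_AE)
    then have "ennreal (2 powr (of_int m * s)) * Lnorm_dist p (block chi m u) \<le> ennreal \<epsilon>"
      using u by (auto simp: AE_count_space intro: order_trans[OF _ less_imp_le])
    then have "ennreal (2 powr (- of_int m * s)) * (ennreal (2 powr (of_int m * s)) * Lnorm_dist p (block chi m u))
        \<le> ennreal (2 powr (- of_int m * s)) * ennreal \<epsilon>"
      by (intro mult_left_mono) auto
    then have le: "Lnorm_dist p (block chi m u) \<le> ennreal (2 powr (- of_int m * s) * \<epsilon>)"
      using \<epsilon> by (simp add: ennreal_mult flip: mult.assoc) (simp flip: ennreal_mult powr_add)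
    have "ennreal (norm (hat u (ann (2 powi (- m))))) \<le> ennreal (C * 2 powr (of_int m * ?D)) * Lnorm_dist p (block chi m u)"
      by (rule C(2))
    also have "\<dots> \<le> ennreal (C * 2 powr (of_int m * ?D)) * ennreal (2 powr (- of_int m * s) * \<epsilon>)"
      by (intro mult_left_mono le) simp
    also have "\<dots> = ennreal (C * \<epsilon> * freq k powr (s - ?D))"
    proof -
      have "freq k powr (s - ?D) = 2 powr (of_int m * ?D) * 2 powr (- of_int m * s)"
        unfolding freq_powr m_def by (simp add: powr_powr algebra_simps flip: powr_add)
      then show ?thesis using C(1) \<epsilon> by (simp add: mult_ac flip: ennreal_mult)
    qed
    finally have "ennreal (norm (hat u (ann (2 powi (- m))))) \<le> ennreal (C * \<epsilon> * freq k powr (s - ?D))" .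
    moreover have "2 powi (- m) = freq k" by (simp only: m_def minus_minus freq_powi)
    ultimately have "ennreal (norm (hat u (ann (freq k)))) \<le> ennreal (C * \<epsilon> * freq k powr (s - ?D))"
      by (simp only:)
    then show ?thesis using C(1) \<epsilon> by (subst (asm) ennreal_le_iff) auto
  qed
  have "besov_open chi s p \<infinity> T"
    unfolding besov_open_def
  proof (intro conjI ballI)
    show "T \<subseteq> ?B" by (auto simp: T_def)
    fix Y assume "Y \<in> T"
    then obtain u \<delta> where Y: "Y \<in> ?B" and u: "u \<in> Y" and \<delta>: "\<delta> > 0"
      "\<And>k. \<delta> * freq k powr (s - ?D) \<le> norm (hat u (ann (freq k)))" by (auto simp: T_def)
    \<comment> \<open>Within this radius \<open>hat_le\<close> consumes at most half of the lower
      bound \<open>\<delta>\<close>.\<close>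
    define \<epsilon> where "\<epsilon> = \<delta> / (2 * C)"
    have \<epsilon>: "\<epsilon> > 0" using \<delta>(1) C(1) by (simp add: \<epsilon>_def)
    show "\<exists>\<epsilon>>0. \<forall>Z\<in>?B. besov_norm chi s p \<infinity> (class_diff Z Y) < \<epsilon> \<longrightarrow> Z \<in> T"
    proof (intro exI[of _ "ennreal \<epsilon>"] conjI ballI impI)
      show "0 < ennreal \<epsilon>" using \<epsilon> by simp
      fix Z assume Z: "Z \<in> ?B" and less: "besov_norm chi s p \<infinity> (class_diff Z Y) < ennreal \<epsilon>"
      obtain v where v: "v \<in> Z" using mod_poly_nonempty Z by (auto simp: besov_def)
      have "besov_norm_rep chi s p \<infinity> (tempered_diff v u) < ennreal \<epsilon>"
        using less besov_norm_class_diff[of Z Y v u s p \<infinity>] Z Y u v by (simp add: besov_def)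
      from hat_le[OF this \<epsilon>]
      have d: "norm (hat v (ann (freq k)) - hat u (ann (freq k))) \<le> \<delta> / 2 * freq k powr (s - ?D)" for k
        using C(1) by (simp add: hat_diff \<epsilon>_def)
      have "\<delta> / 2 * freq k powr (s - ?D) \<le> norm (hat v (ann (freq k)))" for k
      proof -
        have "\<delta> / 2 * freq k powr (s - ?D) + \<delta> / 2 * freq k powr (s - ?D) = \<delta> * freq k powr (s - ?D)"
          by (simp flip: distrib_right)
        then show ?thesis
          using \<delta>(2)[of k] d[of k] norm_triangle_ineq2[of "hat u (ann (freq k))" "hat v (ann (freq k))"]
          unfolding norm_minus_commute[of "hat v (ann (freq k))"] by linarith
      qed
      moreover have "\<delta> / 2 > 0" using \<delta>(1) by simp
      ultimately show "Z \<in> T" unfolding T_def using Z v by blast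
    qed
  qed
  moreover have "besov_h chi s p \<infinity> \<inter> T = {}"
  proof (rule ccontr)
    assume "besov_h chi s p \<infinity> \<inter> T \<noteq> {}"
    then obtain Y v u \<delta> where Y: "Y \<in> ?B" and v: "v \<in> Y" "v \<in> tempered_h chi" and u: "u \<in> Y"
      and \<delta>: "\<delta> > 0" "\<And>k. \<delta> * freq k powr (s - ?D) \<le> norm (hat u (ann (freq k)))"
      unfolding T_def besov_h_def by blast
    have "hat u (ann (freq k)) = hat v (ann (freq k))" for k
    proof (rule hat_eq_schwartz0[OF _ u v(1)])
      show "Y \<in> tempered_mod_poly" using Y by (simp add: besov_def)
      have "(\<lambda>\<xi>. ann (freq k) \<xi> * low (freq k / 2) \<xi>) \<in> schwartz0"
        using freq_ge(2)[of k] by (intro schwartz0_mult_ann low_schwartz) auto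
      then show "ann (freq k) \<in> schwartz0" unfolding ann_low_half[OF freq_ge(2)] .
    qed
    \<comment> \<open>Here \<open>?D \<le> s\<close> enters: the powers of \<open>freq k\<close> are
      at least 1, so the pairings stay above \<open>\<delta>\<close> instead of tending to
      0.\<close>
    moreover have "\<delta> * 1 \<le> \<delta> * freq k powr (s - ?D)" for k
      using \<delta>(1) s freq_ge(3)[of k] by (intro mult_left_mono ge_one_powr_ge_zero) auto
    ultimately have ge: "\<delta> \<le> norm (hat v (ann (freq k)))" for k
      using \<delta>(2)[of k] by (metis mult.right_neutral order_trans)
    obtain k where "norm (hat v (ann (freq k))) < \<delta>"
      using LIMSEQ_D[OF tempered_h_hat_ann[OF v(2)] \<delta>(1)] by auto
    with ge[of k] show False by simp
  qed
  ultimately have "X \<notin> (besov_topology chi s p \<infinity>) closure_of (besov_h chi s p \<infinity>)"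
    using XT unfolding in_closure_of openin_besov_topology by blast
  then show ?thesis using X by blast
qed

text \<open>Cutting off the frequencies below \<open>2^-n\<close> gives elements of \<open>tempered_h\<close>, and the norm of
  the removed part is a tail of a convergent series.\<close>

lemma dense_besov_h:
  assumes p: "1 \<le> p" and r: "1 \<le> r" "r < \<infinity>"
  shows "(besov_topology chi s p r) closure_of (besov_h chi s p r) = besov chi s p r"
proof (rule antisym)
  show "(besov_topology chi s p r) closure_of (besov_h chi s p r) \<subseteq> besov chi s p r"
    using closure_of_subset_topspace[of "besov_topology chi s p r"] by (simp only: topspace_besov_topology)
  show "besov chi s p r \<subseteq> (besov_topology chi s p r) closure_of (besov_h chi s p r)"
  proof
    fix X assume X: "X \<in> besov chi s p r"
    obtain q where q: "r = ereal q" "1 \<le> q" using r by (cases r) (auto simp: one_ereal_def)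
    have Xm: "X \<in> tempered_mod_poly" using X by (simp add: besov_def)
    obtain u where uX: "u \<in> X" using mod_poly_nonempty[OF Xm] by blast
    have u: "u \<in> tempered" by (rule mod_poly_tempered[OF Xm uX])
    define W where "W m = ennreal (2 powr (of_int m * s)) * Lnorm_dist p (block chi m u)" for m :: int
    have "besov_norm_rep chi s p r u = ennreal_powr (\<integral>\<^sup>+m. ennreal_powr (W m) q \<partial>count_space UNIV) (1 / q)"
      by (simp only: besov_norm_rep_def W_def q(1) Lnorm_ereal)
    moreover have "besov_norm_rep chi s p r u < top"
      using X besov_norm_eq[OF Xm uX] by (simp add: besov_def infinity_ennreal_def)
    ultimately have "ennreal_powr (\<integral>\<^sup>+m. ennreal_powr (W m) q \<partial>count_space UNIV) (1 / q) < top"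
      by (simp only:)
    then have W: "(\<integral>\<^sup>+m. ennreal_powr (W m) q \<partial>count_space UNIV) < top"
      by (rule ennreal_powr_less_top)
    obtain A where A: "A > 0" "\<And>t. t > 0 \<Longrightarrow> (LINT x|lborel. norm (inv_fourier (low t) x)) \<le> A"
      using low_kernel_L1 by metis
    define w where "w n = fourier_multiplier (low (2 ^ n)) u" for n :: nat
    define v where "v n = tempered_diff u (w n)" for n
    have low: "low (2 ^ n) \<in> schwartz" for n :: nat by (rule low_schwartz) simp
    have wt: "w n \<in> tempered" for n
      unfolding w_def by (intro fourier_multiplier_tempered schwartz_imp_slow low u)
    have vt: "v n \<in> tempered" for n unfolding v_def by (intro tempered_diff_tempered u wt)
    have hw: "hat (w n) f = hat u (\<lambda>\<xi>. low (2 ^ n) \<xi> * f \<xi>)" if "f \<in> schwartz" for n f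
      unfolding w_def by (intro hat_fourier_multiplier schwartz_imp_slow low that)
    have annS: "(\<lambda>\<xi>. ann (2 powi (- m)) \<xi> * f \<xi>) \<in> schwartz" if "f \<in> schwartz" for m f
      by (intro schwartz_mult ann_schwartz that) simp
    have bw: "block chi m (w n) f = hat u (\<lambda>\<xi>. low (2 ^ n) \<xi> * (ann (2 powi (- m)) \<xi> * inv_fourier f \<xi>))"
      if "f \<in> schwartz" for m n f
      unfolding block_eq[OF that] by (intro hw annS inv_fourier_schwartz that)
    have bd: "block chi m (tempered_diff x y) f = block chi m x f - block chi m y f" for m x y f
      by (simp only: block_diff tempered_diff_def[of "block chi m x"])
    have vh: "v n \<in> tempered_h chi" for n
    proof (rule tempered_hI[OF vt, of "2 * 2 ^ n"])
      fix f :: "'a \<Rightarrow> complex" and t :: real assume f: "f \<in> schwartz" and t: "t \<ge> 2 * 2 ^ n"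
      have t0: "t > 0" using t by (rule less_le_trans[rotated]) simp
      \<comment> \<open>When \<open>t\<close> is at least twice \<open>2 ^ n\<close>, the removed
        cutoff is 1 on the support of \<open>low t\<close>; the removed part then carries all of the
        low-frequency pairing.\<close>
      have e: "low (2 ^ n) \<xi> * (low t \<xi> * f \<xi>) = low t \<xi> * f \<xi>" for \<xi>
      proof (cases "t * norm \<xi> > 2")
        case False
        have "(2 * 2 ^ n) * norm \<xi> \<le> t * norm \<xi>" using t by (rule mult_right_mono) simp
        then have "2 ^ n * norm \<xi> \<le> 1" using False by simp
        then have "low (2 ^ n) \<xi> = 1" by (intro low_eq_1) auto
        then show ?thesis by (simp only: mult_1)
      next
        case True
        then have "low t \<xi> = 0" using t0 by (rule low_eq_0)
        then show ?thesis by (simp only: mult_zero_left mult_zero_right)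
      qed
      have g: "(\<lambda>\<xi>. low t \<xi> * f \<xi>) \<in> schwartz" using t0 by (intro schwartz_mult low_schwartz f) simp
      show "hat (v n) (\<lambda>\<xi>. low t \<xi> * f \<xi>) = 0" unfolding v_def hat_diff hw[OF g] e by simp
    qed
    have vb: "Lnorm_dist p (block chi m (v n)) \<le> ennreal (2 * A) * Lnorm_dist p (block chi m u)" for m n
    proof -
      let ?t = "2 powi (- m) / 2 :: real"
      \<comment> \<open>The true multiplier, 1 minus \<open>low (2 ^ n)\<close>, is not Schwartz. On
        the block the constant 1 may be replaced by \<open>low ?t\<close>, and the kernel becomes a
        difference of two kernels of L^1 norm at most \<open>A\<close>.\<close>
      let ?s = "\<lambda>\<xi>. low ?t \<xi> - low (2 ^ n) \<xi>"
      have lt: "low ?t \<in> schwartz" by (rule low_schwartz) simp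
      have sS: "?s \<in> schwartz" by (intro schwartz_diff lt low)
      show ?thesis
      proof (rule Lnorm_dist_multiplier[OF p sS])
        show "2 * A > 0" using A by simp
        have "inv_fourier ?s x = inv_fourier (low ?t) x - inv_fourier (low (2 ^ n)) x" for x
          using fun_cong[OF inv_fourier_schwartz_lincomb[OF lt low[of n], of 1 "-1"], of x] by simp
        then have "(LINT x|lborel. norm (inv_fourier ?s x)) \<le>
            (LINT x|lborel. norm (inv_fourier (low ?t) x) + norm (inv_fourier (low (2 ^ n)) x))"
          using sS lt low
          by (intro integral_mono integrable_norm Bochner_Integration.integrable_add schwartz_integrable inv_fourier_schwartz)
            (simp_all only: norm_triangle_ineq4)
        also have "\<dots> \<le> A + A"
        proof -
          have 1: "integrable lborel (\<lambda>x. norm (inv_fourier (low ?t) x))"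
            by (intro integrable_norm schwartz_integrable inv_fourier_schwartz lt)
          have 2: "integrable lborel (\<lambda>x. norm (inv_fourier (low (2 ^ n)) x))"
            by (intro integrable_norm schwartz_integrable inv_fourier_schwartz low)
          show ?thesis unfolding Bochner_Integration.integral_add[OF 1 2] by (intro add_mono A(2)) simp_all
        qed
        finally show "(LINT x|lborel. norm (inv_fourier ?s x)) \<le> 2 * A" by simp
      next
        fix f :: "'a \<Rightarrow> complex" assume f: "f \<in> schwartz"
        note h = inv_fourier_schwartz[OF f]
        let ?a = "\<lambda>\<xi>. ann (2 powi (- m)) \<xi> * inv_fourier f \<xi>"
        have "block chi m (v n) f = hat u ?a - hat u (\<lambda>\<xi>. low (2 ^ n) \<xi> * ?a \<xi>)"
          unfolding v_def bd bw[OF f] block_eq[OF f, of m u] ..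
        also have "\<dots> = hat u (\<lambda>\<xi>. ?a \<xi> - low (2 ^ n) \<xi> * ?a \<xi>)"
          by (rule hat_minus[OF u annS[OF h] schwartz_mult[OF low annS[OF h]], symmetric])
        also have "(\<lambda>\<xi>. ?a \<xi> - low (2 ^ n) \<xi> * ?a \<xi>) = (\<lambda>\<xi>. ann (2 powi (- m)) \<xi> * (?s \<xi> * inv_fourier f \<xi>))"
        proof
          fix \<xi>
          have 1: "ann (2 powi (- m)) \<xi> * low ?t \<xi> = ann (2 powi (- m)) \<xi>" by (rule ann_low_half) simp
          have 2: "x * ((y - z) * y') = (x * y) * y' - z * (x * y')" for x y z y' :: complex
            by (simp add: algebra_simps)
          show "?a \<xi> - low (2 ^ n) \<xi> * ?a \<xi> = ann (2 powi (- m)) \<xi> * (?s \<xi> * inv_fourier f \<xi>)"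
            unfolding 2 1 ..
        qed
        also have "hat u \<dots> = block chi m u (fourier (\<lambda>\<xi>. ?s \<xi> * inv_fourier f \<xi>))"
          by (rule block_fourier[symmetric]) (intro schwartz_mult sS h)
        finally show "block chi m (v n) f = block chi m u (fourier (\<lambda>\<xi>. ?s \<xi> * inv_fourier f \<xi>))" .
      qed
    qed
    have wb: "Lnorm_dist p (block chi m (tempered_diff (v n) u)) \<le> ennreal A * Lnorm_dist p (block chi m u)"
      and wb0: "m \<ge> 2 - int n \<Longrightarrow> Lnorm_dist p (block chi m (tempered_diff (v n) u)) = 0" for m n
    proof -
      \<comment> \<open>Minus the cutoff, spelled as a linear combination to match
        \<open>schwartz_lincomb\<close> and \<open>hat_linear\<close>.\<close>
      let ?s = "\<lambda>\<xi>. (- 1) * low (2 ^ n) \<xi> + 0 * low (2 ^ n) \<xi>"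
      have sS: "?s \<in> schwartz" by (intro schwartz_lincomb low)
      have eq: "block chi m (tempered_diff (v n) u) f = hat u (\<lambda>\<xi>. ann (2 powi (- m)) \<xi> * (?s \<xi> * inv_fourier f \<xi>))"
        if f: "f \<in> schwartz" for f
      proof -
        let ?a = "\<lambda>\<xi>. low (2 ^ n) \<xi> * (ann (2 powi (- m)) \<xi> * inv_fourier f \<xi>)"
        have a: "?a \<in> schwartz" by (intro schwartz_mult low annS inv_fourier_schwartz f)
        have "block chi m (tempered_diff (v n) u) f = (- 1) * hat u ?a + 0 * hat u ?a"
          unfolding v_def bd bw[OF f] by simp
        also have "\<dots> = hat u (\<lambda>\<xi>. (- 1) * ?a \<xi> + 0 * ?a \<xi>)" by (rule hat_linear[OF u a a, symmetric])
        also have "(\<lambda>\<xi>. (- 1) * ?a \<xi> + 0 * ?a \<xi>) = (\<lambda>\<xi>. ann (2 powi (- m)) \<xi> * (?s \<xi> * inv_fourier f \<xi>))"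
          by (simp add: mult_ac)
        finally show ?thesis .
      qed
      show "Lnorm_dist p (block chi m (tempered_diff (v n) u)) \<le> ennreal A * Lnorm_dist p (block chi m u)"
      proof (rule Lnorm_dist_multiplier[OF p sS _ _ A(1)])
        show "block chi m (tempered_diff (v n) u) f = block chi m u (fourier (\<lambda>\<xi>. ?s \<xi> * inv_fourier f \<xi>))"
          if f: "f \<in> schwartz" for f
          unfolding eq[OF f] by (rule block_fourier[symmetric]) (intro schwartz_mult sS inv_fourier_schwartz f)
        show "(LINT x|lborel. norm (inv_fourier ?s x)) \<le> A"
          unfolding inv_fourier_schwartz_lincomb[OF low low] using A(2)[of "2 ^ n"] by simp
      qed
      assume m: "m \<ge> 2 - int n"
      \<comment> \<open>The block lives where \<open>norm \<xi>\<close> exceeds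
        \<open>2 powi (m - 1)\<close>, the removed part where it is at most
        \<open>2 powi (1 - n)\<close>; these are disjoint once \<open>m \<ge> 2 - n\<close>.\<close>
      have z: "ann (2 powi (- m)) \<xi> * low (2 ^ n) \<xi> = 0" for \<xi>
      proof (cases "2 powi (- m) * norm \<xi> \<le> 1 / 2")
        case True
        then have "ann (2 powi (- m)) \<xi> = 0" by (intro ann_eq_0) auto
        then show ?thesis by (simp only: mult_zero_left)
      next
        case False
        have "(4::real) * 2 powi (- m) \<le> 2 ^ n"
        proof -
          have "(2::real) powi (2 + (- m)) \<le> 2 powi (int n)" using m by (intro power_int_increasing) auto
          moreover have "(2::real) powi (2 + (- m)) = 2 powi 2 * 2 powi (- m)" by (rule power_int_add) simp
          ultimately show ?thesis by simp
        qed
        then have "4 * 2 powi (- m) * norm \<xi> \<le> 2 ^ n * norm \<xi>" by (rule mult_right_mono) simp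
        with False have "2 ^ n * norm \<xi> > 2" by linarith
        then have "low (2 ^ n) \<xi> = 0" by (intro low_eq_0) auto
        then show ?thesis by (simp only: mult_zero_right)
      qed
      have z: "ann (2 powi (- m)) \<xi> * (?s \<xi> * x) = 0" for \<xi> x using z[of \<xi>] by auto
      have "block chi m (tempered_diff (v n) u) f = 0" for f
      proof (cases "f \<in> schwartz")
        case True
        show ?thesis unfolding eq[OF True] z by (rule hat_zero[OF u])
      qed (rule block_off_schwartz)
      then have "represents (\<lambda>x. 0) (block chi m (tempered_diff (v n) u))" by (simp add: represents_def)
      from Lnorm_dist_le[OF this, of p]
      show "Lnorm_dist p (block chi m (tempered_diff (v n) u)) = 0"
        by (simp add: Lnorm_zero[OF p])
    qed
    have Y: "poly_class (v n) \<in> besov_h chi s p r" for n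
    proof -
      have "(\<integral>\<^sup>+m. ennreal_powr (ennreal (2 powr (of_int m * s)) * Lnorm_dist p (block chi m (v n))) q \<partial>count_space UNIV)
        \<le> (\<integral>\<^sup>+m. ennreal ((2 * A) powr q) * ennreal_powr (W m) q \<partial>count_space UNIV)"
      proof (rule nn_integral_mono)
        fix m :: int
        have "ennreal (2 powr (of_int m * s)) * Lnorm_dist p (block chi m (v n)) \<le> ennreal (2 * A) * W m"
          unfolding W_def using mult_left_mono[OF vb[of m n], of "ennreal (2 powr (of_int m * s))"]
          by (simp only: mult_ac) simp
        then have "ennreal_powr (ennreal (2 powr (of_int m * s)) * Lnorm_dist p (block chi m (v n))) q \<le> ennreal_powr (ennreal (2 * A) * W m) q"
          using q by (intro ennreal_powr_mono) auto
        then show "ennreal_powr (ennreal (2 powr (of_int m * s)) * Lnorm_dist p (block chi m (v n))) q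
            \<le> ennreal ((2 * A) powr q) * ennreal_powr (W m) q"
          using A(1) q by (subst (asm) ennreal_powr_mult) auto
      qed
      also have "\<dots> < top" using W by (simp add: nn_integral_cmult ennreal_mult_less_top)
      finally have "besov_norm_rep chi s p r (v n) < \<infinity>"
        unfolding besov_norm_rep_def q(1) Lnorm_ereal infinity_ennreal_def by (rule ennreal_powr_less_topI)
      from poly_class_besov[OF vt this] show ?thesis
        using poly_class_self[OF vt] vh by (auto simp: besov_h_def)
    qed
    let ?I = "\<lambda>n. \<integral>\<^sup>+m. ennreal_powr (W m) q * indicator {m. m < 2 - int n} m \<partial>count_space UNIV"
    have norm_le: "besov_norm chi s p r (class_diff (poly_class (v n)) X) \<le> ennreal_powr (ennreal (A powr q) * ?I n) (1 / q)" for n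
    proof -
      have "besov_norm chi s p r (class_diff (poly_class (v n)) X) = besov_norm_rep chi s p r (tempered_diff (v n) u)"
        by (intro besov_norm_class_diff poly_class_mod_poly poly_class_self vt Xm uX)
      also have "\<dots> \<le> ennreal_powr (\<integral>\<^sup>+m. ennreal (A powr q) * (ennreal_powr (W m) q * indicator {m. m < 2 - int n} m) \<partial>count_space UNIV) (1 / q)"
        unfolding besov_norm_rep_def q(1) Lnorm_ereal
      proof (intro ennreal_powr_mono nn_integral_mono)
        fix m :: int
        show "ennreal_powr (ennreal (2 powr (of_int m * s)) * Lnorm_dist p (block chi m (tempered_diff (v n) u))) q
            \<le> ennreal (A powr q) * (ennreal_powr (W m) q * indicator {m. m < 2 - int n} m)"
        proof (cases "m < 2 - int n")
          case True
          have "ennreal (2 powr (of_int m * s)) * Lnorm_dist p (block chi m (tempered_diff (v n) u)) \<le> ennreal A * W m"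
            unfolding W_def using mult_left_mono[OF wb[of m n], of "ennreal (2 powr (of_int m * s))"]
            by (simp only: mult_ac) simp
          then have "ennreal_powr (ennreal (2 powr (of_int m * s)) * Lnorm_dist p (block chi m (tempered_diff (v n) u))) q \<le> ennreal_powr (ennreal A * W m) q"
            using q by (intro ennreal_powr_mono) auto
          then show ?thesis using A(1) q True by (subst (asm) ennreal_powr_mult) auto
        next
          case False
          then show ?thesis using wb0[of n m] by simp
        qed
      qed (use q in auto)
      also have "\<dots> = ennreal_powr (ennreal (A powr q) * ?I n) (1 / q)" by (simp add: nn_integral_cmult)
      finally show ?thesis .
    qed
    \<comment> \<open>Here \<open>r < \<infinity>\<close> is decisive: the finite norm of
      \<open>X\<close> gives a summable majorant, and each fixed \<open>m\<close> leaves the tail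
      eventually.\<close>
    have "?I \<longlonglongrightarrow> (\<integral>\<^sup>+m. 0 \<partial>count_space (UNIV :: int set))"
    proof (rule nn_integral_dominated_convergence[where w = "\<lambda>m. ennreal_powr (W m) q"])
      show "AE m in count_space UNIV. ennreal_powr (W m) q * indicator {m. m < 2 - int n} m \<le> ennreal_powr (W m) q" for n
        by (auto simp: indicator_def)
      show "AE m in count_space UNIV. (\<lambda>n. ennreal_powr (W m) q * indicator {m. m < 2 - int n} m) \<longlonglongrightarrow> 0"
      proof (rule AE_I2)
        fix m :: int
        have "\<forall>\<^sub>F n in sequentially. 0 = ennreal_powr (W m) q * indicator {m. m < 2 - int n} m"
          using eventually_ge_at_top[of "nat (2 - m)"] by eventually_elim (auto simp: indicator_def)
        then show "(\<lambda>n. ennreal_powr (W m) q * indicator {m. m < 2 - int n} m) \<longlonglongrightarrow> 0"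
          by (rule Lim_transform_eventually[OF tendsto_const])
      qed
    qed (use W in auto)
    then have I0: "?I \<longlonglongrightarrow> 0" by simp
    show "X \<in> (besov_topology chi s p r) closure_of (besov_h chi s p r)"
      unfolding in_closure_of topspace_besov_topology openin_besov_topology
    proof (intro conjI X allI impI)
      fix T assume "X \<in> T \<and> besov_open chi s p r T"
      then obtain \<epsilon> where \<epsilon>: "\<epsilon> > 0" "\<And>Y. Y \<in> besov chi s p r \<Longrightarrow>
          besov_norm chi s p r (class_diff Y X) < \<epsilon> \<Longrightarrow> Y \<in> T"
        using besov_openE by metis
      obtain \<delta> :: real where \<delta>: "\<delta> > 0" "ennreal \<delta> \<le> \<epsilon>"
      proof (cases \<epsilon>)
        case (real x)
        then show thesis using \<epsilon>(1) by (intro that[of x]) auto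
      next
        case top
        then show thesis by (intro that[of 1]) auto
      qed
      \<comment> \<open>Solved from the bound \<open>norm_le\<close>: with this value the right side
        becomes \<open>\<delta> / 2\<close>.\<close>
      define \<eta> where "\<eta> = (\<delta> / 2 / A) powr q"
      have \<eta>: "\<eta> > 0" using \<delta>(1) A(1) by (simp add: \<eta>_def)
      obtain n where n: "?I n < ennreal \<eta>"
        using order_tendstoD(2)[OF I0, of "ennreal \<eta>"] \<eta> by (auto simp: eventually_sequentially)
      have "besov_norm chi s p r (class_diff (poly_class (v n)) X) \<le> ennreal_powr (ennreal (A powr q) * ennreal \<eta>) (1 / q)"
        using q n by (intro order_trans[OF norm_le] ennreal_powr_mono mult_left_mono) auto
      also have "ennreal (A powr q) * ennreal \<eta> = ennreal ((\<delta> / 2) powr q)"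
        using A(1) \<delta>(1) by (simp add: \<eta>_def powr_divide powr_mult flip: ennreal_mult)
      also have "ennreal_powr \<dots> (1 / q) = ennreal (\<delta> / 2)" using \<delta>(1) q by (simp add: powr_powr)
      also have "\<dots> < ennreal \<delta>" using \<delta>(1) by (intro ennreal_lessI) auto
      also have "\<dots> \<le> \<epsilon>" by (rule \<delta>(2))
      finally have "poly_class (v n) \<in> T" using \<epsilon>(2) Y[of n] by (simp add: besov_h_def)
      then show "\<exists>Y. Y \<in> besov_h chi s p r \<and> Y \<in> T" using Y by blast
    qed
  qed
qed

end

theorem theorem13:
  fixes chi :: "'a::euclidean_space \<Rightarrow> real" and s :: real and p r :: ereal
  assumes "cutoff chi"
    and "1 \<le> p" and "1 \<le> r"
    and "ereal (real DIM('a)) / p < ereal s \<or> (ereal s = ereal (real DIM('a)) / p \<and> 1 < r)"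
  shows "\<not> closedin (besov_topology chi s p r) (besov_h chi s p r) \<and>
    ((besov_topology chi s p r) closure_of (besov_h chi s p r) = besov chi s p r \<longleftrightarrow> r < \<infinity>)"
proof -
  interpret littlewood_paley chi by unfold_locales (rule assms(1))
  have s: "DIM('a) * recip p < s \<or> DIM('a) * recip p = s \<and> 1 < r"
    using assms(4) by (auto simp: exponent_recip[OF assms(2)])
  show ?thesis
  proof (intro conjI iffI)
    show "\<not> closedin (besov_topology chi s p r) (besov_h chi s p r)"
      by (rule not_closedin_besov_h[OF assms(2,3) s])
    show "r < \<infinity>" if "(besov_topology chi s p r) closure_of (besov_h chi s p r) = besov chi s p r"
      using not_dense_besov_h[OF assms(2), of s] s that by (cases "r = \<infinity>") auto
    show "(besov_topology chi s p r) closure_of (besov_h chi s p r) = besov chi s p r" if "r < \<infinity>"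
      by (rule dense_besov_h[OF assms(2,3) that])
  qed
qed

end
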